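(* Let $\pi:\mathbb{L}\to M$ be a bundle of Lie algebras with fiber $\mathfrak{k}$ and let $k\in\mathbb{N}\cup\{\infty\}$, $\mathbb{N}=\{0,1,2,\dots\}$. If $\mathfrak{k}$ is perfect or centerfree, then $\operatorname{Cent}(\Gamma^k(\mathbb{L}))\cong\Gamma^k(\operatorname{Cent}(\mathbb{L}))$ as associative algebras.
   Context: All vector spaces and linear maps are over $\mathbb{K}\in\{\mathbb{R},\mathbb{C}\}$. A manifold is smooth, finite-dimensional over $\mathbb{R}$, Hausdorff, paracompact and connected. A Lie algebra $\mathfrak{g}$ is perfect if $[\mathfrak{g},\mathfrak{g}]=\mathfrak{g}$, and centerfree if its center is $0$. The centroid of a Lie algebra $\mathfrak{g}$ is the associative algebra $\operatorname{Cent}(\mathfrak{g})=\{f\in\operatorname{End}(\mathfrak{g}): f[x,y]=[x,f(y)]\ \forall x,y\in\mathfrak{g}\}$ under composition. Let $\mathfrak{k}$ be a finite-dimensional Lie algebra over $\mathbb{K}$. A bundle of Lie algebras $\pi:\mathbb{L}\to M$ with fiber $\mathfrak{k}$ is a smooth vector bundle with fiber $\mathfrak{k}$ over a manifold $M$ together with a bundle atlas whose transition maps take values in $\operatorname{Aut}(\mathfrak{k})$; each fiber $\mathbb{L}_x$ carries the Lie bracket for which bundle charts restrict to Lie algebra isomorphisms $\mathbb{L}_x\to\mathfrak{k}$. $\Gamma^k(\mathbb{L})$ is the Lie algebra of $C^k$-sections with pointwise bracket. $\operatorname{Cent}(\mathbb{L})$ is the smooth subbundle of $\operatorname{Hom}(\mathbb{L},\mathbb{L})$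 (fibers $\operatorname{End}(\mathbb{L}_x)$) with fibers $\operatorname{Cent}(\mathbb{L}_x)$; $\Gamma^k(\operatorname{Cent}(\mathbb{L}))$ is the associative algebra of its $C^k$-sections under pointwise composition. *)

theory Defs
  imports
    "HOL-Analysis.Analysis"
    "HOL-Algebra.Module"
    "HOL-Algebra.QuotRing"
begin

section \<open>The ground field\<close>

text \<open>
  Up to isomorphism of real algebras, the types of this class are exactly \<^typ>\<open>real\<close> and
  \<^typ>\<open>complex\<close>. A type variable of this class renders a ground field that is either of the two.
\<close>

class real_or_complex = real_field +
  assumes real_or_complex:
    "(\<forall>z. \<exists>a. z = a *\<^sub>R 1) \<or>
     (\<exists>i. i * i = - 1 \<and> (\<forall>z. \<exists>a b. z = a *\<^sub>R 1 + b *\<^sub>R i))"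

instance real :: real_or_complex
  by standard auto

instance complex :: real_or_complex
proof
  have "\<exists>a b. z = a *\<^sub>R 1 + b *\<^sub>R \<i>" for z
    by (intro exI[of _ "Re z"] exI[of _ "Im z"]) (simp add: complex_eq_iff)
  moreover have "\<i> * \<i> = - 1" by simp
  ultimately show "(\<forall>z. \<exists>a. z = a *\<^sub>R (1::complex)) \<or>
     (\<exists>i::complex. i * i = - 1 \<and> (\<forall>z. \<exists>a b. z = a *\<^sub>R 1 + b *\<^sub>R i))"
    by blast
qed


section \<open>Differentiability classes\<close>

text \<open>
  The domain is meant to be open and finite-dimensional. Then the derivative at \<open>x\<close> is determined
  by, and is as regular as, its values in all fixed directions \<open>v\<close>, so the recursion avoids
  iterated spaces of linear maps.
\<close>

primrec times_cont_differentiable_on ::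
    "nat \<Rightarrow> 'a::real_normed_vector set \<Rightarrow> ('a \<Rightarrow> 'b::real_normed_vector) \<Rightarrow> bool" where
  "times_cont_differentiable_on 0 S f \<longleftrightarrow> continuous_on S f"
| "times_cont_differentiable_on (Suc n) S f \<longleftrightarrow>
     (\<forall>x\<in>S. f differentiable (at x)) \<and>
     (\<forall>v. times_cont_differentiable_on n S (\<lambda>x. frechet_derivative f (at x) v))"

definition Ck_on ::
    "enat \<Rightarrow> 'a::real_normed_vector set \<Rightarrow> ('a \<Rightarrow> 'b::real_normed_vector) \<Rightarrow> bool" where
  "Ck_on k S f \<longleftrightarrow> (\<forall>n. enat n \<le> k \<longrightarrow> times_cont_differentiable_on n S f)"


section \<open>Manifolds\<close>

text \<open>
  Model spaces (of manifolds, and later the fiber of a bundle) are types of class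
  \<^class>\<open>real_normed_vector\<close> that are finite-dimensional. Unlike \<^class>\<open>euclidean_space\<close> this
  permits dimension 0. The choice of the norm is immaterial.
\<close>

definition finite_dimensional_type :: "'a::real_normed_vector itself \<Rightarrow> bool" where
  "finite_dimensional_type _ \<longleftrightarrow> (\<exists>B :: 'a set. finite B \<and> span B = UNIV)"

definition paracompact_type :: "'m::topological_space itself \<Rightarrow> bool" where
  "paracompact_type _ \<longleftrightarrow>
     (\<forall>\<C> :: 'm set set. (\<forall>U\<in>\<C>. open U) \<and> \<Union>\<C> = UNIV \<longrightarrow>
        (\<exists>\<D>. (\<forall>V\<in>\<D>. open V \<and> (\<exists>U\<in>\<C>. V \<subseteq> U)) \<and> \<Union>\<D> = UNIV \<and>
             locally_finite_in euclidean \<D>))"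

type_synonym ('m, 'e) atlas = "('m set \<times> ('m \<Rightarrow> 'e)) set"

text \<open>
  A chart is a pair of its domain and its coordinate map (irrelevant outside the domain).
  The underlying space of the manifold is the whole type \<open>'m\<close>.
\<close>

locale smooth_manifold =
  fixes \<A> :: "('m::t2_space, 'e::real_normed_vector) atlas"
  assumes finite_dimensional_model: "finite_dimensional_type TYPE('e)"
    and connected_manifold: "connected (UNIV :: 'm set)"
    and paracompact_manifold: "paracompact_type TYPE('m)"
    and charts_cover: "(\<Union>(U, \<alpha>)\<in>\<A>. U) = UNIV"
    and chart_domain_open: "(U, \<alpha>) \<in> \<A> \<Longrightarrow> open U"
    and chart_image_open: "(U, \<alpha>) \<in> \<A> \<Longrightarrow> open (\<alpha> ` U)"
    and chart_homeomorphism: "(U, \<alpha>) \<in> \<A> \<Longrightarrow> \<exists>\<beta>. homeomorphism U (\<alpha> ` U) \<alpha> \<beta>"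
    and chart_transition_smooth: "(U, \<alpha>) \<in> \<A> \<Longrightarrow> (V, \<beta>) \<in> \<A> \<Longrightarrow>
          Ck_on \<infinity> (\<alpha> ` (U \<inter> V)) (\<lambda>y. \<beta> (inv_into U \<alpha> y))"

text \<open>Being \<open>C\<^sup>k\<close> for maps from an open subset \<open>S\<close> of a manifold to a normed space.\<close>

definition Ck_on_manifold ::
    "enat \<Rightarrow> ('m, 'e::real_normed_vector) atlas \<Rightarrow> 'm set \<Rightarrow> ('m \<Rightarrow> 'b::real_normed_vector) \<Rightarrow> bool"
  where
  "Ck_on_manifold k \<A> S f \<longleftrightarrow>
     (\<forall>(U, \<alpha>)\<in>\<A>. Ck_on k (\<alpha> ` (U \<inter> S)) (\<lambda>y. f (inv_into U \<alpha> y)))"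


section \<open>Lie algebras on carrier sets\<close>

text \<open>
  Fibers of a bundle and spaces of sections are not types, hence this record of operations; the
  scalars are all elements of the type \<open>'k\<close>. Below it is instantiated only with structures
  that satisfy the axioms of a Lie algebra: the Lie algebra \<open>\<kk>\<close>, the fibers (isomorphic to \<open>\<kk>\<close>
  via charts), and sections with the pointwise operations.
\<close>

record ('k, 'v) lie_structure = "'v partial_object" +
  lie_zero :: 'v
  lie_add :: "'v \<Rightarrow> 'v \<Rightarrow> 'v"
  lie_scale :: "'k \<Rightarrow> 'v \<Rightarrow> 'v"
  lie_bracket :: "'v \<Rightarrow> 'v \<Rightarrow> 'v"

definition lie_isos ::
    "('k, 'v) lie_structure \<Rightarrow> ('k, 'w) lie_structure \<Rightarrow> ('v \<Rightarrow> 'w) set" where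
  "lie_isos G H = {f. bij_betw f (carrier G) (carrier H) \<and>
     f (lie_zero G) = lie_zero H \<and> lie_zero G \<in> carrier G \<and>
     (\<forall>x\<in>carrier G. \<forall>y\<in>carrier G.
        lie_add G x y \<in> carrier G \<and> f (lie_add G x y) = lie_add H (f x) (f y)) \<and>
     (\<forall>c. \<forall>x\<in>carrier G.
        lie_scale G c x \<in> carrier G \<and> f (lie_scale G c x) = lie_scale H c (f x)) \<and>
     (\<forall>x\<in>carrier G. \<forall>y\<in>carrier G.
        lie_bracket G x y \<in> carrier G \<and>
        f (lie_bracket G x y) = lie_bracket H (f x) (f y))}"

text \<open>
  The centroid is an associative algebra; it is presented as a record of type
  \<open>module\<close> from HOL-Algebra, whose ring operations are those of the algebra. Endomorphisms are
  taken to be undefined outside the carrier, so that equality of endomorphisms is equality of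
  functions.
\<close>

definition endomorphisms :: "('k, 'v) lie_structure \<Rightarrow> ('v \<Rightarrow> 'v) set" where
  "endomorphisms G = {f \<in> carrier G \<rightarrow>\<^sub>E carrier G.
     (\<forall>x\<in>carrier G. \<forall>y\<in>carrier G. f (lie_add G x y) = lie_add G (f x) (f y)) \<and>
     (\<forall>c. \<forall>x\<in>carrier G. f (lie_scale G c x) = lie_scale G c (f x))}"

definition centroid :: "('k, 'v) lie_structure \<Rightarrow> ('k, 'v \<Rightarrow> 'v) module" where
  "centroid G =
    \<lparr> carrier = {f \<in> endomorphisms G. \<forall>x\<in>carrier G. \<forall>y\<in>carrier G.
                   f (lie_bracket G x y) = lie_bracket G x (f y)},
      mult = (\<lambda>f g. compose (carrier G) f g),
      one = (\<lambda>x\<in>carrier G. x),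
      zero = (\<lambda>x\<in>carrier G. lie_zero G),
      add = (\<lambda>f g. \<lambda>x\<in>carrier G. lie_add G (f x) (g x)),
      smult = (\<lambda>c f. \<lambda>x\<in>carrier G. lie_scale G c (f x)) \<rparr>"

definition algebra_isomorphic :: "('k, 'a) module \<Rightarrow> ('k, 'b) module \<Rightarrow> bool" where
  "algebra_isomorphic A B \<longleftrightarrow>
     (\<exists>h \<in> ring_iso A B. \<forall>c. \<forall>a\<in>carrier A. h (c \<odot>\<^bsub>A\<^esub> a) = c \<odot>\<^bsub>B\<^esub> h a)"


section \<open>The Lie algebra of the fiber type\<close>

locale finite_dimensional_lie_algebra = vector_space scl
  for scl :: "'k::real_or_complex \<Rightarrow> 'f::real_normed_vector \<Rightarrow> 'f" +
  fixes bracket :: "'f \<Rightarrow> 'f \<Rightarrow> 'f"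
  assumes finite_dimensional: "\<exists>B. finite B \<and> Modules.module.span scl B = (UNIV :: 'f set)"
    and scl_of_real: "scl (of_real r) x = r *\<^sub>R x"
    and bracket_add_left: "bracket (x + y) z = bracket x z + bracket y z"
    and bracket_add_right: "bracket x (y + z) = bracket x y + bracket x z"
    and bracket_scl_left: "bracket (scl c x) y = scl c (bracket x y)"
    and bracket_scl_right: "bracket x (scl c y) = scl c (bracket x y)"
    and bracket_self: "bracket x x = 0"
    and jacobi: "bracket x (bracket y z) + bracket y (bracket z x) + bracket z (bracket x y) = 0"

definition perfect_lie_algebra ::
    "('k::field \<Rightarrow> 'f::ab_group_add \<Rightarrow> 'f) \<Rightarrow> ('f \<Rightarrow> 'f \<Rightarrow> 'f) \<Rightarrow> bool" where
  "perfect_lie_algebra scl bracket \<longleftrightarrow>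
     Modules.module.span scl {bracket x y |x y. True} = UNIV"

definition centerfree_lie_algebra :: "('f::ab_group_add \<Rightarrow> 'f \<Rightarrow> 'f) \<Rightarrow> bool" where
  "centerfree_lie_algebra bracket \<longleftrightarrow> {z. \<forall>x. bracket z x = 0} = {0}"

definition lie_structure_of_type ::
    "('k \<Rightarrow> 'f::ab_group_add \<Rightarrow> 'f) \<Rightarrow> ('f \<Rightarrow> 'f \<Rightarrow> 'f) \<Rightarrow> ('k, 'f) lie_structure" where
  "lie_structure_of_type scl bracket =
    \<lparr> carrier = UNIV, lie_zero = 0, lie_add = (+), lie_scale = scl, lie_bracket = bracket \<rparr>"


section \<open>Bundles of Lie algebras\<close>

text \<open>
  The total space is the type \<open>'l\<close>, with projection \<open>\<pi>\<close>; \<open>\<LL> x\<close> is the fiber over \<open>x\<close> with its Lie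
  algebra structure. A bundle chart \<open>(U, \<phi>)\<close> stands for the local trivialization
  \<open>v \<mapsto> (\<pi> v, \<phi> v)\<close> from \<open>\<pi> -` U\<close> to \<open>U \<times> \<kk>\<close>. Since the charts restrict to Lie algebra
  isomorphisms on fibers, the maps \<open>\<psi> \<circ> \<phi>\<^sup>-\<^sup>1\<close> over \<open>x\<close> are automorphisms of \<open>\<kk>\<close>; they are required
  to depend smoothly on \<open>x\<close>, as elements of the normed space of (automatically bounded) endomorphisms.
  The topology and the smooth structure of the total space are the unique ones that make the
  local trivializations diffeomorphisms, and therefore are not separate data.
\<close>

type_synonym ('l, 'm, 'f) bundle_atlas = "('m set \<times> ('l \<Rightarrow> 'f)) set"

locale lie_algebra_bundle =
  smooth_manifold \<A> + finite_dimensional_lie_algebra scl bracket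
  for \<A> :: "('m::t2_space, 'e::real_normed_vector) atlas"
    and scl :: "'k::real_or_complex \<Rightarrow> 'f::real_normed_vector \<Rightarrow> 'f"
    and bracket :: "'f \<Rightarrow> 'f \<Rightarrow> 'f" +
  fixes \<pi> :: "'l \<Rightarrow> 'm"
    and \<LL> :: "'m \<Rightarrow> ('k, 'l) lie_structure"
    and \<Phi> :: "('l, 'm, 'f) bundle_atlas"
  assumes carrier_fiber: "carrier (\<LL> x) = \<pi> -` {x}"
    and bundle_charts_cover: "(\<Union>(U, \<phi>)\<in>\<Phi>. U) = UNIV"
    and bundle_chart_domain_open: "(U, \<phi>) \<in> \<Phi> \<Longrightarrow> open U"
    and bundle_chart_fiber: "(U, \<phi>) \<in> \<Phi> \<Longrightarrow> x \<in> U \<Longrightarrow>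
          \<phi> \<in> lie_isos (\<LL> x) (lie_structure_of_type scl bracket)"
    and bundle_transition_smooth: "(U, \<phi>) \<in> \<Phi> \<Longrightarrow> (V, \<psi>) \<in> \<Phi> \<Longrightarrow>
          Ck_on_manifold \<infinity> \<A> (U \<inter> V) (\<lambda>x. Blinfun (\<psi> \<circ> inv_into (\<pi> -` {x}) \<phi>))"

text \<open>A map into the total space is \<open>C\<^sup>k\<close> iff it is so in the local trivializations.\<close>

definition lie_sections ::
    "enat \<Rightarrow> ('m, 'e::real_normed_vector) atlas \<Rightarrow> ('l \<Rightarrow> 'm) \<Rightarrow> ('m \<Rightarrow> ('k, 'l) lie_structure) \<Rightarrow>
     ('l, 'm, 'f::real_normed_vector) bundle_atlas \<Rightarrow> ('k, 'm \<Rightarrow> 'l) lie_structure" where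
  "lie_sections k \<A> \<pi> \<LL> \<Phi> =
    \<lparr> carrier = {s. (\<forall>x. \<pi> (s x) = x) \<and> (\<forall>(U, \<phi>)\<in>\<Phi>. Ck_on_manifold k \<A> U (\<lambda>x. \<phi> (s x)))},
      lie_zero = (\<lambda>x. lie_zero (\<LL> x)),
      lie_add = (\<lambda>s t x. lie_add (\<LL> x) (s x) (t x)),
      lie_scale = (\<lambda>c s x. lie_scale (\<LL> x) c (s x)),
      lie_bracket = (\<lambda>s t x. lie_bracket (\<LL> x) (s x) (t x)) \<rparr>"

text \<open>
  A bundle chart \<open>(U, \<phi>)\<close> of \<open>\<LL>\<close> induces the bundle chart \<open>A \<mapsto> \<phi> \<circ> A \<circ> \<phi>\<^sup>-\<^sup>1\<close> of \<open>Hom(\<LL>, \<LL>)\<close> over \<open>U\<close>.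
  The \<open>C\<^sup>k\<close>-sections of the subbundle \<open>Cent(\<LL>)\<close> are the \<open>C\<^sup>k\<close>-sections of \<open>Hom(\<LL>, \<LL>)\<close> with values in
  the centroids of the fibers.
\<close>

definition hom_chart :: "('l \<Rightarrow> 'm) \<Rightarrow> ('l \<Rightarrow> 'f::real_normed_vector) \<Rightarrow> 'm \<Rightarrow> ('l \<Rightarrow> 'l) \<Rightarrow> ('f \<Rightarrow>\<^sub>L 'f)"
  where "hom_chart \<pi> \<phi> x A = Blinfun (\<phi> \<circ> A \<circ> inv_into (\<pi> -` {x}) \<phi>)"

definition hom_sections ::
    "enat \<Rightarrow> ('m, 'e::real_normed_vector) atlas \<Rightarrow> ('l \<Rightarrow> 'm) \<Rightarrow> ('m \<Rightarrow> ('k, 'l) lie_structure) \<Rightarrow>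
     ('l, 'm, 'f::real_normed_vector) bundle_atlas \<Rightarrow> ('m \<Rightarrow> 'l \<Rightarrow> 'l) set" where
  "hom_sections k \<A> \<pi> \<LL> \<Phi> = {A. (\<forall>x. A x \<in> endomorphisms (\<LL> x)) \<and>
     (\<forall>(U, \<phi>)\<in>\<Phi>. Ck_on_manifold k \<A> U (\<lambda>x. hom_chart \<pi> \<phi> x (A x)))}"

definition centroid_sections ::
    "enat \<Rightarrow> ('m, 'e::real_normed_vector) atlas \<Rightarrow> ('l \<Rightarrow> 'm) \<Rightarrow> ('m \<Rightarrow> ('k, 'l) lie_structure) \<Rightarrow>
     ('l, 'm, 'f::real_normed_vector) bundle_atlas \<Rightarrow> ('k, 'm \<Rightarrow> 'l \<Rightarrow> 'l) module" where
  "centroid_sections k \<A> \<pi> \<LL> \<Phi> =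
    \<lparr> carrier = {A \<in> hom_sections k \<A> \<pi> \<LL> \<Phi>. \<forall>x. A x \<in> carrier (centroid (\<LL> x))},
      mult = (\<lambda>A B x. A x \<otimes>\<^bsub>centroid (\<LL> x)\<^esub> B x),
      one = (\<lambda>x. \<one>\<^bsub>centroid (\<LL> x)\<^esub>),
      zero = (\<lambda>x. \<zero>\<^bsub>centroid (\<LL> x)\<^esub>),
      add = (\<lambda>A B x. A x \<oplus>\<^bsub>centroid (\<LL> x)\<^esub> B x),
      smult = (\<lambda>c A x. c \<odot>\<^bsub>centroid (\<LL> x)\<^esub> A x) \<rparr>"

end

theory Submission
  imports Defs
begin

text \<open>
  Let \<open>f\<close> be in the centroid of the Lie algebra of sections. The point is that \<open>s x = 0\<close> implies
  \<open>f s x = 0\<close>; then \<open>f\<close> acts on each fiber, by elements of the centroid of the fiber, and local frames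
  show that this family is \<open>C\<^sup>k\<close>. If \<open>\<kk>\<close> is centerfree, \<open>[t, f s] = f [t, s] = - [s, f t]\<close> vanishes at \<open>x\<close> for
  all \<open>t\<close>, so \<open>f s x\<close> is central. If \<open>\<kk>\<close> is perfect, \<open>s\<close> is a finite sum of brackets \<open>[a, b]\<close> of
  global sections with \<open>a x = 0\<close>, and \<open>f [a, b] = [a, f b]\<close> vanishes at \<open>x\<close>. Only the finiteness of
  this sum is not a local matter: it requires finitely many open sets, each a disjoint union of
  sets that lie in a bundle chart, and hence the finite dimension of \<open>M\<close>. These sets are
  obtained from a locally finite family of bump functions \<open>w\<^sub>i\<close>, scaled generically so that
  more than \<open>dim M + 2\<close> of them are never positive and equal at a point: the sets of a given
  colour \<open>p\<close> are \<open>{w\<^sub>i > w\<^sub>j for i \<in> S, j \<notin> S}\<close> with \<open>card S = p\<close>.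
\<close>

section \<open>Calculus of \<open>C\<^sup>k\<close> maps on open sets\<close>

text \<open>No continuity or locality of f is given, so f can be moved past finite sums only.
  Cutting off by a bump function would leave sections s that vanish near x; for t supported near x,
  \<open>[t, f s] = f [t, s] = 0\<close> shows no more than that \<open>f s x\<close> is central,
  which does not suffice for a perfect fiber with nonzero center. There all of s has to be written
  as a finite sum of brackets, whereas a partition of unity alone gives a locally finite one. Since
  sets of one colour are disjoint, the local decompositions over them glue to a single pair of
  global sections for each term, and the number of brackets is the number of colours times the
  number of terms needed in the fiber. The colour of a point is the number of weights that share the
  maximum there. Without the generic scaling this number could be unbounded over M; with it, every
  further tie is one more equation on the point, which gives a bound in terms of dim M.\<close>

lemma has_derivative_frechet_SucD:
  assumes "times_cont_differentiable_on (Suc n) S f" "x \<in> S"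
  shows "(f has_derivative frechet_derivative f (at x)) (at x)"
  using assms by (simp add: frechet_derivative_works[symmetric])

text \<open>\<open>frechet_derivative\<close> is a choice among all derivatives, so equivalence of
  the two predicates makes the chosen maps equal, whether or not a derivative exists.\<close>

lemma frechet_derivative_cong_open:
  assumes "open S" "x \<in> S" "\<And>y. y \<in> S \<Longrightarrow> f y = g y"
  shows "frechet_derivative f (at x) = frechet_derivative g (at x)"
proof -
  have "(f has_derivative D) (at x) \<longleftrightarrow> (g has_derivative D) (at x)" for D
    using has_derivative_transform_within_open[OF _ assms(1,2), of f D UNIV g]
      has_derivative_transform_within_open[OF _ assms(1,2), of g D UNIV f] assms(3) by auto
  then show ?thesis unfolding frechet_derivative_def by simp
qed

lemma times_cont_diff_subset:
  "times_cont_differentiable_on n S f \<Longrightarrow> T \<subseteq> S \<Longrightarrow> times_cont_differentiable_on n T f"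
  by (induction n arbitrary: f) (auto intro: continuous_on_subset)

lemma times_cont_diff_cong:
  assumes "open S" "\<And>x. x \<in> S \<Longrightarrow> f x = g x" "times_cont_differentiable_on n S f"
  shows "times_cont_differentiable_on n S g"
  using assms(2,3)
proof (induction n arbitrary: f g)
  case 0
  then show ?case by (auto intro: continuous_on_eq)
next
  case (Suc n)
  have "g differentiable (at x)" if "x \<in> S" for x
  proof -
    obtain D where "(f has_derivative D) (at x)"
      using Suc.prems(2) \<open>x \<in> S\<close> by (auto simp: differentiable_def)
    then have "(g has_derivative D) (at x)"
      using has_derivative_transform_within_open[OF _ assms(1) that, of f D UNIV g] Suc.prems(1) by simp
    then show ?thesis by (auto simp: differentiable_def)
  qed
  moreover have "times_cont_differentiable_on n S (\<lambda>x. frechet_derivative g (at x) v)" for v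
  proof (rule Suc.IH)
    show "times_cont_differentiable_on n S (\<lambda>x. frechet_derivative f (at x) v)"
      using Suc.prems by simp
    show "frechet_derivative f (at x) v = frechet_derivative g (at x) v" if "x \<in> S" for x
      using frechet_derivative_cong_open[OF assms(1) that, of f g] Suc.prems by simp
  qed
  ultimately show ?case by simp
qed

text \<open>The derivative may be supplied by a formula, so the closure proofs below read it off
  from the sum, product and chain rules and apply the induction hypothesis to it.\<close>

lemma times_cont_diff_SucI:
  assumes "open S" "\<And>x. x \<in> S \<Longrightarrow> (f has_derivative D x) (at x)"
    "\<And>v. times_cont_differentiable_on n S (\<lambda>x. D x v)"
  shows "times_cont_differentiable_on (Suc n) S f"
proof -
  have "frechet_derivative f (at x) = D x" if "x \<in> S" for x
    using assms(2)[OF that] frechet_derivative_at by metis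
  then have "times_cont_differentiable_on n S (\<lambda>x. frechet_derivative f (at x) v)" for v
    by (intro times_cont_diff_cong[OF assms(1) _ assms(3)[of v]]) simp
  then show ?thesis using assms(2) by (auto simp: differentiable_def)
qed

lemma times_cont_diff_local:
  assumes "\<And>x. x \<in> S \<Longrightarrow> \<exists>T. open T \<and> x \<in> T \<and> times_cont_differentiable_on n T f"
  shows "times_cont_differentiable_on n S f"
  using assms
proof (induction n arbitrary: f)
  case 0
  have "isCont f x" if "x \<in> S" for x
    using 0[OF that] by (auto simp: continuous_on_eq_continuous_at)
  then show ?case by (auto intro: continuous_at_imp_continuous_on)
next
  case (Suc n)
  have "f differentiable at x" if "x \<in> S" for x
    using Suc.prems[OF that] by auto
  moreover have "times_cont_differentiable_on n S (\<lambda>x. frechet_derivative f (at x) v)" for v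
      proof (rule Suc.IH)
    fix x assume "x \<in> S"
    then show "\<exists>T. open T \<and> x \<in> T \<and>
        times_cont_differentiable_on n T (\<lambda>x. frechet_derivative f (at x) v)"
      using Suc.prems[of x] by auto
  qed
  ultimately show ?case by simp
qed

lemma times_cont_diff_SucD: "times_cont_differentiable_on (Suc n) S f \<Longrightarrow> times_cont_differentiable_on n S f"
proof (induction n arbitrary: f)
  case 0
  then show ?case
    by (auto intro!: continuous_at_imp_continuous_on differentiable_imp_continuous_within)
next
  case (Suc n)
  then show ?case by simp
qed

lemma times_cont_diff_const: "times_cont_differentiable_on n S (\<lambda>x. c)"
  by (induction n arbitrary: c) (auto simp: frechet_derivative_const)

lemma times_cont_diff_bounded_linear:
  assumes "bounded_linear L" "open S" "times_cont_differentiable_on n S f"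
  shows "times_cont_differentiable_on n S (\<lambda>x. L (f x))"
  using assms(3)
proof (induction n arbitrary: f)
  case 0
  then show ?case by (simp add: bounded_linear.continuous_on[OF assms(1)])
next
  case (Suc n)
  show ?case
  proof (rule times_cont_diff_SucI[OF assms(2)])
    show "((\<lambda>x. L (f x)) has_derivative (\<lambda>v. L (frechet_derivative f (at x) v))) (at x)"
      if "x \<in> S" for x
      using bounded_linear.has_derivative[OF assms(1) has_derivative_frechet_SucD[OF Suc.prems that]] .
    show "times_cont_differentiable_on n S (\<lambda>x. L (frechet_derivative f (at x) v))" for v
      using Suc by simp
  qed
qed

lemma times_cont_diff_add:
  assumes "open S" "times_cont_differentiable_on n S f" "times_cont_differentiable_on n S g"
  shows "times_cont_differentiable_on n S (\<lambda>x. f x + g x)"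
  using assms(2,3)
proof (induction n arbitrary: f g)
  case 0
  then show ?case by (auto intro: continuous_intros)
next
  case (Suc n)
  show ?case
  proof (rule times_cont_diff_SucI[OF assms(1)])
    show "((\<lambda>x. f x + g x) has_derivative
        (\<lambda>v. frechet_derivative f (at x) v + frechet_derivative g (at x) v)) (at x)" if "x \<in> S" for x
      using has_derivative_frechet_SucD[OF Suc.prems(1) that]
        has_derivative_frechet_SucD[OF Suc.prems(2) that] by (rule has_derivative_add)
    show "times_cont_differentiable_on n S
        (\<lambda>x. frechet_derivative f (at x) v + frechet_derivative g (at x) v)" for v
      using Suc by simp
  qed
qed

lemma times_cont_diff_bilinear:
  assumes "bounded_bilinear B" "open S"
    "times_cont_differentiable_on n S f" "times_cont_differentiable_on n S g"
  shows "times_cont_differentiable_on n S (\<lambda>x. B (f x) (g x))"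
  using assms(3,4)
proof (induction n arbitrary: f g)
  case 0
  then show ?case using bounded_bilinear.continuous_on[OF assms(1)] by auto
next
  case (Suc n)
  show ?case
  proof (rule times_cont_diff_SucI[OF assms(2)])
    show "((\<lambda>x. B (f x) (g x)) has_derivative
        (\<lambda>v. B (f x) (frechet_derivative g (at x) v) + B (frechet_derivative f (at x) v) (g x))) (at x)"
      if "x \<in> S" for x
      using bounded_bilinear.FDERIV[OF assms(1) has_derivative_frechet_SucD[OF Suc.prems(1) that]
        has_derivative_frechet_SucD[OF Suc.prems(2) that]] .
    \<comment> \<open>The factors left undifferentiated enter with one order less than they have,
      hence \<open>times_cont_diff_SucD\<close>.\<close>
    show "times_cont_differentiable_on n S
        (\<lambda>x. B (f x) (frechet_derivative g (at x) v) + B (frechet_derivative f (at x) v) (g x))" for v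
      using Suc.prems(1,2)
      by (intro times_cont_diff_add[OF assms(2)] Suc.IH times_cont_diff_SucD[OF Suc.prems(1)] times_cont_diff_SucD[OF Suc.prems(2)]) simp_all
  qed
qed

text \<open>Smooth functions of one variable enter as members of a family closed under derivatives.\<close>

lemma times_cont_diff_compose_real:
  fixes f :: "'a::real_normed_vector \<Rightarrow> real"
  assumes H: "\<And>h. h \<in> H \<Longrightarrow> \<exists>h'\<in>H. \<forall>r\<in>T. (h has_real_derivative h' r) (at r)"
    and "open S" "f ` S \<subseteq> T" "h \<in> H" "times_cont_differentiable_on n S f"
  shows "times_cont_differentiable_on n S (\<lambda>x. h (f x))"
  using assms(4,5)
proof (induction n arbitrary: h)
  case 0
  obtain h' where "\<forall>r\<in>T. (h has_real_derivative h' r) (at r)" using H 0 by blast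
  then have "continuous_on T h"
    by (intro continuous_at_imp_continuous_on) (auto intro: DERIV_isCont)
  then show ?case using 0 assms(3) by (auto intro: continuous_on_compose2)
next
  case (Suc n)
  obtain h' where h': "h' \<in> H" "\<forall>r\<in>T. (h has_real_derivative h' r) (at r)" using H Suc.prems by blast
  show ?case
  proof (rule times_cont_diff_SucI[OF assms(2)])
    show "((\<lambda>x. h (f x)) has_derivative (\<lambda>v. h' (f x) * frechet_derivative f (at x) v)) (at x)"
      if "x \<in> S" for x
    proof -
      have "(h has_derivative (\<lambda>v. h' (f x) * v)) (at (f x))"
        using h'(2) that assms(3) by (auto simp: has_field_derivative_def)
      from has_derivative_compose[OF has_derivative_frechet_SucD[OF Suc.prems(2) that] this]
      show ?thesis .
    qed
    show "times_cont_differentiable_on n S (\<lambda>x. h' (f x) * frechet_derivative f (at x) v)" for v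
      using Suc.prems(2)
      by (intro times_cont_diff_bilinear[OF bounded_bilinear_mult assms(2)] Suc.IH[OF h'(1)]
        times_cont_diff_SucD[OF Suc.prems(2)]) simp
  qed
qed

section \<open>Smooth functions of one real variable\<close>

definition smooth_family :: "real set \<Rightarrow> (real \<Rightarrow> real) set \<Rightarrow> bool" where
  "smooth_family T H \<longleftrightarrow> (\<forall>h\<in>H. \<exists>h'\<in>H. \<forall>r\<in>T. (h has_real_derivative h' r) (at r))"

text \<open>A derivative of \<open>inverse\<close> changes both the constant and the exponent; the
  family has to contain all multiples of all powers to be closed.\<close>

lemma smooth_family_reciprocal: "smooth_family (- {0}) {h. \<exists>c m. h = (\<lambda>r. c * inverse r ^ m)}"
  unfolding smooth_family_def
proof safe
  fix c :: real and m :: nat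
  have "((\<lambda>r. c * inverse r ^ m) has_real_derivative (- c * m) * inverse r ^ (m + 1)) (at r)"
    if "r \<noteq> 0" for r
  proof -
    have inv: "(inverse has_real_derivative - (inverse r * inverse r)) (at r)"
      using DERIV_inverse[of r UNIV] that by (simp add: power2_eq_square)
    show ?thesis
      using DERIV_cmult[OF DERIV_power[OF inv, of m], of c] by (cases m) (simp_all add: mult_ac)
  qed
  then show "\<exists>h'\<in>{h. \<exists>c m. h = (\<lambda>r. c * inverse r ^ m)}.
      \<forall>r\<in>- {0}. ((\<lambda>r. c * inverse r ^ m) has_real_derivative h' r) (at r)"
    by (intro bexI[of _ "\<lambda>r. (- c * m) * inverse r ^ (m + 1)"]) blast+
qed

text \<open>The substitution x = 1/r turns this into the decay of x^m / exp x at infinity.\<close>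

lemma exp_times_power_tendsto_0: "((\<lambda>r. inverse r ^ m * exp (- inverse r)) \<longlongrightarrow> (0::real)) (at_right 0)"
proof -
  have "((\<lambda>x::real. x ^ m / exp x) \<longlongrightarrow> 0) at_top" by (rule tendsto_power_div_exp_0)
  then have "((\<lambda>r::real. inverse r ^ m / exp (inverse r)) \<longlongrightarrow> 0) (at_right 0)"
    by (rule filterlim_compose) (rule filterlim_inverse_at_top_right)
  then show ?thesis by (simp add: exp_minus field_simps)
qed

text \<open>The derivative of \<open>p(1/r) exp(-1/r)\<close> is \<open>q(1/r) exp(-1/r)\<close> with \<open>q = X\<^sup>2 (p - p')\<close>; all these
  functions extend to \<open>r \<le> 0\<close> by \<open>0\<close>.\<close>

definition flat_fun :: "real poly \<Rightarrow> real \<Rightarrow> real" where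
  "flat_fun p r = (if r > 0 then poly p (inverse r) * exp (- inverse r) else 0)"

lemma flat_fun_tendsto_0: "((\<lambda>r. flat_fun p r) \<longlongrightarrow> 0) (at_right 0)"
proof -
  have "((\<lambda>r. \<Sum>i\<le>degree p. coeff p i * (inverse r ^ i * exp (- inverse r))) \<longlongrightarrow>
      (\<Sum>i\<le>degree p. coeff p i * 0)) (at_right 0)"
    by (intro tendsto_intros exp_times_power_tendsto_0)
  then have "((\<lambda>r. \<Sum>i\<le>degree p. coeff p i * (inverse r ^ i * exp (- inverse r))) \<longlongrightarrow> 0) (at_right 0)"
    by simp
  moreover have "\<forall>\<^sub>F r in at_right 0.
      (\<Sum>i\<le>degree p. coeff p i * (inverse r ^ i * exp (- inverse r))) = flat_fun p r"
    unfolding eventually_at_filter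
    by (auto simp: flat_fun_def poly_altdef sum_distrib_right mult.assoc intro!: always_eventually)
  ultimately show ?thesis by (simp add: tendsto_cong)
qed

lemma has_derivative_flat_fun:
  "(flat_fun p has_real_derivative flat_fun ([:0, 0, 1:] * (p - pderiv p)) r) (at r)"
proof -
  consider "r > 0" | "r < 0" | "r = 0" by linarith
  then show ?thesis
  proof cases
    case 1
    have inv: "(inverse has_real_derivative - (inverse r * inverse r)) (at r)"
      using DERIV_inverse[of r UNIV] 1 by (simp add: power2_eq_square)
    have "((\<lambda>r. poly p (inverse r) * exp (- inverse r)) has_real_derivative
        poly p (inverse r) * (exp (- inverse r) * (inverse r * inverse r)) +
        poly (pderiv p) (inverse r) * - (inverse r * inverse r) * exp (- inverse r)) (at r)"
      using DERIV_mult'[OF DERIV_chain2[OF poly_DERIV[of p] inv]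
        DERIV_chain2[OF DERIV_exp DERIV_minus[OF inv]]] by simp
    also have "poly p (inverse r) * (exp (- inverse r) * (inverse r * inverse r)) +
        poly (pderiv p) (inverse r) * - (inverse r * inverse r) * exp (- inverse r) =
        flat_fun ([:0, 0, 1:] * (p - pderiv p)) r"
      using 1 by (simp add: flat_fun_def algebra_simps)
    finally have "((\<lambda>r. poly p (inverse r) * exp (- inverse r)) has_real_derivative
        flat_fun ([:0, 0, 1:] * (p - pderiv p)) r) (at r)" .
    then show ?thesis
      by (rule has_field_derivative_transform_within_open[of _ _ _ "{0<..}"])
        (use 1 in \<open>auto simp: flat_fun_def\<close>)
  next
    case 2
    have "((\<lambda>r. 0) has_real_derivative 0) (at r)" by simp
    then have "(flat_fun p has_real_derivative 0) (at r)"
      by (rule has_field_derivative_transform_within_open[of _ _ _ "{..<0}"])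
        (use 2 in \<open>auto simp: flat_fun_def\<close>)
    then show ?thesis using 2 by (simp add: flat_fun_def)
  next
    case 3
    \<comment> \<open>Dividing by h multiplies the polynomial in 1/h by its variable, so for h > 0
      the difference quotient is itself a flat function and tends to 0.\<close>
    have "((\<lambda>h. flat_fun p h / h) \<longlongrightarrow> 0) (at_right 0)"
    proof -
      have "\<forall>\<^sub>F h in at_right 0. flat_fun (pCons 0 p) h = flat_fun p h / h"
        unfolding eventually_at_filter
        by (auto simp: flat_fun_def field_simps intro!: always_eventually)
      then show ?thesis using flat_fun_tendsto_0[of "pCons 0 p"] by (simp add: tendsto_cong)
    qed
    moreover have "((\<lambda>h. flat_fun p h / h) \<longlongrightarrow> 0) (at_left 0)"
    proof -
      have "\<forall>\<^sub>F h in at_left 0. 0 = flat_fun p h / h"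
        unfolding eventually_at_filter by (auto simp: flat_fun_def intro!: always_eventually)
      then show ?thesis by (simp add: tendsto_eventually eventually_mono)
    qed
    ultimately have "((\<lambda>h. flat_fun p h / h) \<longlongrightarrow> 0) (at 0)"
      by (simp add: filterlim_split_at)
    then show ?thesis using 3 by (simp add: DERIV_def flat_fun_def)
  qed
qed

lemma smooth_family_flat_fun: "smooth_family UNIV (range flat_fun)"
  unfolding smooth_family_def by (auto intro: has_derivative_flat_fun)

definition bump_fun :: "real \<Rightarrow> real" where "bump_fun = flat_fun 1"

lemma bump_fun_pos_iff [simp]: "bump_fun r > 0 \<longleftrightarrow> r > 0"
  and bump_fun_nonneg [simp]: "bump_fun r \<ge> 0"
  and bump_fun_eq_0_iff [simp]: "bump_fun r = 0 \<longleftrightarrow> r \<le> 0"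
  by (auto simp: bump_fun_def flat_fun_def)

subsection \<open>The classes \<open>Ck_on\<close>\<close>

lemma Ck_on_subset: "Ck_on k S f \<Longrightarrow> T \<subseteq> S \<Longrightarrow> Ck_on k T f"
  by (auto simp: Ck_on_def intro: times_cont_diff_subset)

lemma Ck_on_cong: "Ck_on k S f \<Longrightarrow> open S \<Longrightarrow> (\<And>x. x \<in> S \<Longrightarrow> f x = g x) \<Longrightarrow> Ck_on k S g"
  unfolding Ck_on_def by (auto intro: times_cont_diff_cong)

lemma Ck_on_local:
  assumes "\<And>x. x \<in> S \<Longrightarrow> \<exists>T. open T \<and> x \<in> T \<and> Ck_on k T f"
  shows "Ck_on k S f"
  unfolding Ck_on_def
proof (intro allI impI times_cont_diff_local)
  fix n x
  assume "enat n \<le> k" "x \<in> S"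
  then show "\<exists>T. open T \<and> x \<in> T \<and> times_cont_differentiable_on n T f"
    using assms[of x] by (auto simp: Ck_on_def)
qed

lemma Ck_on_infinityD: "Ck_on \<infinity> S f \<Longrightarrow> Ck_on k S f"
  by (simp add: Ck_on_def)

lemma Ck_on_const: "Ck_on k S (\<lambda>x. c)"
  by (simp add: Ck_on_def times_cont_diff_const)

lemma Ck_on_bounded_linear: "bounded_linear L \<Longrightarrow> open S \<Longrightarrow> Ck_on k S f \<Longrightarrow> Ck_on k S (\<lambda>x. L (f x))"
  by (simp add: Ck_on_def times_cont_diff_bounded_linear)

lemma Ck_on_add: "open S \<Longrightarrow> Ck_on k S f \<Longrightarrow> Ck_on k S g \<Longrightarrow> Ck_on k S (\<lambda>x. f x + g x)"
  by (simp add: Ck_on_def times_cont_diff_add)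

lemma Ck_on_bilinear:
  "bounded_bilinear B \<Longrightarrow> open S \<Longrightarrow> Ck_on k S f \<Longrightarrow> Ck_on k S g \<Longrightarrow> Ck_on k S (\<lambda>x. B (f x) (g x))"
  by (simp add: Ck_on_def times_cont_diff_bilinear)

lemma Ck_on_compose_real:
  "smooth_family T H \<Longrightarrow> h \<in> H \<Longrightarrow> open S \<Longrightarrow> f ` S \<subseteq> T \<Longrightarrow> Ck_on k S f \<Longrightarrow> Ck_on k S (\<lambda>x. h (f x))"
  unfolding Ck_on_def by (intro allI impI times_cont_diff_compose_real[of H T S f h]) (auto simp: smooth_family_def)

lemma Ck_on_infinity_differentiable:
  assumes "Ck_on \<infinity> S f" "x \<in> S"
  shows "f differentiable at x"
proof -
  have "times_cont_differentiable_on (Suc 0) S f" using assms(1) by (simp add: Ck_on_def)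
  then show ?thesis using assms(2) by simp
qed

section \<open>Coordinates on finite-dimensional spaces\<close>

text \<open>One index more than the dimension, since an index type cannot be empty.\<close>

typedef (overloaded) ('a::real_normed_vector) coord_index = "{i::nat. i \<le> dim (UNIV :: 'a set)}"
  by auto

lemma finite_UNIV_coord_index: "finite (UNIV :: 'a::real_normed_vector coord_index set)"
  and card_coord_index: "CARD('a::real_normed_vector coord_index) = Suc (dim (UNIV :: 'a set))"
proof -
  have eq: "{i::nat. i \<le> dim (UNIV :: 'a set)} = {..dim (UNIV :: 'a set)}" by auto
  have rg: "range (Rep_coord_index :: 'a coord_index \<Rightarrow> nat) = {i. i \<le> dim (UNIV :: 'a set)}"
    by (rule type_definition.Rep_range[OF type_definition_coord_index])
  have b: "bij_betw Rep_coord_index (UNIV :: 'a coord_index set) {..dim (UNIV :: 'a set)}"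
    unfolding bij_betw_def inj_on_def
    using rg by (simp add: Rep_coord_index_inject eq)
  show "finite (UNIV :: 'a coord_index set)" using bij_betw_finite[OF b] by simp
  show "CARD('a coord_index) = Suc (dim (UNIV :: 'a set))" using bij_betw_same_card[OF b] by simp
qed

instance coord_index :: (real_normed_vector) finite
  by standard (rule finite_UNIV_coord_index)

text \<open>Transfers analysis on \<open>real ^ n\<close> to a type known only to be a
  finite-dimensional normed space. Q combines the vectors of a basis, and \<xi> is a linear right
  inverse of Q. That \<xi> is bounded is the equivalence of norms: Q is injective on the range of
  \<xi>, so \<open>norm (Q w)\<close> has a positive minimum on the compact unit sphere of that
  subspace. The map \<xi> is not onto, as there is one coordinate too many.\<close>

lemma finite_dimensional_coordinates:
  assumes "finite_dimensional_type TYPE('a::real_normed_vector)"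
  obtains \<xi> :: "'a::real_normed_vector \<Rightarrow> real ^ 'a::real_normed_vector coord_index" and Q where
    "bounded_linear \<xi>" "bounded_linear Q" "\<And>v. Q (\<xi> v) = v"
proof -
  obtain B0 :: "'a set" where B0: "finite B0" "span B0 = UNIV"
    using assms by (auto simp: finite_dimensional_type_def)
  obtain B :: "'a set" where B: "independent B" "UNIV \<subseteq> span B" "card B = dim (UNIV :: 'a set)"
    by (rule basis_exists[of "UNIV :: 'a set"], rule that; assumption)
  have finB: "finite B" using independent_span_bound[OF B0(1) B(1)] B0(2) by simp
  have "card B \<le> CARD('a coord_index)" by (simp add: B card_coord_index)
  then obtain \<iota> :: "'a \<Rightarrow> 'a coord_index" where \<iota>: "inj_on \<iota> B"
    using card_le_inj[of B "UNIV :: 'a coord_index set"] finB by auto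
  define Q :: "real ^ 'a coord_index \<Rightarrow> 'a" where "Q t = (\<Sum>b\<in>B. (t $ \<iota> b) *\<^sub>R b)" for t
  have blQ: "bounded_linear Q"
    unfolding Q_def
    by (intro bounded_linear_sum bounded_linear_compose[OF bounded_linear_scaleR_left] bounded_linear_vec_nth)
  have "v \<in> range Q" for v
  proof -
    obtain u where u: "v = (\<Sum>b\<in>B. u b *\<^sub>R b)" using B(2) finB span_finite[OF finB] by auto
    have "Q (\<chi> i. u (the_inv_into B \<iota> i)) = v"
      unfolding Q_def u by (intro sum.cong) (auto simp: the_inv_into_f_f[OF \<iota>])
    then show ?thesis by (metis rangeI)
  qed
  then have "surj Q" by auto
  from linear_surjective_right_inverse[OF bounded_linear.linear[OF blQ] this]
  obtain \<xi> where \<xi>: "linear \<xi>" "Q \<circ> \<xi> = id" by blast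
  have Q\<xi>: "Q (\<xi> v) = v" for v using \<xi>(2) by (metis comp_apply id_apply)
  let ?W = "range \<xi> \<inter> sphere 0 1"
  have "closed (range \<xi>)" by (intro closed_subspace linear_subspace_image \<xi>(1) subspace_UNIV)
  then have cpt: "compact ?W" by (simp add: closed_Int_compact)
  have "\<exists>c>0. \<forall>w\<in>?W. c \<le> norm (Q w)"
  proof (cases "?W = {}")
    case True
    then show ?thesis by (intro exI[of _ 1]) auto
  next
    case False
    have "continuous_on ?W (\<lambda>w. norm (Q w))"
      by (intro continuous_on_norm bounded_linear.continuous_on[OF blQ] continuous_on_id)
    from continuous_attains_inf[OF cpt False this]
    obtain w where w: "w \<in> ?W" "\<forall>w'\<in>?W. norm (Q w) \<le> norm (Q w')" by blast
    obtain v where v: "w = \<xi> v" using w by blast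
    have "v \<noteq> 0" using w v linear_0[OF \<xi>(1)] by auto
    then have "norm (Q w) > 0" by (simp add: v Q\<xi>)
    then show ?thesis using w by blast
  qed
  then obtain c where c: "c > 0" "\<And>w. w \<in> ?W \<Longrightarrow> c \<le> norm (Q w)" by blast
  have "norm (\<xi> v) \<le> norm v * (1 / c)" for v
  proof (cases "\<xi> v = 0")
    case False
    have "(1 / norm (\<xi> v)) *\<^sub>R \<xi> v = \<xi> ((1 / norm (\<xi> v)) *\<^sub>R v)" by (simp add: linear_cmul[OF \<xi>(1)])
    moreover have "norm ((1 / norm (\<xi> v)) *\<^sub>R \<xi> v) = 1" using False by simp
    ultimately have "(1 / norm (\<xi> v)) *\<^sub>R \<xi> v \<in> ?W" by (metis IntI mem_sphere_0 rangeI)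
    from c(2)[OF this] have "c \<le> norm v / norm (\<xi> v)"
      by (simp add: linear_cmul[OF bounded_linear.linear[OF blQ]] Q\<xi>)
    then show ?thesis using c(1) False by (simp add: field_simps)
  qed (use c(1) in auto)
  then have "bounded_linear \<xi>"
    by (intro bounded_linear_intro[where K = "1/c"] linear_add[OF \<xi>(1)] linear_cmul[OF \<xi>(1)])
  then show thesis using that blQ Q\<xi> by blast
qed

lemma bounded_linear_finite_dimensional:
  fixes f :: "'a::real_normed_vector \<Rightarrow> 'b::real_normed_vector"
  assumes "finite_dimensional_type TYPE('a::real_normed_vector)" "linear f"
  shows "bounded_linear f"
proof -
  obtain \<xi> :: "'a \<Rightarrow> real ^ 'a coord_index" and Q where
    c: "bounded_linear \<xi>" "bounded_linear Q" "\<And>v. Q (\<xi> v) = v"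
    using finite_dimensional_coordinates[OF assms(1)] by blast
  have "linear (\<lambda>t. f (Q t))"
    using linear_compose[OF bounded_linear.linear[OF c(2)] assms(2)] by (simp add: comp_def)
  then have "bounded_linear (\<lambda>t. f (Q t))" by (simp add: linear_conv_bounded_linear)
  from bounded_linear_compose[OF this c(1)] show ?thesis by (simp add: c(3))
qed

lemma bounded_bilinear_finite_dimensional:
  fixes B :: "'a::real_normed_vector \<Rightarrow> 'a \<Rightarrow> 'b::real_normed_vector"
  assumes fd: "finite_dimensional_type TYPE('a::real_normed_vector)" and "bilinear B"
  shows "bounded_bilinear B"
proof -
  obtain \<xi> :: "'a \<Rightarrow> real ^ 'a coord_index" and Q where
    c: "bounded_linear \<xi>" "bounded_linear Q" "\<And>v. Q (\<xi> v) = v"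
    using finite_dimensional_coordinates[OF assms(1)] by blast
  have "bilinear (\<lambda>s t. B (Q s) (Q t))"
    using assms(2) bounded_linear.linear[OF c(2)]
    unfolding bilinear_def by (auto intro: linear_compose[unfolded comp_def])
  then have "bounded_bilinear (\<lambda>s t. B (Q s) (Q t))" by (simp add: bilinear_conv_bounded_bilinear)
  from bounded_bilinear.comp[OF this c(1) c(1)] show ?thesis by (simp add: c(3))
qed

section \<open>Calculus of \<open>C\<^sup>k\<close> maps on open subsets of a manifold\<close>

context smooth_manifold
begin

abbreviation Ck :: "enat \<Rightarrow> 'm set \<Rightarrow> ('m \<Rightarrow> 'b::real_normed_vector) \<Rightarrow> bool" where
  "Ck k S f \<equiv> Ck_on_manifold k \<A> S f"

lemma chart_inv_homeomorphism: "(U, \<alpha>) \<in> \<A> \<Longrightarrow> homeomorphism U (\<alpha> ` U) \<alpha> (inv_into U \<alpha>)"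
proof -
  assume "(U, \<alpha>) \<in> \<A>"
  then obtain \<beta> where b: "homeomorphism U (\<alpha> ` U) \<alpha> \<beta>" using chart_homeomorphism by blast
  have "inj_on \<alpha> U" using homeomorphism_apply1[OF b] by (rule inj_on_inverseI)
  then show ?thesis
    by (intro homeomorphism_cong[OF b refl refl refl]) (auto simp: homeomorphism_apply1[OF b])
qed

lemma chart_inj_on: "(U, \<alpha>) \<in> \<A> \<Longrightarrow> inj_on \<alpha> U"
  using homeomorphism_apply1[OF chart_inv_homeomorphism] by (rule inj_on_inverseI)

lemma chart_inv_into [simp]: "(U, \<alpha>) \<in> \<A> \<Longrightarrow> x \<in> U \<Longrightarrow> inv_into U \<alpha> (\<alpha> x) = x"
  using chart_inj_on by simp

lemma chart_open_image: "(U, \<alpha>) \<in> \<A> \<Longrightarrow> open S \<Longrightarrow> open (\<alpha> ` (U \<inter> S))"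
  using homeomorphism_imp_open_map[OF chart_inv_homeomorphism, of U \<alpha> "U \<inter> S"]
    openin_open_trans[OF _ chart_image_open] by (simp add: openin_open_Int)

lemma chart_at: "\<exists>U \<alpha>. (U, \<alpha>) \<in> \<A> \<and> x \<in> U"
proof -
  have "x \<in> (\<Union>(U, \<alpha>)\<in>\<A>. U)" unfolding charts_cover by simp
  then show ?thesis by auto
qed

lemma Ck_I: "(\<And>U \<alpha>. (U, \<alpha>) \<in> \<A> \<Longrightarrow> Ck_on k (\<alpha> ` (U \<inter> S)) (\<lambda>y. f (inv_into U \<alpha> y))) \<Longrightarrow> Ck k S f"
  by (auto simp: Ck_on_manifold_def)

lemma Ck_D: "Ck k S f \<Longrightarrow> (U, \<alpha>) \<in> \<A> \<Longrightarrow> Ck_on k (\<alpha> ` (U \<inter> S)) (\<lambda>y. f (inv_into U \<alpha> y))"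
  by (auto simp: Ck_on_manifold_def)

lemma Ck_subset: "Ck k S f \<Longrightarrow> T \<subseteq> S \<Longrightarrow> Ck k T f"
  by (rule Ck_I, rule Ck_on_subset, erule Ck_D, assumption, blast)

lemma Ck_cong:
  assumes "Ck k S f" "open S" "\<And>x. x \<in> S \<Longrightarrow> f x = g x"
  shows "Ck k S g"
proof (rule Ck_I)
  fix U \<alpha> assume a: "(U, \<alpha>) \<in> \<A>"
  show "Ck_on k (\<alpha> ` (U \<inter> S)) (\<lambda>y. g (inv_into U \<alpha> y))"
  proof (rule Ck_on_cong[OF Ck_D[OF assms(1) a] chart_open_image[OF a assms(2)]])
    fix y assume "y \<in> \<alpha> ` (U \<inter> S)"
    then show "f (inv_into U \<alpha> y) = g (inv_into U \<alpha> y)"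
      using assms(3) chart_inv_into[OF a] by force
  qed
qed

lemma Ck_local:
  assumes "\<And>x. x \<in> S \<Longrightarrow> \<exists>T. open T \<and> x \<in> T \<and> Ck k T f"
  shows "Ck k S f"
proof (intro Ck_I Ck_on_local)
  fix U \<alpha> y assume a: "(U, \<alpha>) \<in> \<A>" and "y \<in> \<alpha> ` (U \<inter> S)"
  then obtain x where x: "x \<in> U" "x \<in> S" "y = \<alpha> x" by auto
  obtain T where T: "open T" "x \<in> T" "Ck k T f" using assms x by blast
  then show "\<exists>T. open T \<and> y \<in> T \<and> Ck_on k T (\<lambda>y. f (inv_into U \<alpha> y))"
    using a x by (intro exI[of _ "\<alpha> ` (U \<inter> T)"] conjI chart_open_image Ck_D) simp_all
qed

lemma Ck_infinityD: "Ck \<infinity> S f \<Longrightarrow> Ck k S f"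
  by (rule Ck_I, rule Ck_on_infinityD, rule Ck_D)

lemma Ck_const: "Ck k S (\<lambda>x. c)"
  by (rule Ck_I) (intro Ck_on_const)

lemma Ck_bounded_linear: "bounded_linear L \<Longrightarrow> open S \<Longrightarrow> Ck k S f \<Longrightarrow> Ck k S (\<lambda>x. L (f x))"
  by (rule Ck_I, rule Ck_on_bounded_linear, assumption, rule chart_open_image, assumption+, rule Ck_D)

lemma Ck_add: "open S \<Longrightarrow> Ck k S f \<Longrightarrow> Ck k S g \<Longrightarrow> Ck k S (\<lambda>x. f x + g x)"
  by (rule Ck_I) (intro Ck_on_add chart_open_image Ck_D)

lemma Ck_bilinear:
  "bounded_bilinear B \<Longrightarrow> open S \<Longrightarrow> Ck k S f \<Longrightarrow> Ck k S g \<Longrightarrow> Ck k S (\<lambda>x. B (f x) (g x))"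
  by (rule Ck_I, rule Ck_on_bilinear, assumption, rule chart_open_image, assumption+)
    (rule Ck_D, assumption+)+

lemma Ck_compose_real:
  "smooth_family T H \<Longrightarrow> h \<in> H \<Longrightarrow> open S \<Longrightarrow> f ` S \<subseteq> T \<Longrightarrow> Ck k S f \<Longrightarrow> Ck k S (\<lambda>x. h (f x))"
  by (rule Ck_I, rule Ck_on_compose_real[of T H h], assumption+, rule chart_open_image, assumption+)
    (auto simp: image_subset_iff intro: Ck_D)

lemma Ck_minus: "open S \<Longrightarrow> Ck k S f \<Longrightarrow> Ck k S (\<lambda>x. - f x)"
  using Ck_bounded_linear[OF bounded_linear_minus[OF bounded_linear_ident]] .

lemma Ck_diff: "open S \<Longrightarrow> Ck k S f \<Longrightarrow> Ck k S g \<Longrightarrow> Ck k S (\<lambda>x. f x - g x)"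
  using Ck_add[of S k f "\<lambda>x. - g x"] Ck_minus[of S k g] by simp

lemma Ck_mult:
  fixes f g :: "'m \<Rightarrow> real"
  shows "open S \<Longrightarrow> Ck k S f \<Longrightarrow> Ck k S g \<Longrightarrow> Ck k S (\<lambda>x. f x * g x)"
  by (rule Ck_bilinear[OF bounded_bilinear_mult])

lemma Ck_scaleR: "open S \<Longrightarrow> Ck k S f \<Longrightarrow> Ck k S g \<Longrightarrow> Ck k S (\<lambda>x. f x *\<^sub>R g x)"
  by (rule Ck_bilinear[OF bounded_bilinear_scaleR])

lemma Ck_sum: "open S \<Longrightarrow> (\<And>i. i \<in> I \<Longrightarrow> Ck k S (f i)) \<Longrightarrow> Ck k S (\<lambda>x. \<Sum>i\<in>I. f i x)"
  by (induction I rule: infinite_finite_induct) (simp_all add: Ck_const Ck_add)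

lemma Ck_prod:
  fixes f :: "'i \<Rightarrow> 'm \<Rightarrow> real"
  shows "open S \<Longrightarrow> (\<And>i. i \<in> I \<Longrightarrow> Ck k S (f i)) \<Longrightarrow> Ck k S (\<lambda>x. \<Prod>i\<in>I. f i x)"
  by (induction I rule: infinite_finite_induct) (simp_all add: Ck_const Ck_mult)

lemma Ck_bump_fun: "open S \<Longrightarrow> Ck k S f \<Longrightarrow> Ck k S (\<lambda>x. bump_fun (f x))"
  unfolding bump_fun_def by (rule Ck_compose_real[OF smooth_family_flat_fun]) auto

lemma Ck_inverse:
  fixes f :: "'m \<Rightarrow> real"
  assumes "open S" "Ck k S f" "\<And>x. x \<in> S \<Longrightarrow> f x \<noteq> 0"
  shows "Ck k S (\<lambda>x. inverse (f x))"
proof (rule Ck_compose_real[where h = inverse, OF smooth_family_reciprocal _ assms(1) _ assms(2)])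
  show "inverse \<in> {h. \<exists>c m. h = (\<lambda>r::real. c * inverse r ^ m)}"
    by (rule CollectI, rule exI[of _ 1], rule exI[of _ 1]) simp
qed (use assms(3) in auto)

lemma Ck_imp_continuous_on:
  assumes "Ck k S f" "open S"
  shows "continuous_on S f"
proof (rule continuous_at_imp_continuous_on, rule ballI)
  fix x assume "x \<in> S"
  obtain U \<alpha> where a: "(U, \<alpha>) \<in> \<A>" "x \<in> U" using chart_at[of x] by blast
  have "enat 0 \<le> k" by (simp add: zero_enat_def[symmetric])
  then have "times_cont_differentiable_on 0 (\<alpha> ` (U \<inter> S)) (\<lambda>y. f (inv_into U \<alpha> y))"
    using Ck_D[OF assms(1) a(1)] unfolding Ck_on_def by blast
  then have "continuous_on (\<alpha> ` (U \<inter> S)) (\<lambda>y. f (inv_into U \<alpha> y))" by simp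
  moreover have "continuous_on (U \<inter> S) \<alpha>"
    using homeomorphism_cont1[OF chart_inv_homeomorphism[OF a(1)]] by (rule continuous_on_subset) simp
  ultimately have "continuous_on (U \<inter> S) (\<lambda>x. f (inv_into U \<alpha> (\<alpha> x)))"
    by (rule continuous_on_compose2) auto
  then have "continuous_on (U \<inter> S) f"
    by (rule continuous_on_eq) (use a in auto)
  then show "isCont f x"
    using a \<open>x \<in> S\<close> assms(2) chart_domain_open[OF a(1)]
    by (auto simp: continuous_on_eq_continuous_at open_Int)
qed

lemma Ck_chart: "(U, \<alpha>) \<in> \<A> \<Longrightarrow> Ck \<infinity> U \<alpha>"
  by (rule Ck_I) (simp add: chart_transition_smooth)

text \<open>In a chart, \<rho> is a function of the square of the Euclidean norm of \<xi>, which is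
  smooth whatever the norm of the model space. The extension by 0 is smooth since C is compact,
  hence closed in the Hausdorff space M: around a point outside the chart domain the complement of C
  is an open set on which \<rho> vanishes.\<close>

lemma bump_exists:
  assumes "open G" "x0 \<in> G"
  obtains \<rho> :: "'m \<Rightarrow> real" and C where "Ck \<infinity> UNIV \<rho>" "\<And>x. \<rho> x \<ge> 0" "\<rho> x0 > 0" "compact C" "C \<subseteq> G"
    "\<And>x. \<rho> x \<noteq> 0 \<Longrightarrow> x \<in> C"
proof -
  obtain U \<alpha> where a: "(U, \<alpha>) \<in> \<A>" "x0 \<in> U" using chart_at[of x0] by blast
  obtain \<xi> :: "'e \<Rightarrow> real ^ 'e coord_index" and Q where
    c: "bounded_linear \<xi>" "bounded_linear Q" "\<And>v. Q (\<xi> v) = v"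
    using finite_dimensional_coordinates[OF finite_dimensional_model] by blast
  let ?y0 = "\<alpha> x0"
  have "?y0 \<in> \<alpha> ` (U \<inter> G)" using a assms by auto
  then obtain e where e: "e > 0" "ball ?y0 e \<subseteq> \<alpha> ` (U \<inter> G)"
    using chart_open_image[OF a(1) assms(1)] open_contains_ball by blast
  obtain K where K: "K > 0" "\<And>w. norm (Q w) \<le> norm w * K" using bounded_linear.pos_bounded[OF c(2)] by blast
  \<comment> \<open>K bounds Q, so \<open>norm (\<xi> (y - \<alpha> x0)) \<le> r\<close> puts y at
    distance at most \<open>r * K = e / 2\<close> from the centre, inside the ball provided by
    e.\<close>
  define r where "r = e / (2 * K)"
  have r: "r > 0" "r * K < e" using e K by (auto simp: r_def)
  let ?C' = "{y. norm (\<xi> (y - ?y0)) \<le> r}"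
  have C'1: "?C' \<subseteq> \<alpha> ` (U \<inter> G)"
  proof
    fix y assume y: "y \<in> ?C'"
    have "norm (y - ?y0) \<le> norm (\<xi> (y - ?y0)) * K" using K(2)[of "\<xi> (y - ?y0)"] c(3) by simp
    also have "\<dots> \<le> r * K" using y K by simp
    also have "\<dots> < e" using r by simp
    finally show "y \<in> \<alpha> ` (U \<inter> G)" using e(2) by (auto simp: dist_norm norm_minus_commute)
  qed
  have "closed (range \<xi>)"
    by (intro closed_subspace linear_subspace_image bounded_linear.linear[OF c(1)] subspace_UNIV)
  then have "compact ((\<lambda>w. ?y0 + Q w) ` (range \<xi> \<inter> cball 0 r))"
    by (intro compact_continuous_image closed_Int_compact compact_cball continuous_intros
        bounded_linear.continuous_on[OF c(2)])
  moreover have "(\<lambda>w. ?y0 + Q w) ` (range \<xi> \<inter> cball 0 r) = ?C'"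
  proof
    show "(\<lambda>w. ?y0 + Q w) ` (range \<xi> \<inter> cball 0 r) \<subseteq> ?C'" using c(3) by auto
    show "?C' \<subseteq> (\<lambda>w. ?y0 + Q w) ` (range \<xi> \<inter> cball 0 r)"
    proof
      fix y assume "y \<in> ?C'"
      then show "y \<in> (\<lambda>w. ?y0 + Q w) ` (range \<xi> \<inter> cball 0 r)"
        by (intro image_eqI[of _ _ "\<xi> (y - ?y0)"]) (auto simp: c(3))
    qed
  qed
  ultimately have cptC': "compact ?C'" by simp
  define C where "C = inv_into U \<alpha> ` ?C'"
  have "continuous_on ?C' (inv_into U \<alpha>)"
    using homeomorphism_cont2[OF chart_inv_homeomorphism[OF a(1)]]
    by (rule continuous_on_subset) (use C'1 in blast)
  then have cptC: "compact C" unfolding C_def by (rule compact_continuous_image[OF _ cptC'])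
  have CG: "C \<subseteq> G" unfolding C_def using C'1 chart_inv_into[OF a(1)] by fastforce
  define \<rho> where "\<rho> x = (if x \<in> U
    then bump_fun (r\<^sup>2 - \<xi> (\<alpha> x - ?y0) \<bullet> \<xi> (\<alpha> x - ?y0)) else 0)" for x
  have supp: "x \<in> C" if "\<rho> x \<noteq> 0" for x
  proof -
    have x: "x \<in> U" using that by (auto simp: \<rho>_def split: if_splits)
    with that have "\<not> r\<^sup>2 \<le> \<xi> (\<alpha> x - ?y0) \<bullet> \<xi> (\<alpha> x - ?y0)" by (simp add: \<rho>_def)
    then have "(norm (\<xi> (\<alpha> x - ?y0)))\<^sup>2 \<le> r\<^sup>2" by (simp add: power2_norm_eq_inner)
    then have "\<alpha> x \<in> ?C'" using r(1) by (simp add: power2_le_iff_abs_le)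
    then show ?thesis unfolding C_def
      by (rule image_eqI[rotated]) (simp add: chart_inv_into[OF a(1) x])
  qed
  have "Ck \<infinity> UNIV \<rho>"
  proof (rule Ck_local)
    fix x
    show "\<exists>T. open T \<and> x \<in> T \<and> Ck \<infinity> T \<rho>"
    proof (cases "x \<in> U")
      case True
      have oU: "open U" using chart_domain_open[OF a(1)] .
      have "Ck \<infinity> U (\<lambda>x. \<xi> (\<alpha> x - ?y0))"
        by (intro Ck_bounded_linear[OF c(1) oU] Ck_diff[OF oU] Ck_const Ck_chart[OF a(1)])
      then have "Ck \<infinity> U (\<lambda>x. bump_fun (r\<^sup>2 - \<xi> (\<alpha> x - ?y0) \<bullet> \<xi> (\<alpha> x - ?y0)))"
        by (intro Ck_bump_fun Ck_diff Ck_const Ck_bilinear[OF bounded_bilinear_inner] oU)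
      then have "Ck \<infinity> U \<rho>" by (rule Ck_cong[OF _ oU]) (simp add: \<rho>_def)
      then show ?thesis using True oU by blast
    next
      case False
      have "x \<notin> C" using False C'1 chart_inv_into[OF a(1)] unfolding C_def by fastforce
      moreover have "open (- C)" using compact_imp_closed[OF cptC] by auto
      moreover have "Ck \<infinity> (- C) \<rho>"
        by (rule Ck_cong[OF Ck_const[of _ _ 0] \<open>open (- C)\<close>]) (use supp in force)
      ultimately show ?thesis by blast
    qed
  qed
  moreover have "\<rho> x0 > 0"
    using a r by (simp add: \<rho>_def linear_0[OF bounded_linear.linear[OF c(1)]])
  moreover have "\<rho> x \<ge> 0" for x by (simp add: \<rho>_def)
  ultimately show thesis using that cptC CG supp by blast
qed

end

section \<open>Coloured covers\<close>

lemma locally_finite_meets_compact: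
  assumes "locally_finite_in euclidean \<D>" "compact (K :: 'a::topological_space set)"
  shows "finite {V \<in> \<D>. V \<inter> K \<noteq> {}}"
proof -
  have "\<forall>x. \<exists>W. open W \<and> x \<in> W \<and> finite {V \<in> \<D>. V \<inter> W \<noteq> {}}"
    using assms(1) by (simp add: locally_finite_in_def)
  then obtain W where W: "\<And>x. open (W x)" "\<And>x. x \<in> W x" "\<And>x. finite {V \<in> \<D>. V \<inter> W x \<noteq> {}}"
    by metis
  obtain X where X: "X \<subseteq> K" "finite X" "K \<subseteq> (\<Union>x\<in>X. W x)"
    using compactE_image[OF assms(2), of K W] W by blast
  have "{V \<in> \<D>. V \<inter> K \<noteq> {}} \<subseteq> (\<Union>x\<in>X. {V \<in> \<D>. V \<inter> W x \<noteq> {}})"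
    using X(3) by blast
  then show ?thesis using X(2) W(3) by (meson finite_UN finite_subset)
qed

text \<open>The sets reachable from a given one by chains of intersecting members of the cover are
  countably many, and their union is open and closed.\<close>

lemma connected_locally_finite_cover_countable:
  assumes conn: "connected (UNIV :: 'a::topological_space set)"
    and D: "locally_finite_in euclidean \<D>" "\<Union>\<D> = (UNIV :: 'a set)"
    and op: "\<And>V. V \<in> \<D> \<Longrightarrow> open V"
    and K: "\<And>V. V \<in> \<D> \<Longrightarrow> \<exists>K. compact K \<and> V \<subseteq> K"
  shows "countable \<D>"
proof -
  obtain V0 where V0: "V0 \<in> \<D>" "V0 \<noteq> {}" using D(2) by (metis Union_empty_conv UNIV_not_empty)
  define F where "F = rec_nat {V0} (\<lambda>_ F. {W \<in> \<D>. W \<inter> \<Union>F \<noteq> {}})"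
  have F0: "F 0 = {V0}" and FS: "F (Suc n) = {W \<in> \<D>. W \<inter> \<Union>(F n) \<noteq> {}}" for n
    by (simp_all add: F_def)
  have FD: "F n \<subseteq> \<D>" for n by (cases n) (use V0 F0 FS in auto)
  have finF: "finite (F n)" for n
  proof (induction n)
    case (Suc n)
    have "finite {W \<in> \<D>. W \<inter> V \<noteq> {}}" if "V \<in> F n" for V
    proof -
      have "V \<in> \<D>" using that FD[of n] by (rule rev_subsetD)
      then obtain K where K': "compact K" "V \<subseteq> K" using K by metis
      have "{W \<in> \<D>. W \<inter> V \<noteq> {}} \<subseteq> {W \<in> \<D>. W \<inter> K \<noteq> {}}" using K'(2) by blast
      then show ?thesis using locally_finite_meets_compact[OF D(1) K'(1)] by (rule finite_subset)
    qed
    moreover have "F (Suc n) \<subseteq> (\<Union>V\<in>F n. {W \<in> \<D>. W \<inter> V \<noteq> {}})" unfolding FS by blast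
    ultimately show ?case using Suc by (meson finite_UN finite_subset)
  qed (simp add: F0)
  define P where "P = (\<Union>n. \<Union>(F n))"
  have "open P" unfolding P_def by (intro open_UN ballI open_Union op) (use FD in blast)
  moreover have "open (- P)"
  proof (subst open_subopen, safe)
    fix x assume x: "x \<notin> P"
    have "x \<in> \<Union>\<D>" unfolding D(2) by simp
    then obtain W where W: "W \<in> \<D>" "x \<in> W" by blast
    have "W \<inter> \<Union>(F n) = {}" for n
    proof (rule ccontr)
      assume "W \<inter> \<Union>(F n) \<noteq> {}"
      then have "W \<in> F (Suc n)" unfolding FS using W by blast
      then show False using x W unfolding P_def by blast
    qed
    then have "W \<subseteq> - P" unfolding P_def by blast
    then show "\<exists>T. open T \<and> x \<in> T \<and> T \<subseteq> - P" using W op by blast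
  qed
  ultimately have "P = {} \<or> P = UNIV"
    using conn by (simp add: connected_clopen closed_def)
  moreover have "V0 \<subseteq> P" unfolding P_def using F0 by blast
  ultimately have P: "P = UNIV" using V0 by blast
  \<comment> \<open>The empty set may belong to the cover but meets nothing, so no chain reaches
    it.\<close>
  have "W \<in> insert {} (\<Union>n. F n)" if W: "W \<in> \<D>" for W
  proof (cases "W = {}")
    case False
    then obtain n where "W \<inter> \<Union>(F n) \<noteq> {}" using P unfolding P_def by blast
    then have "W \<in> F (Suc n)" unfolding FS using W by blast
    then show ?thesis by blast
  qed simp
  then have "\<D> \<subseteq> insert {} (\<Union>n. F n)" by blast
  moreover have "countable (insert {} (\<Union>n. F n))"
    by (simp add: countable_finite finF)
  ultimately show ?thesis using countable_subset by blast
qed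

text \<open>The \<tau> j are the coefficients of a polynomial of degree below
  \<open>CARD('i)\<close> that vanishes at \<open>CARD('i)\<close> distinct points; r only numbers
  the indices to serve as exponents.\<close>

lemma vandermonde_injective:
  fixes s :: "'i::finite \<Rightarrow> nat" and r :: "'i \<Rightarrow> nat" and \<tau> :: "'i \<Rightarrow> real"
  assumes "inj s" "bij_betw r UNIV {..<CARD('i)}" and z: "\<And>i. (\<Sum>j\<in>UNIV. \<tau> j * real (s i) ^ r j) = 0"
  shows "\<tau> j = 0"
proof (rule ccontr)
  assume j: "\<tau> j \<noteq> 0"
  let ?n = "CARD('i) - 1"
  have pos: "CARD('i) > 0" by simp
  then have eq: "{..<CARD('i)} = {..?n}" by (metis Suc_pred' lessThan_Suc_atMost)
  define a where "a m = \<tau> (inv_into UNIV r m)" for m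
  have injr: "inj r" using assms(2) by (simp add: bij_betw_def)
  have sum_eq: "(\<Sum>m\<le>?n. a m * z ^ m) = (\<Sum>j\<in>UNIV. \<tau> j * z ^ r j)" for z
    using sum.reindex_bij_betw[OF assms(2), of "\<lambda>m. a m * z ^ m"] by (simp add: a_def injr eq)
  have "a (r j) \<noteq> 0" using j by (simp add: a_def injr)
  moreover have "r j \<le> ?n" using assms(2) eq by (auto simp: bij_betw_def)
  ultimately have fin: "finite {z. (\<Sum>m\<le>?n. a m * z ^ m) = 0}"
    and card: "card {z. (\<Sum>m\<le>?n. a m * z ^ m) = 0} \<le> ?n"
    using Transcendental.polyfun_rootbound[where c = a and k = "r j" and n = ?n] by blast+
  have "range (\<lambda>i. real (s i)) \<subseteq> {z. (\<Sum>m\<le>?n. a m * z ^ m) = 0}"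
    unfolding sum_eq using z by auto
  from card_mono[OF fin this] have "card (range (\<lambda>i. real (s i))) \<le> ?n" using card by linarith
  moreover have "card (range (\<lambda>i. real (s i))) = CARD('i)"
    using assms(1) by (intro card_image) (auto simp: inj_def)
  ultimately show False using pos by linarith
qed

section \<open>Bump families with finite overlaps and generic weights\<close>

context smooth_manifold
begin

lemma open_Ck_pos: "Ck k UNIV (f :: 'm \<Rightarrow> real) \<Longrightarrow> open {x. f x > a}"
  by (intro open_Collect_less continuous_on_const Ck_imp_continuous_on[of k]) auto

text \<open>Paracompactness is applied to the cover by the positivity sets of bumps. Every member of
  the refinement lies in the compact set of some bump, so connectedness makes the refinement
  countable, and one bump per member still covers M. These bumps need not be locally finite, as
  their positivity sets are larger than the members of the refinement;
  \<open>star_finite_bump_cover\<close> repairs this.\<close>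

lemma countable_bump_cover:
  assumes N: "\<And>y. open (N y)" "\<And>y. y \<in> N y"
  obtains \<rho> :: "nat \<Rightarrow> 'm \<Rightarrow> real" and C where
    "\<And>i. Ck \<infinity> UNIV (\<rho> i)" "\<And>i x. \<rho> i x \<ge> 0" "\<And>i. compact (C i)" "\<And>i x. \<rho> i x \<noteq> 0 \<Longrightarrow> x \<in> C i"
    "\<And>i. \<exists>y. C i \<subseteq> N y" "\<And>x. \<exists>i. \<rho> i x > 0"
proof -
  have "\<forall>y. \<exists>\<rho> C. Ck \<infinity> UNIV (\<rho> :: 'm \<Rightarrow> real) \<and> (\<forall>x. \<rho> x \<ge> 0) \<and> \<rho> y > 0 \<and> compact C \<and> C \<subseteq> N y \<and>
      (\<forall>x. \<rho> x \<noteq> 0 \<longrightarrow> x \<in> C)"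
  proof
    fix y
    obtain \<rho> :: "'m \<Rightarrow> real" and C where "Ck \<infinity> UNIV \<rho>" "\<And>x. \<rho> x \<ge> 0" "\<rho> y > 0" "compact C" "C \<subseteq> N y"
      "\<And>x. \<rho> x \<noteq> 0 \<Longrightarrow> x \<in> C"
      using bump_exists[OF N(1) N(2), of y] by metis
    then show "\<exists>\<rho> C. Ck \<infinity> UNIV (\<rho> :: 'm \<Rightarrow> real) \<and> (\<forall>x. \<rho> x \<ge> 0) \<and> \<rho> y > 0 \<and> compact C \<and> C \<subseteq> N y \<and>
      (\<forall>x. \<rho> x \<noteq> 0 \<longrightarrow> x \<in> C)" by blast
  qed
  then obtain r :: "'m \<Rightarrow> 'm \<Rightarrow> real" and K where r: "\<And>y. Ck \<infinity> UNIV (r y)" "\<And>y x. r y x \<ge> 0" "\<And>y. r y y > 0"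
    "\<And>y. compact (K y)" "\<And>y. K y \<subseteq> N y" "\<And>y x. r y x \<noteq> 0 \<Longrightarrow> x \<in> K y"
    by metis
  let ?\<C> = "range (\<lambda>y. {x. r y x > 0})"
  have "(\<forall>U\<in>?\<C>. open U) \<and> \<Union>?\<C> = UNIV" using open_Ck_pos[OF r(1)] r(3) by auto
  from paracompact_manifold[unfolded paracompact_type_def, THEN spec, THEN mp, OF this]
  obtain \<D> where D: "\<forall>V\<in>\<D>. open V \<and> (\<exists>U\<in>?\<C>. V \<subseteq> U)" "\<Union>\<D> = UNIV"
      "locally_finite_in euclidean \<D>"
    by (elim exE conjE) (rule that)
  have opD: "open V" if "V \<in> \<D>" for V using D(1) that by simp
  have "\<exists>y. V \<subseteq> {x. r y x > 0}" if "V \<in> \<D>" for V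
  proof -
    have "\<exists>U\<in>?\<C>. V \<subseteq> U" using D(1) that by simp
    then show ?thesis by auto
  qed
  then obtain y where y: "\<And>V. V \<in> \<D> \<Longrightarrow> V \<subseteq> {x. r (y V) x > 0}" by metis
  have KD: "\<exists>K. compact K \<and> V \<subseteq> K" if "V \<in> \<D>" for V
  proof (intro exI conjI subsetI)
    show "compact (K (y V))" by (rule r(4))
    fix x assume "x \<in> V"
    then have "r (y V) x > 0" using y[OF that] by blast
    then show "x \<in> K (y V)" by (intro r(6)) simp
  qed
  have "countable \<D>"
    by (rule connected_locally_finite_cover_countable[OF connected_manifold D(3,2)])
      (erule opD, erule KD)
  then have cY: "countable (y ` \<D>)" by simp
  have "\<D> \<noteq> {}" using D(2) by auto
  then have ne: "y ` \<D> \<noteq> {}" by simp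
  \<comment> \<open>If only finitely many points are chosen, this enumeration repeats some of them,
    which is harmless here.\<close>
  let ?e = "from_nat_into (y ` \<D>)"
  have "\<exists>i. r (?e i) x > 0" for x
  proof -
    have "x \<in> \<Union>\<D>" unfolding D(2) by simp
    then obtain V where V: "V \<in> \<D>" "x \<in> V" by blast
    then have "r (y V) x > 0" using y[OF V(1)] by blast
    moreover have "y V \<in> y ` \<D>" using V(1) by (rule imageI)
    then obtain i where "?e i = y V" using from_nat_into_surj[OF cY] by metis
    ultimately show ?thesis by metis
  qed
  then show thesis
    by (intro that[of "\<lambda>i. r (?e i)" "\<lambda>i. K (?e i)"]) (use r in \<open>blast+\<close>)
qed

text \<open>The cut-off factors kill \<theta> i wherever an earlier \<rho> j is at least 1/(i + 1).
  Around a point where \<rho> m is positive, all sufficiently late \<theta> j therefore vanish;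
  compactness of C i turns this into finitely many j for each i. The cover survives: at x, the first
  i with \<open>\<rho> i x > 0\<close> meets only earlier \<rho> j that are 0, so none of its
  cut-offs vanishes.\<close>

lemma star_finite_bump_cover:
  assumes N: "\<And>y. open (N y)" "\<And>y. y \<in> N y"
  obtains \<theta> :: "nat \<Rightarrow> 'm \<Rightarrow> real" and C where
    "\<And>i. Ck \<infinity> UNIV (\<theta> i)" "\<And>i x. \<theta> i x \<ge> 0" "\<And>i. compact (C i)" "\<And>i x. \<theta> i x \<noteq> 0 \<Longrightarrow> x \<in> C i"
    "\<And>i. \<exists>y. C i \<subseteq> N y" "\<And>x. \<exists>i. \<theta> i x > 0"
    "\<And>i. finite {j. \<exists>x. \<theta> i x > 0 \<and> \<theta> j x > 0}"
proof -
  obtain \<rho> :: "nat \<Rightarrow> 'm \<Rightarrow> real" and C where \<rho>: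
    "\<And>i. Ck \<infinity> UNIV (\<rho> i)" "\<And>i x. \<rho> i x \<ge> 0" "\<And>i. compact (C i)" "\<And>i x. \<rho> i x \<noteq> 0 \<Longrightarrow> x \<in> C i"
    "\<And>i. \<exists>y. C i \<subseteq> N y" "\<And>x. \<exists>i. \<rho> i x > 0"
    using countable_bump_cover[OF N] by metis
  define \<theta> where "\<theta> i x = \<rho> i x * (\<Prod>j<i. bump_fun (1 / (real i + 1) - \<rho> j x))" for i x
  have pos_iff: "\<theta> i x > 0 \<longleftrightarrow> \<rho> i x > 0 \<and> (\<forall>j<i. \<rho> j x < 1 / (real i + 1))" for i x
  proof -
    have "(\<Prod>j<i. bump_fun (1 / (real i + 1) - \<rho> j x)) \<ge> 0" by (simp add: prod_nonneg)
    moreover have "(\<Prod>j<i. bump_fun (1 / (real i + 1) - \<rho> j x)) \<noteq> 0 \<longleftrightarrow> (\<forall>j<i. \<rho> j x < 1 / (real i + 1))"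
      by (auto simp: not_le)
    ultimately show ?thesis using \<rho>(2)[of i x] unfolding \<theta>_def
      by (metis less_eq_real_def mult_pos_pos mult_zero_left mult_zero_right order_less_irrefl)
  qed
  have nonneg: "\<theta> i x \<ge> 0" for i x unfolding \<theta>_def using \<rho>(2) by (simp add: prod_nonneg)
  have "Ck \<infinity> UNIV (\<theta> i)" for i
    unfolding \<theta>_def
    by (intro Ck_mult Ck_prod Ck_bump_fun Ck_diff Ck_const \<rho>(1) open_UNIV)
  moreover have supp: "x \<in> C i" if "\<theta> i x \<noteq> 0" for i x using that \<rho>(4) by (auto simp: \<theta>_def)
  moreover have "\<exists>i. \<theta> i x > 0" for x
  proof -
    define i where "i = (LEAST i. \<rho> i x > 0)"
    have "\<rho> i x > 0" unfolding i_def using \<rho>(6) by (rule LeastI_ex)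
    moreover have "\<rho> j x < 1 / (real i + 1)" if "j < i" for j
    proof -
      have "\<rho> j x = 0" using not_less_Least[of j "\<lambda>i. \<rho> i x > 0"] that \<rho>(2)[of j x]
        unfolding i_def by force
      then show ?thesis by simp
    qed
    ultimately show ?thesis using pos_iff by blast
  qed
  moreover have "finite {j. \<exists>x. \<theta> i x > 0 \<and> \<theta> j x > 0}" for i
  proof -
    have "\<exists>W n. open W \<and> x \<in> W \<and> (\<forall>j\<ge>n. \<forall>y\<in>W. \<theta> j y = 0)" for x
    proof -
      obtain m where m: "\<rho> m x > 0" using \<rho>(6) by blast
      obtain q :: nat where q: "1 / \<rho> m x * 2 < real q" using reals_Archimedean2 by blast
      let ?W = "{y. \<rho> m y > \<rho> m x / 2}"
      \<comment> \<open>The bound q brings the threshold 1/(j + 1) below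
        \<open>\<rho> m x / 2\<close>, and \<open>Suc m\<close> makes \<rho> m one of the functions
        that cut off \<theta> j.\<close>
      have "\<theta> j y = 0" if "j \<ge> max q (Suc m)" "y \<in> ?W" for j y
      proof -
        have "1 / (real j + 1) \<le> \<rho> m x / 2"
        proof -
          have "1 / \<rho> m x * 2 < real j + 1" using q that(1) by linarith
          then show ?thesis using m by (simp add: field_simps)
        qed
        then have "\<not> \<rho> m y < 1 / (real j + 1)" using that(2) by simp
        then have "\<not> \<theta> j y > 0" using pos_iff[of j y] that(1) by auto
        then show ?thesis using nonneg[of j y] by simp
      qed
      moreover have "open ?W" using open_Ck_pos[OF \<rho>(1)] .
      moreover have "x \<in> ?W" using m by simp
      ultimately show ?thesis by blast
    qed
    then obtain W n where W: "\<And>x. open (W x)" "\<And>x. x \<in> W x" "\<And>x j y. j \<ge> n x \<Longrightarrow> y \<in> W x \<Longrightarrow> \<theta> j y = 0"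
      by metis
    have cov: "C i \<subseteq> (\<Union>x\<in>C i. W x)" using W(2) by blast
    obtain X where X: "X \<subseteq> C i" "finite X" "C i \<subseteq> (\<Union>x\<in>X. W x)"
      by (rule compactE_image[OF \<rho>(3) W(1) cov]) (rule that)
    have "{j. \<exists>x. \<theta> i x > 0 \<and> \<theta> j x > 0} \<subseteq> (\<Union>x\<in>X. {..<n x})"
    proof safe
      fix j y assume jy: "\<theta> i y > 0" "\<theta> j y > 0"
      then have "y \<in> C i" using supp[of i y] by simp
      then obtain x where "x \<in> X" "y \<in> W x" using X(3) by blast
      then show "j \<in> (\<Union>x\<in>X. {..<n x})" using W(3)[of x j y] jy(2) by (force simp: not_le)
    qed
    then show ?thesis using X(2) by (meson finite_UN finite_lessThan finite_subset)
  qed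
  ultimately show thesis by (intro that[of \<theta> C] nonneg \<rho>(3,5))
qed

text \<open>The weights \<open>exp p(i)\<close> for polynomials \<open>p\<close> of degree below \<open>dim M + 3\<close>: by Vandermonde, the values
  of \<open>p\<close> at \<open>dim M + 3\<close> indices are independent, whereas the values of \<open>ln v - ln \<theta> i\<close> at these indices
  form the image of a differentiable map of \<open>dim M + 2\<close> parameters.\<close>

lemma generic_scaling:
  assumes \<theta>: "\<And>i. Ck \<infinity> UNIV (\<theta> i :: 'm \<Rightarrow> real)"
    and chart: "\<And>i. \<exists>(U, \<alpha>)\<in>\<A>. \<forall>x. \<theta> i x > 0 \<longrightarrow> x \<in> U"
  obtains c :: "nat \<Rightarrow> real" and n :: nat where "\<And>i. c i > 0"
    "\<And>x S v. (\<And>i. i \<in> S \<Longrightarrow> \<theta> i x > 0 \<and> c i * \<theta> i x = v) \<Longrightarrow> finite S \<and> card S < n"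
proof -
  \<comment> \<open>\<open>coord_index\<close> accounts for dim M + 1 and \<open>bool\<close> for
    two more. The domain below has dimension one more than \<open>coord_index\<close> has elements,
    so the target exceeds it by exactly one.\<close>
  let ?n = "CARD('e coord_index + bool)"
  obtain \<xi> :: "'e \<Rightarrow> real ^ 'e coord_index" and Q where
    c: "bounded_linear \<xi>" "bounded_linear Q" "\<And>v. Q (\<xi> v) = v"
    using finite_dimensional_coordinates[OF finite_dimensional_model] by blast
  obtain r :: "'e coord_index + bool \<Rightarrow> nat" where r: "bij_betw r UNIV {..<?n}"
    using ex_bij_betw_finite_nat[of "UNIV :: ('e coord_index + bool) set"]
    by (auto simp: atLeast0LessThan)
  define p :: "real ^ ('e coord_index + bool) \<Rightarrow> nat \<Rightarrow> real" where
    "p \<tau> i = (\<Sum>j\<in>UNIV. \<tau> $ j * real i ^ r j)" for \<tau> i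
  \<comment> \<open>The coefficient vectors for which the weights
    \<open>exp (p \<tau> i) * \<theta> i\<close> at the indices s i all take a common positive
    value, here exp v, at some point.\<close>
  define Bad where "Bad s = {\<tau>. \<exists>x v. \<forall>i. \<theta> (s i) x > 0 \<and> p \<tau> (s i) = v - ln (\<theta> (s i) x)}"
    for s :: "'e coord_index + bool \<Rightarrow> nat"
  have "negligible (Bad s)" if s: "inj s" for s
  proof -
    define V :: "real ^ ('e coord_index + bool) \<Rightarrow> real ^ ('e coord_index + bool)" where
      "V \<tau> = (\<chi> i. p \<tau> (s i))" for \<tau>
    have linV: "linear V"
      by (intro linearI) (simp_all add: V_def p_def vec_eq_iff algebra_simps sum.distrib sum_distrib_left)
    have "inj V"
    proof (subst linear_injective_0[OF linV], safe)
      fix \<tau> assume "V \<tau> = 0"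
      then have "(\<Sum>j\<in>UNIV. \<tau> $ j * real (s i) ^ r j) = 0" for i
        by (simp add: V_def p_def vec_eq_iff)
      from vandermonde_injective[OF s r this] show "\<tau> = 0" by (simp add: vec_eq_iff)
    qed
    then obtain V' where V': "linear V'" "V' \<circ> V = id"
      using linear_injective_left_inverse[OF linV] by blast
    \<comment> \<open>A tie occurs only where all \<theta> (s i) are positive, so the chart
      belonging to any one of them sees every such point; \<open>undefined\<close> serves as an
      arbitrary index.\<close>
    obtain U \<alpha> where a: "(U, \<alpha>) \<in> \<A>" "\<And>x. \<theta> (s undefined) x > 0 \<Longrightarrow> x \<in> U"
      using chart[of "s undefined"] by blast
    \<comment> \<open>A parameter is a coordinate vector z, standing for the point
      \<open>inv_into U \<alpha> (Q z)\<close>, together with the common logarithmic level v. The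
      left inverse V' then recovers \<tau> from the prescribed values g.\<close>
    define D :: "((real ^ 'e coord_index) \<times> real) set" where
      "D = {(z, v). Q z \<in> \<alpha> ` U \<and> (\<forall>i. \<theta> (s i) (inv_into U \<alpha> (Q z)) > 0)}"
    define g :: "(real ^ 'e coord_index) \<times> real \<Rightarrow> real ^ ('e coord_index + bool)" where
      "g q = (\<Sum>i\<in>UNIV. (snd q - ln (\<theta> (s i) (inv_into U \<alpha> (Q (fst q))))) *\<^sub>R axis i 1)" for q
    have g_nth: "g q $ i = snd q - ln (\<theta> (s i) (inv_into U \<alpha> (Q (fst q))))" for q i
      by (simp add: g_def axis_def if_distrib[of "\<lambda>x. _ * x"] cong: if_cong)
    have "g differentiable at q" if q: "q \<in> D" for q
    proof -
      have "(\<lambda>q. ln (\<theta> (s i) (inv_into U \<alpha> (Q (fst q))))) differentiable at q" for i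
      proof -
        have "Ck_on \<infinity> (\<alpha> ` (U \<inter> UNIV)) (\<lambda>y. \<theta> (s i) (inv_into U \<alpha> y))" by (rule Ck_D[OF \<theta> a(1)])
        then have d1: "(\<lambda>y. \<theta> (s i) (inv_into U \<alpha> y)) differentiable at (Q (fst q))"
          by (rule Ck_on_infinity_differentiable) (use q in \<open>auto simp: D_def\<close>)
        have d2: "(\<lambda>q :: (real ^ 'e coord_index) \<times> real. Q (fst q)) differentiable at q"
          by (intro bounded_linear_imp_differentiable bounded_linear_compose[OF c(2)] bounded_linear_fst)
        have "\<theta> (s i) (inv_into U \<alpha> (Q (fst q))) > 0" using q by (cases q) (simp add: D_def)
        from DERIV_ln[OF this] have d3: "ln differentiable at (\<theta> (s i) (inv_into U \<alpha> (Q (fst q))))"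
          unfolding real_differentiable_def by (rule exI)
        show ?thesis
          using differentiable_chain_at[OF differentiable_chain_at[OF d2 d1], of ln] d3
          by (simp add: comp_def)
      qed
      moreover have "snd differentiable at q"
        by (intro bounded_linear_imp_differentiable bounded_linear_snd)
      ultimately show ?thesis
        unfolding g_def
        by (intro differentiable_sum ballI differentiable_scaleR differentiable_diff differentiable_const) auto
    qed
    then have "(\<lambda>q. V' (g q)) differentiable_on D"
      unfolding differentiable_on_def
      using differentiable_chain_at[of g _ V'] linear_imp_differentiable[OF V'(1)]
      by (auto simp: comp_def intro: differentiable_at_withinI)
    then have "negligible ((\<lambda>q. V' (g q)) ` D)"
      by (rule negligible_differentiable_image_lowdim[rotated]) (simp add: card_UNIV_sum)
    moreover have "Bad s \<subseteq> (\<lambda>q. V' (g q)) ` D"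
    proof
      fix \<tau> assume "\<tau> \<in> Bad s"
      then obtain x v where x: "\<And>i. \<theta> (s i) x > 0" "\<And>i. p \<tau> (s i) = v - ln (\<theta> (s i) x)"
        unfolding Bad_def by blast
      have xU: "x \<in> U" using a(2) x(1) by blast
      let ?q = "(\<xi> (\<alpha> x), v)"
      have "g ?q = V \<tau>" by (simp add: vec_eq_iff g_nth V_def x(2) c(3) chart_inv_into[OF a(1) xU])
      then have "V' (g ?q) = \<tau>" using V'(2) by (metis comp_apply id_apply)
      moreover have "?q \<in> D" using xU x(1) by (simp add: D_def c(3) chart_inv_into[OF a(1) xU])
      ultimately show "\<tau> \<in> (\<lambda>q. V' (g q)) ` D" by (metis image_eqI)
    qed
    ultimately show ?thesis using negligible_subset by blast
  qed
  \<comment> \<open>Maps from a finite type to the naturals are countably many, so one \<tau> avoids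
    all bad sets at once.\<close>
  then have "negligible (\<Union>(Bad ` {s. inj s}))"
    by (intro negligible_countable_Union) auto
  then have "\<Union>(Bad ` {s. inj s}) \<noteq> UNIV" by auto
  then obtain \<tau> where \<tau>: "\<And>s. inj s \<Longrightarrow> \<tau> \<notin> Bad s" by blast
  show thesis
  proof (rule that[of "\<lambda>i. exp (p \<tau> i)" ?n])
    fix x S v
    assume S: "\<And>i. i \<in> S \<Longrightarrow> \<theta> i x > 0 \<and> exp (p \<tau> i) * \<theta> i x = v"
    show "finite S \<and> card S < ?n"
    proof (rule ccontr)
      assume "\<not> (finite S \<and> card S < ?n)"
      then obtain T where T: "T \<subseteq> S" "finite T" "card T = ?n"
        by (metis infinite_arbitrarily_large not_le obtain_subset_with_card_n)
      obtain s :: "'e coord_index + bool \<Rightarrow> nat" where s: "range s \<subseteq> T" "inj s"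
        using card_le_inj[of "UNIV :: ('e coord_index + bool) set" T] T by auto
      have "\<theta> (s i) x > 0 \<and> p \<tau> (s i) = ln v - ln (\<theta> (s i) x)" for i
      proof -
        have i: "\<theta> (s i) x > 0" "exp (p \<tau> (s i)) * \<theta> (s i) x = v" using S[of "s i"] s(1) T(1) by auto
        have "ln v = p \<tau> (s i) + ln (\<theta> (s i) x)" using i by (simp add: ln_mult flip: i(2))
        then show ?thesis using i by simp
      qed
      then have "\<tau> \<in> Bad s" unfolding Bad_def by blast
      then show False using \<tau> s(2) by blast
    qed
  qed simp
qed

text \<open>Milnor's trick: \<open>\<eta> S\<close> is positive where all \<open>w i\<close> with \<open>i \<in> S\<close> exceed all \<open>w j\<close> with \<open>j \<notin> S\<close>. For
  distinct \<open>S\<close> of equal cardinality this cannot happen at the same point.\<close>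

lemma coloured_bump_cover:
  assumes N: "\<And>y. open (N y)" "\<And>y. y \<in> N y"
  obtains \<eta> :: "nat set \<Rightarrow> 'm \<Rightarrow> real" and C :: "nat set \<Rightarrow> 'm set" and \<I> :: "nat \<Rightarrow> nat set set" and n :: nat where
    "\<And>p S. S \<in> \<I> p \<Longrightarrow> Ck \<infinity> UNIV (\<eta> S)" "\<And>p S. S \<in> \<I> p \<Longrightarrow> closed (C S)"
    "\<And>p S. S \<in> \<I> p \<Longrightarrow> \<exists>y. C S \<subseteq> N y" "\<And>p S x. S \<in> \<I> p \<Longrightarrow> \<eta> S x \<noteq> 0 \<Longrightarrow> x \<in> C S"
    "\<And>p S S' x. S \<in> \<I> p \<Longrightarrow> S' \<in> \<I> p \<Longrightarrow> \<eta> S x \<noteq> 0 \<Longrightarrow> \<eta> S' x \<noteq> 0 \<Longrightarrow> S = S'"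
    "\<And>x. \<exists>p<n. \<exists>S\<in>\<I> p. \<eta> S x \<noteq> 0"
    "\<And>p x. \<exists>W. open W \<and> x \<in> W \<and> finite {S \<in> \<I> p. \<exists>y\<in>W. \<eta> S y \<noteq> 0}"
proof -
  have "\<forall>y. \<exists>U. y \<in> U \<and> (\<exists>\<alpha>. (U, \<alpha>) \<in> \<A>)" using chart_at by blast
  then obtain U where U: "\<And>y. y \<in> U y" "\<And>y. \<exists>\<alpha>. (U y, \<alpha>) \<in> \<A>" by metis
  \<comment> \<open>Shrinking to chart domains makes each \<theta> i live in a single chart, as
    \<open>generic_scaling\<close> requires.\<close>
  have oN: "open (N y \<inter> U y)" for y
    using N(1) U(2) chart_domain_open by blast
  have mem: "y \<in> N y \<inter> U y" for y using N(2) U(1) by simp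
  obtain \<theta> :: "nat \<Rightarrow> 'm \<Rightarrow> real" and C where \<theta>:
    "\<And>i. Ck \<infinity> UNIV (\<theta> i)" "\<And>i x. \<theta> i x \<ge> 0" "\<And>i. compact (C i)" "\<And>i x. \<theta> i x \<noteq> 0 \<Longrightarrow> x \<in> C i"
    "\<And>i. \<exists>y. C i \<subseteq> N y \<inter> U y" "\<And>x. \<exists>i. \<theta> i x > 0"
    "\<And>i. finite {j. \<exists>x. \<theta> i x > 0 \<and> \<theta> j x > 0}"
    apply (rule star_finite_bump_cover[OF oN mem])
    subgoal premises p for \<theta> C by (rule that[of \<theta> C]) (fact p)+
    done
  have "\<exists>(U, \<alpha>)\<in>\<A>. \<forall>x. \<theta> i x > 0 \<longrightarrow> x \<in> U" for i
  proof -
    obtain y where y: "C i \<subseteq> N y \<inter> U y" using \<theta>(5) by blast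
    obtain \<alpha> where "(U y, \<alpha>) \<in> \<A>" using U(2) by blast
    moreover have "\<forall>x. \<theta> i x > 0 \<longrightarrow> x \<in> U y" using \<theta>(4)[of i] y by force
    ultimately show ?thesis by blast
  qed
  note chart = this
  obtain c n where c: "\<And>i. c i > 0"
    "\<And>x S v. (\<And>i. i \<in> S \<Longrightarrow> \<theta> i x > 0 \<and> c i * \<theta> i x = v) \<Longrightarrow> finite S \<and> card S < n"
    apply (rule generic_scaling[of \<theta>, OF \<theta>(1)])
    subgoal using chart by blast
    subgoal premises p for c n by (rule that[of c n]) (fact p)+
    done
  define w where "w i x = c i * \<theta> i x" for i x
  have w_pos: "w i x > 0 \<longleftrightarrow> \<theta> i x > 0" for i x using c(1)[of i] by (simp add: w_def zero_less_mult_iff)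
  have w_nn: "w i x \<ge> 0" for i x using c(1)[of i] \<theta>(2)[of i x] by (simp add: w_def)
  \<comment> \<open>The condition \<open>w j < w i\<close> for all j outside S involves infinitely
    many j. Only those in J S can be positive together with a member of S; the others have weight 0
    there. J S is finite, so a finite product expresses the condition.\<close>
  define J where "J S = {j. j \<notin> S \<and> (\<exists>i\<in>S. \<exists>x. \<theta> i x > 0 \<and> \<theta> j x > 0)}" for S
  \<comment> \<open>The first product enforces positivity of the weights in S, also when J S is
    empty.\<close>
  define \<eta> where "\<eta> S x = (\<Prod>i\<in>S. bump_fun (w i x)) * (\<Prod>i\<in>S. \<Prod>j\<in>J S. bump_fun (w i x - w j x))" for S x
  \<comment> \<open>The empty set is left out because \<eta> of it is the constant 1, which is not
    supported in any C i.\<close>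
  define \<I> where "\<I> p = {S :: nat set. finite S \<and> S \<noteq> {} \<and> card S = p}" for p
  have finJ: "finite (J S)" if "finite S" for S
    by (rule finite_subset[of _ "\<Union>i\<in>S. {j. \<exists>x. \<theta> i x > 0 \<and> \<theta> j x > 0}"]) (use that \<theta>(7) in \<open>auto simp: J_def\<close>)
  have \<eta>_iff: "\<eta> S x \<noteq> 0 \<longleftrightarrow> (\<forall>i\<in>S. \<theta> i x > 0 \<and> (\<forall>j. j \<notin> S \<longrightarrow> w j x < w i x))" if "finite S" for S x
  proof
    assume "\<eta> S x \<noteq> 0"
    then have 1: "\<And>i. i \<in> S \<Longrightarrow> w i x > 0" "\<And>i j. i \<in> S \<Longrightarrow> j \<in> J S \<Longrightarrow> w j x < w i x"
      using that finJ[OF that] by (auto simp: \<eta>_def not_le)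
    show "\<forall>i\<in>S. \<theta> i x > 0 \<and> (\<forall>j. j \<notin> S \<longrightarrow> w j x < w i x)"
    proof (intro ballI conjI allI impI)
      fix i assume i: "i \<in> S"
      show "\<theta> i x > 0" using 1(1)[OF i] w_pos by simp
      fix j assume j: "j \<notin> S"
      show "w j x < w i x"
      proof (cases "j \<in> J S")
        case False
        then have "\<not> \<theta> j x > 0" using i j \<open>\<theta> i x > 0\<close> by (auto simp: J_def)
        then show ?thesis using 1(1)[OF i] w_pos[of j x] by linarith
      qed (use 1 i in blast)
    qed
  next
    assume "\<forall>i\<in>S. \<theta> i x > 0 \<and> (\<forall>j. j \<notin> S \<longrightarrow> w j x < w i x)"
    then show "\<eta> S x \<noteq> 0"
      using that finJ[OF that] w_pos by (auto simp: \<eta>_def J_def not_le)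
  qed
  show thesis
  \<comment> \<open>Where \<eta> S is nonzero every \<theta> i with i in S is positive, so C i for
    any such i contains these points; \<open>Min S\<close> selects one.\<close>
  proof (rule that[of \<I> \<eta> "\<lambda>S. C (Min S)" n])
    fix p S assume S: "S \<in> \<I> p"
    show "Ck \<infinity> UNIV (\<eta> S)"
      unfolding \<eta>_def w_def
      by (intro Ck_mult Ck_prod Ck_bump_fun Ck_diff Ck_const \<theta>(1) open_UNIV)
    show "closed (C (Min S))" using \<theta>(3) by (rule compact_imp_closed)
    show "\<exists>y. C (Min S) \<subseteq> N y" using \<theta>(5) by blast
    show "x \<in> C (Min S)" if "\<eta> S x \<noteq> 0" for x
    proof -
      have fin: "finite S" "S \<noteq> {}" using S by (auto simp: \<I>_def)
      have "\<theta> (Min S) x > 0" using \<eta>_iff[OF fin(1)] that Min_in[OF fin] by blast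
      then show ?thesis by (intro \<theta>(4)) simp
    qed
  next
    fix p S S' x assume S: "S \<in> \<I> p" "S' \<in> \<I> p" "\<eta> S x \<noteq> 0" "\<eta> S' x \<noteq> 0"
    have fin: "finite S" "finite S'" "card S = card S'" using S by (auto simp: \<I>_def)
    show "S = S'"
    proof (rule ccontr)
      assume ne: "S \<noteq> S'"
      then have "\<not> S \<subseteq> S'" "\<not> S' \<subseteq> S" using card_subset_eq fin by metis+
      then obtain i j where "i \<in> S" "i \<notin> S'" "j \<in> S'" "j \<notin> S" by blast
      then have "w j x < w i x" "w i x < w j x" using S \<eta>_iff fin by blast+
      then show False by simp
    qed
  next
    fix x
    obtain i0 where i0: "\<theta> i0 x > 0" using \<theta>(6) by blast
    define A where "A = {j. \<theta> j x > 0}"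
    have finA: "finite A" by (rule finite_subset[OF _ \<theta>(7)[of i0]]) (use i0 in \<open>auto simp: A_def\<close>)
    have neA: "A \<noteq> {}" using i0 by (auto simp: A_def)
    \<comment> \<open>The indices of maximal weight at x beat all others, so \<eta> of their set S
      is nonzero at x. They tie, so the generic scaling bounds their number; this is where the
      finite number of colours comes from.\<close>
    define m where "m = Max ((\<lambda>i. w i x) ` A)"
    define S where "S = {i \<in> A. w i x = m}"
    have "m \<in> (\<lambda>i. w i x) ` A" unfolding m_def using finA neA by (intro Max_in) auto
    then have neS: "S \<noteq> {}" by (auto simp: S_def)
    have finS: "finite S" using finA by (simp add: S_def)
    have le: "w i x \<le> m" if "i \<in> A" for i unfolding m_def using finA that by simp
    have "m > 0" using le[of i0] i0 w_pos[of i0 x] by (auto simp: A_def)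
    have "w j x < m" if "j \<notin> S" for j
    proof (cases "j \<in> A")
      case True
      then show ?thesis using le[OF True] that by (auto simp: S_def)
    next
      case False
      then show ?thesis using \<open>m > 0\<close> w_pos[of j x] by (auto simp: A_def)
    qed
    then have "\<eta> S x \<noteq> 0" using \<eta>_iff[OF finS] by (auto simp: S_def A_def)
    moreover have "card S < n" using c(2)[of S x m] by (auto simp: S_def A_def w_def)
    ultimately show "\<exists>p<n. \<exists>S\<in>\<I> p. \<eta> S x \<noteq> 0" using finS neS by (auto simp: \<I>_def)
  next
    fix p x
    obtain i where i: "\<theta> i x > 0" using \<theta>(6) by blast
    let ?W = "{y. \<theta> i y > 0}"
    \<comment> \<open>A set S that is active at a point of this neighbourhood consists of indices
      overlapping with i, of which there are finitely many.\<close>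
    have "{S \<in> \<I> p. \<exists>y\<in>?W. \<eta> S y \<noteq> 0} \<subseteq> Pow {j. \<exists>x. \<theta> i x > 0 \<and> \<theta> j x > 0}"
    proof (intro subsetI PowI CollectI)
      fix S j assume S: "S \<in> {S \<in> \<I> p. \<exists>y\<in>?W. \<eta> S y \<noteq> 0}" and j: "j \<in> S"
      then obtain y where y: "\<theta> i y > 0" "\<eta> S y \<noteq> 0" by blast
      have "finite S" using S by (simp add: \<I>_def)
      then have "\<theta> j y > 0" using \<eta>_iff y(2) j by blast
      then show "\<exists>x. \<theta> i x > 0 \<and> \<theta> j x > 0" using y(1) by blast
    qed
    then have "finite {S \<in> \<I> p. \<exists>y\<in>?W. \<eta> S y \<noteq> 0}" 
      by (rule finite_subset) (simp add: \<theta>(7))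
    then show "\<exists>W. open W \<and> x \<in> W \<and> finite {S \<in> \<I> p. \<exists>y\<in>W. \<eta> S y \<noteq> 0}"
      using open_Ck_pos[OF \<theta>(1)] i by (intro exI[of _ ?W]) simp
  qed
qed

end

section \<open>Linear algebra in the fiber\<close>

text \<open>Puts both fields in one form: i = 0 if the field is real, an imaginary unit with r = -1
  otherwise.\<close>

lemma real_or_complex_unit:
  "\<exists>(i :: 'k::real_or_complex) r. i * i = of_real r \<and> (\<forall>z. \<exists>a b. z = of_real a + of_real b * i)"
proof (cases "\<forall>z::'k. \<exists>a. z = a *\<^sub>R 1")
  case True
  have "\<exists>a b. z = of_real a + of_real b * 0" for z :: 'k
    using True by (auto simp: of_real_def)
  then show ?thesis by (intro exI[of _ 0]) simp
next
  case False
  then obtain i :: 'k where i: "i * i = - 1" "\<forall>z. \<exists>a b. z = a *\<^sub>R 1 + b *\<^sub>R i"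
    using real_or_complex[where ?'a = 'k] by blast
  then show ?thesis by (intro exI[of _ i] exI[of _ "- 1"]) (simp add: of_real_def)
qed

text \<open>The real span of a generating set B and of its multiples by i is closed under
  multiplication by i, hence by all scalars of the field, and so it contains the span of B over the
  field.\<close>

lemma finite_dimensional_type_fiber:
  fixes scl :: "'k::real_or_complex \<Rightarrow> 'f::real_normed_vector \<Rightarrow> 'f"
  assumes "finite_dimensional_lie_algebra scl bracket"
  shows "finite_dimensional_type TYPE('f)"
proof -
  interpret L: finite_dimensional_lie_algebra scl bracket by fact
  obtain B where B: "finite B" "L.span B = (UNIV :: 'f set)" using L.finite_dimensional by blast
  obtain i :: 'k and r where i: "i * i = of_real r" "\<And>z. \<exists>a b. z = of_real a + of_real b * i"
    using real_or_complex_unit[where ?'k = 'k] by metis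
  let ?B = "B \<union> scl i ` B"
  have scl_i: "scl i x \<in> span ?B" if "x \<in> span ?B" for x
    using that
  proof (induction x rule: span_induct_alt)
    case base
    then show ?case by (simp add: span_zero L.scale_zero_right)
  next
    case (step c x y)
    have "scl i x \<in> span ?B"
    proof (cases "x \<in> B")
      case True
      then show ?thesis by (intro span_base UnI2 imageI)
    next
      case False
      then obtain b where b: "b \<in> B" "x = scl i b" using step by blast
      have "scl i x = r *\<^sub>R b" by (simp add: b(2) i(1) L.scl_of_real)
      then show ?thesis using b(1) by (simp add: span_base span_scale)
    qed
    moreover have "scl i (c *\<^sub>R x + y) = c *\<^sub>R scl i x + scl i y"
      by (simp add: L.scale_right_distrib L.scl_of_real[symmetric] L.scale_left_commute)
    ultimately show ?case using step by (simp add: span_add span_scale)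
  qed
  have "L.subspace (span ?B)"
  proof (rule L.subspaceI)
    fix z :: 'k and x assume x: "x \<in> span ?B"
    obtain a b where z: "z = of_real a + of_real b * i" using i(2) by blast
    have "scl z x = a *\<^sub>R x + b *\<^sub>R scl i x"
      by (simp add: z L.scale_left_distrib L.scl_of_real flip: L.scale_scale)
    then show "scl z x \<in> span ?B" using x scl_i by (simp add: span_add span_scale)
  qed (auto simp: span_zero span_add)
  moreover have "B \<subseteq> span ?B" using span_superset[of ?B] by blast
  ultimately have "L.span B \<subseteq> span ?B" by (intro L.span_minimal)
  then have "span ?B = UNIV" using B(2) by auto
  then show ?thesis unfolding finite_dimensional_type_def using B(1) by (intro exI[of _ ?B]) simp
qed

context finite_dimensional_lie_algebra
begin

lemmas fd_fiber = finite_dimensional_type_fiber[OF finite_dimensional_lie_algebra_axioms]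

lemma bounded_linear_if_scl_linear:
  assumes "\<And>x y. g (x + y) = g x + g y" "\<And>c x. g (scl c x) = scl c (g x)"
  shows "bounded_linear (g :: 'f \<Rightarrow> 'f)"
  using assms(2)[of "of_real _"]
  by (intro bounded_linear_finite_dimensional[OF fd_fiber] linearI assms(1)) (simp add: scl_of_real)

lemma bounded_linear_scl: "bounded_linear (scl c)"
  by (rule bounded_linear_if_scl_linear) (simp_all add: scale_right_distrib mult.commute)

lemma bracket_scaleR_left: "bracket (r *\<^sub>R x) y = r *\<^sub>R bracket x y"
  and bracket_scaleR_right: "bracket x (r *\<^sub>R y) = r *\<^sub>R bracket x y"
  by (simp_all add: scl_of_real[symmetric] bracket_scl_left bracket_scl_right)

lemma bounded_bilinear_bracket: "bounded_bilinear bracket"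
  by (rule bounded_bilinear_finite_dimensional[OF fd_fiber])
    (simp add: bilinear_def linear_iff bracket_add_left bracket_add_right bracket_scaleR_left
      bracket_scaleR_right)

lemma bracket_zero_left [simp]: "bracket 0 x = 0" and bracket_zero_right [simp]: "bracket x 0 = 0"
  using bracket_scaleR_left[of 0 0 x] bracket_scaleR_right[of x 0 0] by simp_all

lemma bracket_antisym: "bracket y x = - bracket x y"
proof -
  have "bracket (x + y) (x + y) = bracket x y + bracket y x"
    unfolding bracket_add_left bracket_add_right by (simp add: bracket_self)
  then have "bracket x y + bracket y x = 0" by (simp add: bracket_self)
  then show ?thesis by (simp add: eq_neg_iff_add_eq_0 add.commute)
qed

text \<open>A scalar can be absorbed into the first entry of each bracket, so sums of brackets
  without coefficients already form a subspace.\<close>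

lemma perfect_sum_of_brackets:
  assumes "perfect_lie_algebra scl bracket"
  shows "\<exists>xs. w = (\<Sum>(a, b)\<leftarrow>xs. bracket a b)"
proof -
  let ?W = "{w. \<exists>xs. w = (\<Sum>(a, b)\<leftarrow>xs. bracket a b)}"
  have "subspace ?W"
  proof (rule subspaceI)
    show "0 \<in> ?W" by (auto intro: exI[of _ "[]"])
  next
    fix v w assume "v \<in> ?W" "w \<in> ?W"
    then obtain xs ys where "v = (\<Sum>(a, b)\<leftarrow>xs. bracket a b)" "w = (\<Sum>(a, b)\<leftarrow>ys. bracket a b)" by blast
    then have "v + w = (\<Sum>(a, b)\<leftarrow>xs @ ys. bracket a b)" by simp
    then show "v + w \<in> ?W" by blast
  next
    fix c v assume "v \<in> ?W"
    then obtain xs where "v = (\<Sum>(a, b)\<leftarrow>xs. bracket a b)" by blast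
    moreover have "scl c (\<Sum>(a, b)\<leftarrow>xs. bracket a b) = (\<Sum>(a, b)\<leftarrow>map (\<lambda>(a, b). (scl c a, b)) xs. bracket a b)"
      by (induction xs) (auto simp: scale_right_distrib bracket_scl_left)
    ultimately show "scl c v \<in> ?W" by blast
  qed
  moreover have "{bracket x y |x y. True} \<subseteq> ?W"
  proof safe
    fix x y
    show "\<exists>xs. bracket x y = (\<Sum>(a, b)\<leftarrow>xs. bracket a b)" by (intro exI[of _ "[(x, y)]"]) simp
  qed
  ultimately have "span {bracket x y |x y. True} \<subseteq> ?W" by (intro span_minimal)
  then show ?thesis using assms unfolding perfect_lie_algebra_def by blast
qed

text \<open>A linear right inverse of the bracket sum. Each of finitely many generators is split
  into brackets once, and the coordinates of v scale the first entries. Linearity of l j matters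
  twice: \<open>l j (s x)\<close> is as regular as s, and it vanishes where s does.\<close>

lemma perfect_decomposition:
  assumes "perfect_lie_algebra scl bracket"
  obtains m :: nat and l :: "nat \<Rightarrow> 'f \<Rightarrow> 'f" and b where
    "\<And>j. j < m \<Longrightarrow> bounded_linear (l j)" "\<And>v. (\<Sum>j<m. bracket (l j v) (b j)) = v"
proof -
  obtain \<xi> :: "'f \<Rightarrow> real ^ 'f coord_index" and Q where
    c: "bounded_linear \<xi>" "bounded_linear Q" "\<And>v. Q (\<xi> v) = v"
    using finite_dimensional_coordinates[OF fd_fiber] by blast
  have "\<exists>ls. (\<forall>(l, b)\<in>set ls. bounded_linear l) \<and>
      (\<forall>v. (\<Sum>(l, b)\<leftarrow>ls. bracket (l v) b) = (\<Sum>i\<in>F. (\<xi> v $ i) *\<^sub>R Q (axis i 1)))"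
    if "finite F" for F
    using that
  proof (induction F)
    case empty
    then show ?case by (auto intro: exI[of _ "[]"])
  next
    case (insert i F)
    then obtain ls where ls: "\<forall>(l, b)\<in>set ls. bounded_linear l"
      "\<And>v. (\<Sum>(l, b)\<leftarrow>ls. bracket (l v) b) = (\<Sum>i\<in>F. (\<xi> v $ i) *\<^sub>R Q (axis i 1))" by blast
    obtain xs where xs: "Q (axis i 1) = (\<Sum>(a, b)\<leftarrow>xs. bracket a b)"
      using perfect_sum_of_brackets[OF assms] by blast
    let ?ls = "map (\<lambda>(a, b). (\<lambda>v. (\<xi> v $ i) *\<^sub>R a, b)) xs"
    have bl: "bounded_linear (\<lambda>v. (\<xi> v $ i) *\<^sub>R a)" for a
      by (intro bounded_linear_compose[OF bounded_linear_scaleR_left]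
          bounded_linear_compose[OF bounded_linear_vec_nth c(1)])
    have "(\<Sum>(l, b)\<leftarrow>?ls. bracket (l v) b) = (\<xi> v $ i) *\<^sub>R (\<Sum>(a, b)\<leftarrow>xs. bracket a b)" for v
      by (induction xs) (auto simp: bracket_scaleR_left scaleR_right_distrib)
    then have "\<And>v. (\<Sum>(l, b)\<leftarrow>?ls @ ls. bracket (l v) b) = (\<Sum>i\<in>insert i F. (\<xi> v $ i) *\<^sub>R Q (axis i 1))"
      using insert(1,2) xs ls(2) by simp
    moreover have "\<forall>(l, b)\<in>set (?ls @ ls). bounded_linear l" using ls(1) bl by auto
    ultimately show ?case by blast
  qed
  from this[of UNIV] obtain ls where ls: "\<forall>(l, b)\<in>set ls. bounded_linear l"
    "\<And>v. (\<Sum>(l, b)\<leftarrow>ls. bracket (l v) b) = (\<Sum>i\<in>UNIV. (\<xi> v $ i) *\<^sub>R Q (axis i 1))" by auto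
  have "(\<Sum>j<length ls. bracket (fst (ls ! j) v) (snd (ls ! j))) = v" for v
  proof -
    have "\<xi> v = (\<Sum>i\<in>UNIV. (\<xi> v $ i) *\<^sub>R axis i 1)"
      using basis_expansion[of "\<xi> v"] by (simp add: scalar_mult_eq_scaleR)
    then have "Q (\<xi> v) = Q (\<Sum>i\<in>UNIV. (\<xi> v $ i) *\<^sub>R axis i 1)" by simp
    also have "\<dots> = (\<Sum>i\<in>UNIV. (\<xi> v $ i) *\<^sub>R Q (axis i 1))"
      using bounded_linear.linear[OF c(2)] by (simp add: linear_sum linear_cmul)
    finally have "v = (\<Sum>(l, b)\<leftarrow>ls. bracket (l v) b)" by (simp add: ls(2) c(3))
    then show ?thesis
      by (simp add: sum_list_sum_nth atLeast0LessThan case_prod_beta)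
  qed
  moreover have "bounded_linear (fst (ls ! j))" if "j < length ls" for j
    using ls(1) nth_mem[OF that] by (auto simp: case_prod_beta)
  ultimately show thesis by (rule that[of "length ls" "\<lambda>j. fst (ls ! j)" "\<lambda>j. snd (ls ! j)", rotated])
qed

end

section \<open>Sections of a bundle of Lie algebras\<close>

context lie_algebra_bundle
begin

section \<open>Bundle charts on fibers\<close>

abbreviation fiber_inv :: "('l \<Rightarrow> 'f) \<Rightarrow> 'm \<Rightarrow> 'f \<Rightarrow> 'l" where
  "fiber_inv \<phi> x \<equiv> inv_into (\<pi> -` {x}) \<phi>"

lemma bundle_chart_at: "\<exists>U \<phi>. (U, \<phi>) \<in> \<Phi> \<and> x \<in> U"
proof -
  have "x \<in> (\<Union>(U, \<phi>)\<in>\<Phi>. U)" unfolding bundle_charts_cover by simp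
  then show ?thesis by auto
qed

lemma bundle_chart_bij:
  assumes "(U, \<phi>) \<in> \<Phi>" "x \<in> U"
  shows "bij_betw \<phi> (\<pi> -` {x}) UNIV"
  using bundle_chart_fiber[OF assms]
  by (simp add: lie_isos_def lie_structure_of_type_def carrier_fiber)

lemma bundle_chart_ops:
  assumes "(U, \<phi>) \<in> \<Phi>" "x \<in> U"
  shows bc_zero: "\<phi> (lie_zero (\<LL> x)) = 0"
    and bc_add: "\<pi> u = x \<Longrightarrow> \<pi> v = x \<Longrightarrow> \<phi> (lie_add (\<LL> x) u v) = \<phi> u + \<phi> v"
    and bc_scale: "\<pi> u = x \<Longrightarrow> \<phi> (lie_scale (\<LL> x) c u) = scl c (\<phi> u)"
    and bc_bracket: "\<pi> u = x \<Longrightarrow> \<pi> v = x \<Longrightarrow> \<phi> (lie_bracket (\<LL> x) u v) = bracket (\<phi> u) (\<phi> v)"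
  using bundle_chart_fiber[OF assms]
  by (auto simp: lie_isos_def lie_structure_of_type_def carrier_fiber)

lemma fiber_closed [simp]:
  shows "\<pi> (lie_zero (\<LL> x)) = x"
    and "\<pi> u = x \<Longrightarrow> \<pi> v = x \<Longrightarrow> \<pi> (lie_add (\<LL> x) u v) = x"
    and "\<pi> u = x \<Longrightarrow> \<pi> (lie_scale (\<LL> x) c u) = x"
    and "\<pi> u = x \<Longrightarrow> \<pi> v = x \<Longrightarrow> \<pi> (lie_bracket (\<LL> x) u v) = x"
proof -
  obtain U \<phi> where U: "(U, \<phi>) \<in> \<Phi>" "x \<in> U" using bundle_chart_at by blast
  note iso = bundle_chart_fiber[OF U]
  show "\<pi> (lie_zero (\<LL> x)) = x"
    and "\<pi> u = x \<Longrightarrow> \<pi> v = x \<Longrightarrow> \<pi> (lie_add (\<LL> x) u v) = x"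
    and "\<pi> u = x \<Longrightarrow> \<pi> (lie_scale (\<LL> x) c u) = x"
    and "\<pi> u = x \<Longrightarrow> \<pi> v = x \<Longrightarrow> \<pi> (lie_bracket (\<LL> x) u v) = x"
    using iso by (auto simp: lie_isos_def carrier_fiber)
qed

lemma bundle_chart_eqI:
  assumes "(U, \<phi>) \<in> \<Phi>" "x \<in> U" "\<pi> u = x" "\<pi> v = x" "\<phi> u = \<phi> v"
  shows "u = v"
  using bundle_chart_bij[OF assms(1,2)] assms(3-) by (auto simp: bij_betw_def inj_on_def)

lemma bundle_chart_fiber_inv:
  assumes "(U, \<phi>) \<in> \<Phi>" "x \<in> U"
  shows "\<pi> (fiber_inv \<phi> x w) = x" "\<phi> (fiber_inv \<phi> x w) = w" "\<pi> v = x \<Longrightarrow> fiber_inv \<phi> x (\<phi> v) = v"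
proof -
  have b: "bij_betw \<phi> (\<pi> -` {x}) UNIV" by (rule bundle_chart_bij[OF assms])
  then have w: "w \<in> \<phi> ` (\<pi> -` {x})" by (simp add: bij_betw_def)
  show "\<pi> (fiber_inv \<phi> x w) = x" using inv_into_into[OF w] by simp
  show "\<phi> (fiber_inv \<phi> x w) = w" by (rule f_inv_into_f[OF w])
  show "fiber_inv \<phi> x (\<phi> v) = v" if "\<pi> v = x" using b that by (simp add: bij_betw_def)
qed

lemma bounded_linear_chart_conjugate:
  assumes "(U, \<phi>) \<in> \<Phi>" "x \<in> U" "(V, \<psi>) \<in> \<Phi>" "x \<in> V" "g \<in> endomorphisms (\<LL> x)"
  shows "bounded_linear (\<lambda>w. \<psi> (g (fiber_inv \<phi> x w)))"
proof -
  note inv = bundle_chart_fiber_inv[OF assms(1,2)] and ops = bundle_chart_ops[OF assms(1,2)]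
    and ops' = bundle_chart_ops[OF assms(3,4)]
  have g: "\<pi> u = x \<Longrightarrow> \<pi> (g u) = x" "\<pi> u = x \<Longrightarrow> \<pi> v = x \<Longrightarrow> g (lie_add (\<LL> x) u v) = lie_add (\<LL> x) (g u) (g v)"
    "\<pi> u = x \<Longrightarrow> g (lie_scale (\<LL> x) c u) = lie_scale (\<LL> x) c (g u)" for u v c
    using assms(5) by (auto simp: endomorphisms_def carrier_fiber PiE_iff)
  show ?thesis
  proof (rule bounded_linear_if_scl_linear)
    fix w w'
    have "fiber_inv \<phi> x (w + w') = lie_add (\<LL> x) (fiber_inv \<phi> x w) (fiber_inv \<phi> x w')"
      by (rule bundle_chart_eqI[OF assms(1,2)]) (simp_all add: inv ops)
    then show "\<psi> (g (fiber_inv \<phi> x (w + w'))) = \<psi> (g (fiber_inv \<phi> x w)) + \<psi> (g (fiber_inv \<phi> x w'))"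
      by (simp add: g inv ops')
  next
    fix c w
    have "fiber_inv \<phi> x (scl c w) = lie_scale (\<LL> x) c (fiber_inv \<phi> x w)"
      by (rule bundle_chart_eqI[OF assms(1,2)]) (simp_all add: inv ops)
    then show "\<psi> (g (fiber_inv \<phi> x (scl c w))) = scl c (\<psi> (g (fiber_inv \<phi> x w)))"
      by (simp add: g inv ops')
  qed
qed

lemma bounded_linear_transition:
  assumes "(U, \<phi>) \<in> \<Phi>" "x \<in> U" "(V, \<psi>) \<in> \<Phi>" "x \<in> V"
  shows "bounded_linear (\<lambda>w. \<psi> (fiber_inv \<phi> x w))"
proof -
  have "(\<lambda>v\<in>carrier (\<LL> x). v) \<in> endomorphisms (\<LL> x)"
    by (auto simp: endomorphisms_def carrier_fiber)
  from bounded_linear_chart_conjugate[OF assms this] show ?thesis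
    by (simp add: carrier_fiber bundle_chart_fiber_inv[OF assms(1,2)])
qed

lemma Ck_transition:
  assumes "(U, \<phi>) \<in> \<Phi>" "(V, \<psi>) \<in> \<Phi>" "open S" "S \<subseteq> U \<inter> V" "Ck k S u"
  shows "Ck k S (\<lambda>x. \<psi> (fiber_inv \<phi> x (u x)))"
proof -
  have "Ck k S (\<lambda>x. Blinfun (\<psi> \<circ> fiber_inv \<phi> x))"
    by (rule Ck_subset[OF Ck_infinityD[OF bundle_transition_smooth[OF assms(1,2)]] assms(4)])
  then have "Ck k S (\<lambda>x. blinfun_apply (Blinfun (\<psi> \<circ> fiber_inv \<phi> x)) (u x))"
    by (rule Ck_bilinear[OF bounded_bilinear_blinfun_apply assms(3) _ assms(5)])
  then show ?thesis
  proof (rule Ck_cong[OF _ assms(3)])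
    fix x assume "x \<in> S"
    then have "bounded_linear (\<psi> \<circ> fiber_inv \<phi> x)"
      using bounded_linear_transition[OF assms(1) _ assms(2)] assms(4) by (auto simp: comp_def)
    then show "blinfun_apply (Blinfun (\<psi> \<circ> fiber_inv \<phi> x)) (u x) = \<psi> (fiber_inv \<phi> x (u x))"
      by (simp add: bounded_linear_Blinfun_apply)
  qed
qed

section \<open>Global sections and their construction from local data\<close>

abbreviation sections :: "enat \<Rightarrow> ('k, 'm \<Rightarrow> 'l) lie_structure" where
  "sections k \<equiv> lie_sections k \<A> \<pi> \<LL> \<Phi>"

lemma sections_carrier_iff:
  "s \<in> carrier (sections k) \<longleftrightarrow> (\<forall>x. \<pi> (s x) = x) \<and> (\<forall>U \<phi>. (U, \<phi>) \<in> \<Phi> \<longrightarrow> Ck k U (\<lambda>x. \<phi> (s x)))"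
  by (auto simp: lie_sections_def)

lemma section_in_fiber [simp]: "s \<in> carrier (sections k) \<Longrightarrow> \<pi> (s x) = x"
  by (simp add: sections_carrier_iff)

lemma section_Ck: "s \<in> carrier (sections k) \<Longrightarrow> (U, \<phi>) \<in> \<Phi> \<Longrightarrow> Ck k U (\<lambda>x. \<phi> (s x))"
  by (simp add: sections_carrier_iff)

lemma sections_ops [simp]:
  "lie_zero (sections k) = (\<lambda>x. lie_zero (\<LL> x))"
  "lie_add (sections k) s t = (\<lambda>x. lie_add (\<LL> x) (s x) (t x))"
  "lie_scale (sections k) c s = (\<lambda>x. lie_scale (\<LL> x) c (s x))"
  "lie_bracket (sections k) s t = (\<lambda>x. lie_bracket (\<LL> x) (s x) (t x))"
  unfolding lie_sections_def lie_structure.simps by (rule refl)+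

lemma sections_closed:
  shows "(\<lambda>x. lie_zero (\<LL> x)) \<in> carrier (sections k)"
    and "s \<in> carrier (sections k) \<Longrightarrow> t \<in> carrier (sections k) \<Longrightarrow>
      (\<lambda>x. lie_add (\<LL> x) (s x) (t x)) \<in> carrier (sections k)"
    and "s \<in> carrier (sections k) \<Longrightarrow> (\<lambda>x. lie_scale (\<LL> x) c (s x)) \<in> carrier (sections k)"
    and "s \<in> carrier (sections k) \<Longrightarrow> t \<in> carrier (sections k) \<Longrightarrow>
      (\<lambda>x. lie_bracket (\<LL> x) (s x) (t x)) \<in> carrier (sections k)"
proof -
  have "Ck k U (\<lambda>x. \<phi> (lie_zero (\<LL> x)))" if "(U, \<phi>) \<in> \<Phi>" for U \<phi>
    by (rule Ck_cong[OF Ck_const[of _ _ 0] bundle_chart_domain_open[OF that]]) (simp add: bc_zero[OF that])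
  then show "(\<lambda>x. lie_zero (\<LL> x)) \<in> carrier (sections k)" by (simp add: sections_carrier_iff)
next
  assume s: "s \<in> carrier (sections k)" and t: "t \<in> carrier (sections k)"
  have "Ck k U (\<lambda>x. \<phi> (lie_add (\<LL> x) (s x) (t x)))" if "(U, \<phi>) \<in> \<Phi>" for U \<phi>
    by (rule Ck_cong[OF Ck_add[OF _ section_Ck[OF s that] section_Ck[OF t that]]])
      (simp_all add: bc_add[OF that] bundle_chart_domain_open[OF that] section_in_fiber[OF s] section_in_fiber[OF t])
  then show "(\<lambda>x. lie_add (\<LL> x) (s x) (t x)) \<in> carrier (sections k)"
    using s t by (simp add: sections_carrier_iff)
  have "Ck k U (\<lambda>x. \<phi> (lie_bracket (\<LL> x) (s x) (t x)))" if "(U, \<phi>) \<in> \<Phi>" for U \<phi>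
    by (rule Ck_cong[OF Ck_bilinear[OF bounded_bilinear_bracket _ section_Ck[OF s that] section_Ck[OF t that]]])
      (simp_all add: bc_bracket[OF that] bundle_chart_domain_open[OF that] section_in_fiber[OF s] section_in_fiber[OF t])
  then show "(\<lambda>x. lie_bracket (\<LL> x) (s x) (t x)) \<in> carrier (sections k)"
    using s t by (simp add: sections_carrier_iff)
next
  assume s: "s \<in> carrier (sections k)"
  have "Ck k U (\<lambda>x. \<phi> (lie_scale (\<LL> x) c (s x)))" if "(U, \<phi>) \<in> \<Phi>" for U \<phi>
    by (rule Ck_cong[OF Ck_bounded_linear[OF bounded_linear_scl[of c] _ section_Ck[OF s that]]])
      (simp_all add: bc_scale[OF that] bundle_chart_domain_open[OF that] section_in_fiber[OF s])
  then show "(\<lambda>x. lie_scale (\<LL> x) c (s x)) \<in> carrier (sections k)"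
    using s by (simp add: sections_carrier_iff)
qed

text \<open>At each point at most one \<eta> S is nonzero, so the cut-off local sections combine
  without any addition across different charts. Regularity is checked in an arbitrary chart \<psi>,
  where s is locally a finite sum of cut-off terms extended by 0.\<close>

lemma glued_section:
  assumes \<eta>: "\<And>S. S \<in> I \<Longrightarrow> Ck \<infinity> UNIV (\<eta> S :: 'm \<Rightarrow> real)"
    and C: "\<And>S. S \<in> I \<Longrightarrow> closed (C S)" "\<And>S. S \<in> I \<Longrightarrow> C S \<subseteq> V S" "\<And>S x. S \<in> I \<Longrightarrow> \<eta> S x \<noteq> 0 \<Longrightarrow> x \<in> C S"
    and V: "\<And>S. S \<in> I \<Longrightarrow> (V S, \<phi> S) \<in> \<Phi>"
    and disj: "\<And>S S' x. S \<in> I \<Longrightarrow> S' \<in> I \<Longrightarrow> \<eta> S x \<noteq> 0 \<Longrightarrow> \<eta> S' x \<noteq> 0 \<Longrightarrow> S = S'"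
    and lf: "\<And>x. \<exists>W. open W \<and> x \<in> W \<and> finite {S \<in> I. \<exists>y\<in>W. \<eta> S y \<noteq> 0}"
    and u: "\<And>S. S \<in> I \<Longrightarrow> Ck k (V S) (u S)"
  obtains s where "s \<in> carrier (sections k)"
    "\<And>S x. S \<in> I \<Longrightarrow> \<eta> S x \<noteq> 0 \<Longrightarrow> \<phi> S (s x) = \<eta> S x *\<^sub>R u S x"
    "\<And>x. (\<And>S. S \<in> I \<Longrightarrow> \<eta> S x = 0) \<Longrightarrow> s x = lie_zero (\<LL> x)"
proof -
  define P where "P x S \<longleftrightarrow> S \<in> I \<and> \<eta> S x \<noteq> 0" for x S
  have unique: "(SOME S. P x S) = S" if "P x S" for x S
    using someI[of "P x", OF that] disj that unfolding P_def by blast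
  define s where "s x = (if \<exists>S. P x S then
    fiber_inv (\<phi> (SOME S. P x S)) x (\<eta> (SOME S. P x S) x *\<^sub>R u (SOME S. P x S) x) else lie_zero (\<LL> x))" for x
  have s1: "s x = fiber_inv (\<phi> S) x (\<eta> S x *\<^sub>R u S x)" "x \<in> V S" if "P x S" for x S
  proof -
    show "s x = fiber_inv (\<phi> S) x (\<eta> S x *\<^sub>R u S x)"
      using that unique[OF that] unfolding s_def by (metis (mono_tags))
    show "x \<in> V S" using that C unfolding P_def by blast
  qed
  have s0: "s x = lie_zero (\<LL> x)" if "\<not> (\<exists>S. P x S)" for x using that by (simp add: s_def)
  have \<pi>s: "\<pi> (s x) = x" for x
  proof (cases "\<exists>S. P x S")
    case True
    then obtain S where S: "P x S" by blast
    then have "(V S, \<phi> S) \<in> \<Phi>" using V by (simp add: P_def)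
    from bundle_chart_fiber_inv(1)[OF this s1(2)[OF S]] show ?thesis by (simp add: s1(1)[OF S])
  qed (simp add: s0)
  have "Ck k V' (\<lambda>x. \<psi> (s x))" if V': "(V', \<psi>) \<in> \<Phi>" for V' \<psi>
  proof (rule Ck_local)
    have oV': "open V'" by (rule bundle_chart_domain_open[OF V'])
    \<comment> \<open>The term of S read in the chart \<psi>. It is of class \<open>Ck\<close> also
      at points outside V S, because it vanishes on the complement of the closed set C S.\<close>
    define g where "g S x = (if x \<in> V S then \<eta> S x *\<^sub>R \<psi> (fiber_inv (\<phi> S) x (u S x)) else 0)" for S x
    have g: "Ck k V' (g S)" if S: "S \<in> I" for S
    proof (rule Ck_local)
      have oV: "open (V S)" by (rule bundle_chart_domain_open[OF V[OF S]])
      fix x assume x: "x \<in> V'"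
      show "\<exists>T. open T \<and> x \<in> T \<and> Ck k T (g S)"
      proof (cases "x \<in> V S")
        case True
        let ?T = "V' \<inter> V S"
        have oT: "open ?T" using oV oV' by auto
        have "Ck k ?T (\<lambda>x. \<psi> (fiber_inv (\<phi> S) x (u S x)))"
          by (rule Ck_transition[OF V[OF S] V' oT _ Ck_subset[OF u[OF S]]]) auto
        moreover have "Ck k ?T (\<eta> S)" by (rule Ck_subset[OF Ck_infinityD[OF \<eta>[OF S]]]) simp
        ultimately have "Ck k ?T (\<lambda>x. \<eta> S x *\<^sub>R \<psi> (fiber_inv (\<phi> S) x (u S x)))"
          by (intro Ck_scaleR oT)
        then have "Ck k ?T (g S)" by (rule Ck_cong[OF _ oT]) (simp add: g_def)
        then show ?thesis using oT x True by blast
      next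
        case False
        have oC: "open (- C S)" using C(1)[OF S] by (simp add: open_Compl)
        have "g S x = 0" if "x \<in> - C S" for x using that C(3)[OF S, of x] by (auto simp: g_def)
        then have "Ck k (- C S) (g S)" by (intro Ck_cong[OF Ck_const[of _ _ 0] oC]) simp
        then show ?thesis using oC False C(2)[OF S] by blast
      qed
    qed
    fix x assume x: "x \<in> V'"
    obtain W where W: "open W" "x \<in> W" "finite {S \<in> I. \<exists>y\<in>W. \<eta> S y \<noteq> 0}" using lf by blast
    let ?J = "{S \<in> I. \<exists>y\<in>W. \<eta> S y \<noteq> 0}" and ?T = "W \<inter> V'"
    have oT: "open ?T" using W oV' by auto
    have sum: "Ck k ?T (\<lambda>x. \<Sum>S\<in>?J. g S x)"
      by (rule Ck_sum[OF oT]) (rule Ck_subset[OF g], auto)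
    have eq: "(\<Sum>S\<in>?J. g S y) = \<psi> (s y)" if y: "y \<in> ?T" for y
    proof (cases "\<exists>S. P y S")
      case True
      then obtain S where S: "P y S" by blast
      have SJ: "S \<in> ?J" using S y unfolding P_def by blast
      have "g S' y = 0" if "S' \<in> ?J - {S}" for S'
      proof -
        have "\<eta> S' y = 0" using that S disj[of S S' y] unfolding P_def by blast
        then show ?thesis by (simp add: g_def)
      qed
      then have "(\<Sum>S'\<in>?J. g S' y) = g S y"
        using SJ W(3) by (subst sum.remove[of _ S]) (auto intro: sum.neutral)
      also have "\<dots> = \<psi> (s y)"
      proof -
        have VS: "(V S, \<phi> S) \<in> \<Phi>" using S V by (simp add: P_def)
        have "linear (\<lambda>w. \<psi> (fiber_inv (\<phi> S) y w))" (is "linear ?f")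
          using bounded_linear_transition[OF VS s1(2)[OF S] V'] y by (auto intro: bounded_linear.linear)
        from linear_cmul[OF this, of "\<eta> S y" "u S y"] show ?thesis by (simp add: g_def s1[OF S])
      qed
      finally show ?thesis .
    next
      case False
      then have "g S y = 0" if "S \<in> ?J" for S using that by (auto simp: g_def P_def)
      then show ?thesis using y by (simp add: s0[OF False] bc_zero[OF V'])
    qed
    have "Ck k ?T (\<lambda>x. \<psi> (s x))" by (rule Ck_cong[OF sum oT eq])
    then show "\<exists>T. open T \<and> x \<in> T \<and> Ck k T (\<lambda>x. \<psi> (s x))"
      using oT W(2) x by (intro exI[of _ ?T]) simp
  qed
  then have "s \<in> carrier (sections k)" using \<pi>s by (simp add: sections_carrier_iff)
  moreover have "\<phi> S (s x) = \<eta> S x *\<^sub>R u S x" if "S \<in> I" "\<eta> S x \<noteq> 0" for S x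
  proof -
    have S: "P x S" using that by (simp add: P_def)
    show ?thesis unfolding s1(1)[OF S] by (rule bundle_chart_fiber_inv(2)[OF V[OF that(1)] s1(2)[OF S]])
  qed
  moreover have "s x = lie_zero (\<LL> x)" if "\<And>S. S \<in> I \<Longrightarrow> \<eta> S x = 0" for x
    using that by (intro s0) (auto simp: P_def)
  ultimately show thesis by (rule that)
qed

lemma bump_section:
  assumes "(V, \<phi>) \<in> \<Phi>" "Ck \<infinity> UNIV (\<rho> :: 'm \<Rightarrow> real)" "closed C" "C \<subseteq> V" "\<And>x. \<rho> x \<noteq> 0 \<Longrightarrow> x \<in> C" "Ck k V u"
  obtains s where "s \<in> carrier (sections k)" "\<And>x. x \<in> V \<Longrightarrow> \<phi> (s x) = \<rho> x *\<^sub>R u x"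
proof -
  have lf: "\<exists>W. open W \<and> x \<in> W \<and> finite {S \<in> {()}. \<exists>y\<in>W. \<rho> y \<noteq> 0}" for x
    by (intro exI[of _ UNIV]) simp
  obtain s where s: "s \<in> carrier (sections k)"
    "\<And>S x. S \<in> {()} \<Longrightarrow> \<rho> x \<noteq> 0 \<Longrightarrow> \<phi> (s x) = \<rho> x *\<^sub>R u x"
    "\<And>x. (\<And>S. S \<in> {()} \<Longrightarrow> \<rho> x = 0) \<Longrightarrow> s x = lie_zero (\<LL> x)"
    by (rule glued_section[of "{()}" "\<lambda>_. \<rho>" "\<lambda>_. C" "\<lambda>_. V" "\<lambda>_. \<phi>" k "\<lambda>_. u"]) (use assms lf in auto)
  have "\<phi> (s x) = \<rho> x *\<^sub>R u x" if "x \<in> V" for x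
    using s(2)[of "()" x] s(3)[of x] bc_zero[OF assms(1) that] by (cases "\<rho> x = 0") auto
  with s(1) show thesis by (rule that)
qed

text \<open>Evaluation at x maps the sections onto the fiber. This provides test elements in the
  centerfree case and lets a map of sections act on fiber vectors.\<close>

lemma section_through:
  assumes "\<pi> v = x"
  obtains s where "s \<in> carrier (sections k)" "s x = v"
proof -
  obtain V \<phi> where V: "(V, \<phi>) \<in> \<Phi>" "x \<in> V" using bundle_chart_at by blast
  obtain \<rho> :: "'m \<Rightarrow> real" and C where \<rho>: "Ck \<infinity> UNIV \<rho>" "\<And>x. \<rho> x \<ge> 0" "\<rho> x > 0" "compact C" "C \<subseteq> V"
    "\<And>x. \<rho> x \<noteq> 0 \<Longrightarrow> x \<in> C"
    using bump_exists[OF bundle_chart_domain_open[OF V(1)] V(2)] by metis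
  obtain s where s: "s \<in> carrier (sections k)" "\<And>y. y \<in> V \<Longrightarrow> \<phi> (s y) = \<rho> y *\<^sub>R (inverse (\<rho> x) *\<^sub>R \<phi> v)"
    using bump_section[where k = k and u = "\<lambda>_. inverse (\<rho> x) *\<^sub>R \<phi> v",
        OF V(1) \<rho>(1) compact_imp_closed[OF \<rho>(4)] \<rho>(5) _ Ck_const] \<rho>(6) by blast
  have "\<phi> (s x) = \<phi> v" using s(2)[OF V(2)] \<rho>(3) by simp
  then have "s x = v" by (rule bundle_chart_eqI[OF V section_in_fiber[OF s(1)] assms])
  with s(1) show thesis by (rule that)
qed

section \<open>Sections as sums of brackets\<close>

text \<open>For each colour p and each term j of the decomposition in the fiber, glue
  \<open>\<eta> S / D\<close> times \<open>l j\<close> of s to A and \<eta> S times b j to B. Both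
  entries must be cut off to become global, so their bracket carries the square of \<eta> S, and D
  is the sum of these squares over all colours. Linearity of l j makes A vanish wherever s
  does.\<close>

lemma section_sum_of_brackets:
  assumes perf: "perfect_lie_algebra scl bracket" and s: "s \<in> carrier (sections k)"
  obtains Q :: "(nat \<times> nat) set" and A B where "finite Q"
    "\<And>q. A q \<in> carrier (sections k)" "\<And>q. B q \<in> carrier (sections k)"
    "\<And>U \<phi> x. (U, \<phi>) \<in> \<Phi> \<Longrightarrow> x \<in> U \<Longrightarrow> \<phi> (s x) = (\<Sum>q\<in>Q. bracket (\<phi> (A q x)) (\<phi> (B q x)))"
    "\<And>q x. q \<in> Q \<Longrightarrow> s x = lie_zero (\<LL> x) \<Longrightarrow> A q x = lie_zero (\<LL> x)"
proof -
  obtain m :: nat and l :: "nat \<Rightarrow> 'f \<Rightarrow> 'f" and b where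
    l: "\<And>j. j < m \<Longrightarrow> bounded_linear (l j)" "\<And>v. (\<Sum>j<m. bracket (l j v) (b j)) = v"
    using perfect_decomposition[OF perf] by metis
  have "\<forall>y. \<exists>V \<phi>. (V, \<phi>) \<in> \<Phi> \<and> y \<in> V" using bundle_chart_at by blast
  then obtain VV ph where VV: "\<And>y. (VV y, ph y) \<in> \<Phi>" "\<And>y. y \<in> VV y" by metis
  obtain \<eta> :: "nat set \<Rightarrow> 'm \<Rightarrow> real" and C :: "nat set \<Rightarrow> 'm set" and \<I> :: "nat \<Rightarrow> nat set set" and n :: nat where
    \<eta>: "\<And>p S. S \<in> \<I> p \<Longrightarrow> Ck \<infinity> UNIV (\<eta> S)" and C: "\<And>p S. S \<in> \<I> p \<Longrightarrow> closed (C S)"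
      "\<And>p S. S \<in> \<I> p \<Longrightarrow> \<exists>y. C S \<subseteq> VV y" "\<And>p S x. S \<in> \<I> p \<Longrightarrow> \<eta> S x \<noteq> 0 \<Longrightarrow> x \<in> C S" and
    disj: "\<And>p S S' x. S \<in> \<I> p \<Longrightarrow> S' \<in> \<I> p \<Longrightarrow> \<eta> S x \<noteq> 0 \<Longrightarrow> \<eta> S' x \<noteq> 0 \<Longrightarrow> S = S'" and
    cov: "\<And>x. \<exists>p<n. \<exists>S\<in>\<I> p. \<eta> S x \<noteq> 0" and
    lf: "\<And>p x. \<exists>W. open W \<and> x \<in> W \<and> finite {S \<in> \<I> p. \<exists>y\<in>W. \<eta> S y \<noteq> 0}"
    apply (rule coloured_bump_cover[of VV, OF bundle_chart_domain_open[OF VV(1)] VV(2)])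
    subgoal premises p for \<eta> C \<I> n by (rule that[of \<I> \<eta> C n]) (fact p)+
    done
  define yy where "yy S = (SOME y. C S \<subseteq> VV y)" for S
  define V where "V S = VV (yy S)" for S
  define \<phi> where "\<phi> S = ph (yy S)" for S
  have V: "(V S, \<phi> S) \<in> \<Phi>" for S by (simp add: V_def \<phi>_def VV(1))
  have CV: "C S \<subseteq> V S" if "S \<in> \<I> p" for S p
    using someI_ex[OF C(2)[OF that]] by (simp add: V_def yy_def)
  have xV: "x \<in> V S" if "S \<in> \<I> p" "\<eta> S x \<noteq> 0" for S p x using CV[OF that(1)] C(3)[OF that] by blast
  \<comment> \<open>At most one S of colour p is active at x, so this is a single square; written as
    a sum it is visibly smooth, by local finiteness.\<close>
  define E where "E p x = (\<Sum>S\<in>{S \<in> \<I> p. \<eta> S x \<noteq> 0}. (\<eta> S x)\<^sup>2)" for p x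
  define D where "D x = (\<Sum>p<n. E p x)" for x
  have E: "E p x = (\<eta> S x)\<^sup>2" if "S \<in> \<I> p" "\<eta> S x \<noteq> 0" for p x S
  proof -
    have "{S \<in> \<I> p. \<eta> S x \<noteq> 0} = {S}" using that disj[OF _ that(1) _ that(2)] by blast
    then show ?thesis by (simp add: E_def)
  qed
  have E0: "E p x = 0" if "\<And>S. S \<in> \<I> p \<Longrightarrow> \<eta> S x = 0" for p x
  proof -
    have "{S \<in> \<I> p. \<eta> S x \<noteq> 0} = {}" using that by blast
    then show ?thesis by (simp add: E_def)
  qed
  have E_nn: "E p x \<ge> 0" for p x unfolding E_def by (rule sum_nonneg) simp
  have Dpos: "D x > 0" for x
  proof -
    obtain p S where p: "p < n" "S \<in> \<I> p" "\<eta> S x \<noteq> 0" using cov by blast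
    then have "E p x > 0" using E by simp
    moreover have "E p x \<le> D x" unfolding D_def using p(1) E_nn by (intro member_le_sum) auto
    ultimately show ?thesis by linarith
  qed
  have CkE: "Ck \<infinity> UNIV (E p)" for p
  proof (rule Ck_local)
    fix x
    obtain W where W: "open W" "x \<in> W" "finite {S \<in> \<I> p. \<exists>y\<in>W. \<eta> S y \<noteq> 0}" using lf by blast
    let ?J = "{S \<in> \<I> p. \<exists>y\<in>W. \<eta> S y \<noteq> 0}"
    have "Ck \<infinity> W (\<lambda>y. \<eta> S y * \<eta> S y)" if "S \<in> ?J" for S
    proof -
      have "Ck \<infinity> W (\<eta> S)" by (rule Ck_subset[OF \<eta>[of S p]]) (use that in auto)
      then show ?thesis by (intro Ck_mult W(1))
    qed
    then have sum: "Ck \<infinity> W (\<lambda>y. \<Sum>S\<in>?J. \<eta> S y * \<eta> S y)" by (rule Ck_sum[OF W(1)])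
    have "(\<Sum>S\<in>?J. \<eta> S y * \<eta> S y) = E p y" if "y \<in> W" for y
      unfolding E_def power2_eq_square using that W(3) by (intro sum.mono_neutral_right) auto
    then have "Ck \<infinity> W (E p)" by (rule Ck_cong[OF sum W(1)])
    then show "\<exists>T. open T \<and> x \<in> T \<and> Ck \<infinity> T (E p)" using W by blast
  qed
  have CkD: "Ck k UNIV (\<lambda>x. inverse (D x))"
    unfolding D_def
    by (rule Ck_inverse[OF open_UNIV Ck_sum[OF open_UNIV Ck_infinityD[OF CkE]]])
      (use Dpos in \<open>simp add: D_def less_imp_neq[symmetric]\<close>)
  have glue: "\<exists>\<sigma>\<in>carrier (sections k). (\<forall>S\<in>\<I> p. \<forall>x. \<eta> S x \<noteq> 0 \<longrightarrow> \<phi> S (\<sigma> x) = \<eta> S x *\<^sub>R u S x) \<and>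
      (\<forall>x. (\<forall>S\<in>\<I> p. \<eta> S x = 0) \<longrightarrow> \<sigma> x = lie_zero (\<LL> x))"
    if u: "\<And>S. Ck k (V S) (u S)" for p u
    apply (rule glued_section[where I = "\<I> p" and \<eta> = \<eta> and C = C and V = V and \<phi> = \<phi> and k = k and u = u])
    subgoal by (rule \<eta>)
    subgoal by (rule C(1))
    subgoal by (rule CV)
    subgoal by (rule C(3))
    subgoal by (rule V)
    subgoal by (rule disj)
    subgoal by (rule lf)
    subgoal by (rule u)
    subgoal for \<sigma> by (rule bexI[of _ \<sigma>]) auto
    done
  \<comment> \<open>For \<open>j \<ge> m\<close> nothing is asked beyond being a section, so that
    the choice of A is total; s itself is the default.\<close>
  define PA where "PA p j \<sigma> \<longleftrightarrow> \<sigma> \<in> carrier (sections k) \<and>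
      (j < m \<longrightarrow> (\<forall>S\<in>\<I> p. \<forall>x. \<eta> S x \<noteq> 0 \<longrightarrow> \<phi> S (\<sigma> x) = \<eta> S x *\<^sub>R (inverse (D x) *\<^sub>R l j (\<phi> S (s x)))) \<and>
        (\<forall>x. (\<forall>S\<in>\<I> p. \<eta> S x = 0) \<longrightarrow> \<sigma> x = lie_zero (\<LL> x)))" for p j \<sigma>
  have "\<exists>\<sigma>. PA p j \<sigma>" for p j
  proof (cases "j < m")
    case True
    have "Ck k (V S) (\<lambda>x. inverse (D x) *\<^sub>R l j (\<phi> S (s x)))" for S
      using bundle_chart_domain_open[OF V]
      by (intro Ck_scaleR Ck_subset[OF CkD] subset_UNIV Ck_bounded_linear[OF l(1)[OF True]] section_Ck[OF s V])
    from glue[OF this, of p] show ?thesis unfolding PA_def by blast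
  qed (use s in \<open>auto simp: PA_def\<close>)
  then obtain A where PA: "\<And>p j. PA p j (A p j)" by metis
  have A1: "A p j \<in> carrier (sections k)" for p j using PA[of p j] by (simp add: PA_def)
  have A2: "\<phi> S (A p j x) = \<eta> S x *\<^sub>R (inverse (D x) *\<^sub>R l j (\<phi> S (s x)))"
    if "j < m" "S \<in> \<I> p" "\<eta> S x \<noteq> 0" for p j S x using PA[of p j] that by (simp add: PA_def)
  have A3: "A p j x = lie_zero (\<LL> x)" if "j < m" "\<And>S. S \<in> \<I> p \<Longrightarrow> \<eta> S x = 0" for p j x
    using PA[of p j] that by (simp add: PA_def)
  define PB where "PB p j \<sigma> \<longleftrightarrow> \<sigma> \<in> carrier (sections k) \<and>
      (\<forall>S\<in>\<I> p. \<forall>x. \<eta> S x \<noteq> 0 \<longrightarrow> \<phi> S (\<sigma> x) = \<eta> S x *\<^sub>R b j)" for p j \<sigma>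
  have "\<exists>\<sigma>. PB p j \<sigma>" for p j
    using glue[of "\<lambda>_ _. b j" p, OF Ck_const] unfolding PB_def by blast
  then obtain B where PB: "\<And>p j. PB p j (B p j)" by metis
  have B1: "B p j \<in> carrier (sections k)" for p j using PB[of p j] by (simp add: PB_def)
  have B2: "\<phi> S (B p j x) = \<eta> S x *\<^sub>R b j" if "S \<in> \<I> p" "\<eta> S x \<noteq> 0" for p j S x
    using PB[of p j] that by (simp add: PB_def)
  \<comment> \<open>Colour p contributes the fraction E p / D of s, and these fractions add up to
    1.\<close>
  have colour: "(\<Sum>j<m. bracket (\<psi> (A p j x)) (\<psi> (B p j x))) = (E p x * inverse (D x)) *\<^sub>R \<psi> (s x)"
    if U: "(U, \<psi>) \<in> \<Phi>" "x \<in> U" for U \<psi> x p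
  proof (cases "\<exists>S\<in>\<I> p. \<eta> S x \<noteq> 0")
    case True
    then obtain S where S: "S \<in> \<I> p" "\<eta> S x \<noteq> 0" by blast
    \<comment> \<open>A and B are known only in the chart \<phi> S that belongs to the colour. The
      single terms depend on that chart, as l j and b j are not invariant under automorphisms; their
      sum over j does not, so it can be carried over to \<psi>.\<close>
    let ?T = "\<lambda>w. \<psi> (fiber_inv (\<phi> S) x w)"
    have lin: "linear ?T"
      by (rule bounded_linear.linear[OF bounded_linear_transition[OF V xV[OF S] U]])
    have T: "\<psi> v = ?T (\<phi> S v)" if "\<pi> v = x" for v
      by (simp add: bundle_chart_fiber_inv(3)[OF V xV[OF S] that])
    have "bracket (\<psi> (A p j x)) (\<psi> (B p j x)) =
        ?T ((E p x * inverse (D x)) *\<^sub>R bracket (l j (\<phi> S (s x))) (b j))" if j: "j < m" for j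
    proof -
      note in_fiber = section_in_fiber[OF A1] section_in_fiber[OF B1]
      have "bracket (\<psi> (A p j x)) (\<psi> (B p j x)) = \<psi> (lie_bracket (\<LL> x) (A p j x) (B p j x))"
        by (rule bc_bracket[OF U in_fiber, symmetric])
      also have "\<dots> = ?T (\<phi> S (lie_bracket (\<LL> x) (A p j x) (B p j x)))"
        by (rule T) (simp add: in_fiber)
      also have "\<phi> S (lie_bracket (\<LL> x) (A p j x) (B p j x)) = bracket (\<phi> S (A p j x)) (\<phi> S (B p j x))"
        by (rule bc_bracket[OF V xV[OF S] in_fiber])
      also have "\<dots> = (E p x * inverse (D x)) *\<^sub>R bracket (l j (\<phi> S (s x))) (b j)"
        by (simp add: A2[OF j S] B2[OF S] bracket_scaleR_left bracket_scaleR_right E[OF S]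
            power2_eq_square mult_ac)
      finally show ?thesis .
    qed
    then have "(\<Sum>j<m. bracket (\<psi> (A p j x)) (\<psi> (B p j x))) =
        (\<Sum>j<m. ?T ((E p x * inverse (D x)) *\<^sub>R bracket (l j (\<phi> S (s x))) (b j)))" by simp
    also have "\<dots> = ?T (\<Sum>j<m. (E p x * inverse (D x)) *\<^sub>R bracket (l j (\<phi> S (s x))) (b j))"
      by (rule linear_sum[OF lin, symmetric])
    also have "\<dots> = ?T ((E p x * inverse (D x)) *\<^sub>R \<phi> S (s x))"
      by (simp add: scaleR_right.sum[symmetric] l(2))
    also have "\<dots> = (E p x * inverse (D x)) *\<^sub>R \<psi> (s x)"
      by (simp add: linear_cmul[OF lin] T[OF section_in_fiber[OF s]])
    finally show ?thesis .
  next
    case False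
    then have "A p j x = lie_zero (\<LL> x)" if "j < m" for j using A3[OF that] by blast
    then show ?thesis using False by (simp add: bc_zero[OF U] E0)
  qed
  show thesis
  proof (rule that[of "{..<n} \<times> {..<m}" "\<lambda>(p, j). A p j" "\<lambda>(p, j). B p j"])
    show "finite ({..<n} \<times> {..<m})" by simp
    show "(case q of (p, j) \<Rightarrow> A p j) \<in> carrier (sections k)"
      "(case q of (p, j) \<Rightarrow> B p j) \<in> carrier (sections k)" for q
      using A1 B1 by (simp_all split: prod.split)
    fix U \<psi> x assume U: "(U, \<psi>) \<in> \<Phi>" "x \<in> U"
    have "(\<Sum>q\<in>{..<n} \<times> {..<m}. bracket (\<psi> ((case q of (p, j) \<Rightarrow> A p j) x)) (\<psi> ((case q of (p, j) \<Rightarrow> B p j) x)))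
      = (\<Sum>p<n. \<Sum>j<m. bracket (\<psi> (A p j x)) (\<psi> (B p j x)))"
      unfolding sum.cartesian_product by (rule sum.cong) auto
    also have "\<dots> = (\<Sum>p<n. (E p x * inverse (D x)) *\<^sub>R \<psi> (s x))" by (simp only: colour[OF U])
    also have "\<dots> = (D x * inverse (D x)) *\<^sub>R \<psi> (s x)"
      by (simp only: scaleR_left.sum[symmetric] sum_distrib_right[symmetric] D_def)
    also have "\<dots> = \<psi> (s x)" using Dpos[of x] by simp
    finally show "\<psi> (s x) = (\<Sum>q\<in>{..<n} \<times> {..<m}. bracket (\<psi> ((case q of (p, j) \<Rightarrow> A p j) x)) (\<psi> ((case q of (p, j) \<Rightarrow> B p j) x)))"
      by simp
  next
    fix q x assume q: "q \<in> {..<n} \<times> {..<m}" and sx: "s x = lie_zero (\<LL> x)"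
    obtain p j where pj: "q = (p, j)" "j < m" using q by auto
    have "A p j x = lie_zero (\<LL> x)"
    proof (cases "\<exists>S\<in>\<I> p. \<eta> S x \<noteq> 0")
      case True
      then obtain S where S: "S \<in> \<I> p" "\<eta> S x \<noteq> 0" by blast
      have "l j 0 = 0" by (rule linear_0[OF bounded_linear.linear[OF l(1)[OF pj(2)]]])
      then have "\<phi> S (A p j x) = \<phi> S (lie_zero (\<LL> x))"
        by (simp add: A2[OF pj(2) S] sx bc_zero[OF V xV[OF S]])
      then show ?thesis
        by (rule bundle_chart_eqI[OF V xV[OF S] section_in_fiber[OF A1] fiber_closed(1)])
    next
      case False
      then show ?thesis using A3[OF pj(2)] by blast
    qed
    then show "(case q of (p, j) \<Rightarrow> A p j) x = lie_zero (\<LL> x)" by (simp add: pj)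
  qed
qed

section \<open>Elements of the centroid act fiberwise\<close>

lemma centroid_sectionsD:
  assumes "f \<in> carrier (centroid (sections k))"
  shows "s \<in> carrier (sections k) \<Longrightarrow> f s \<in> carrier (sections k)"
    and "s \<in> carrier (sections k) \<Longrightarrow> t \<in> carrier (sections k) \<Longrightarrow>
      f (\<lambda>x. lie_add (\<LL> x) (s x) (t x)) = (\<lambda>x. lie_add (\<LL> x) (f s x) (f t x))"
    and "s \<in> carrier (sections k) \<Longrightarrow>
      f (\<lambda>x. lie_scale (\<LL> x) c (s x)) = (\<lambda>x. lie_scale (\<LL> x) c (f s x))"
    and "s \<in> carrier (sections k) \<Longrightarrow> t \<in> carrier (sections k) \<Longrightarrow>
      f (\<lambda>x. lie_bracket (\<LL> x) (s x) (t x)) = (\<lambda>x. lie_bracket (\<LL> x) (s x) (f t x))"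
    and "f \<in> extensional (carrier (sections k))"
  using assms by (auto simp: centroid_def endomorphisms_def PiE_iff)

text \<open>A \<open>lie_structure\<close> has no axioms from which additivity would give this;
  instead 0 is written as 0 times itself, f is homogeneous, and the result is evaluated in a
  chart.\<close>

lemma centroid_sections_zero:
  assumes "f \<in> carrier (centroid (sections k))"
  shows "f (\<lambda>x. lie_zero (\<LL> x)) = (\<lambda>x. lie_zero (\<LL> x))"
proof
  fix x
  obtain U \<phi> where U: "(U, \<phi>) \<in> \<Phi>" "x \<in> U" using bundle_chart_at by blast
  note f = centroid_sectionsD[OF assms] and z = sections_closed(1)
  have "lie_scale (\<LL> y) 0 (lie_zero (\<LL> y)) = lie_zero (\<LL> y)" for y
  proof -
    obtain V \<psi> where V: "(V, \<psi>) \<in> \<Phi>" "y \<in> V" using bundle_chart_at by blast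
    show ?thesis by (rule bundle_chart_eqI[OF V]) (simp_all add: bc_zero[OF V] bc_scale[OF V])
  qed
  then have "f (\<lambda>x. lie_zero (\<LL> x)) = f (\<lambda>x. lie_scale (\<LL> x) 0 (lie_zero (\<LL> x)))" by simp
  also have "\<dots> = (\<lambda>x. lie_scale (\<LL> x) 0 (f (\<lambda>x. lie_zero (\<LL> x)) x))" by (rule f(3)[OF z])
  finally have eq: "f (\<lambda>x. lie_zero (\<LL> x)) x = lie_scale (\<LL> x) 0 (f (\<lambda>x. lie_zero (\<LL> x)) x)" by (rule fun_cong)
  have in_fiber: "\<pi> (f (\<lambda>x. lie_zero (\<LL> x)) x) = x" by (rule section_in_fiber[OF f(1)[OF z]])
  have "\<phi> (lie_scale (\<LL> x) 0 (f (\<lambda>x. lie_zero (\<LL> x)) x)) = \<phi> (lie_zero (\<LL> x))"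
    by (simp add: bc_scale[OF U in_fiber] bc_zero[OF U])
  then have "lie_scale (\<LL> x) 0 (f (\<lambda>x. lie_zero (\<LL> x)) x) = lie_zero (\<LL> x)"
    by (rule bundle_chart_eqI[OF U, rotated 2]) (simp_all add: in_fiber)
  with eq show "f (\<lambda>x. lie_zero (\<LL> x)) x = lie_zero (\<LL> x)" by simp
qed

lemma centroid_vanish_perfect:
  assumes perf: "perfect_lie_algebra scl bracket" and f: "f \<in> carrier (centroid (sections k))"
    and s: "s \<in> carrier (sections k)" and sx: "s x = lie_zero (\<LL> x)"
  shows "f s x = lie_zero (\<LL> x)"
proof -
  note fD = centroid_sectionsD[OF f]
  obtain Q :: "(nat \<times> nat) set" and A B where Q: "finite Q"
    "\<And>q. A q \<in> carrier (sections k)" "\<And>q. B q \<in> carrier (sections k)"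
    "\<And>U \<phi> x. (U, \<phi>) \<in> \<Phi> \<Longrightarrow> x \<in> U \<Longrightarrow> \<phi> (s x) = (\<Sum>q\<in>Q. bracket (\<phi> (A q x)) (\<phi> (B q x)))"
    "\<And>q x. q \<in> Q \<Longrightarrow> s x = lie_zero (\<LL> x) \<Longrightarrow> A q x = lie_zero (\<LL> x)"
    apply (rule section_sum_of_brackets[OF perf s])
    subgoal premises p for Q A B by (rule that[of Q A B]) (fact p)+
    done
  \<comment> \<open>Additivity of f is used one bracket at a time: the induction builds the partial
    sums as sections t with \<open>f t x\<close> zero. The full sum is s because it agrees with s in
    every chart.\<close>
  have "F \<subseteq> Q \<Longrightarrow> \<exists>t\<in>carrier (sections k). f t x = lie_zero (\<LL> x) \<and>
      (\<forall>U \<phi> y. (U, \<phi>) \<in> \<Phi> \<longrightarrow> y \<in> U \<longrightarrow> \<phi> (t y) = (\<Sum>q\<in>F. bracket (\<phi> (A q y)) (\<phi> (B q y))))"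
    if "finite F" for F
    using that
  proof (induction F)
    case empty
    show ?case
      by (rule bexI[OF _ sections_closed(1)]) (auto simp: centroid_sections_zero[OF f] bc_zero)
  next
    case (insert q F)
    then obtain t where t: "t \<in> carrier (sections k)" "f t x = lie_zero (\<LL> x)"
      "\<And>U \<phi> y. (U, \<phi>) \<in> \<Phi> \<Longrightarrow> y \<in> U \<Longrightarrow> \<phi> (t y) = (\<Sum>q\<in>F. bracket (\<phi> (A q y)) (\<phi> (B q y)))"
      by auto
    let ?b = "\<lambda>x. lie_bracket (\<LL> x) (A q x) (B q x)"
    have b: "?b \<in> carrier (sections k)" by (rule sections_closed(4)[OF Q(2,3)])
    let ?t = "\<lambda>x. lie_add (\<LL> x) (?b x) (t x)"
    have "\<phi> (?t y) = (\<Sum>q\<in>insert q F. bracket (\<phi> (A q y)) (\<phi> (B q y)))"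
      if U: "(U, \<phi>) \<in> \<Phi>" "y \<in> U" for U \<phi> y
      using insert(1,2) by (simp add: bc_add[OF U] bc_bracket[OF U] section_in_fiber[OF t(1)]
          section_in_fiber[OF Q(2)] section_in_fiber[OF Q(3)] t(3)[OF U])
    moreover have "f ?t x = lie_zero (\<LL> x)"
    proof -
      obtain U \<phi> where U: "(U, \<phi>) \<in> \<Phi>" "x \<in> U" using bundle_chart_at by blast
      have "f ?t x = lie_add (\<LL> x) (lie_bracket (\<LL> x) (A q x) (f (B q) x)) (f t x)"
        by (simp only: fD(2)[OF b t(1)] fD(4)[OF Q(2,3)])
      also have "A q x = lie_zero (\<LL> x)" using Q(5)[OF _ sx] insert by blast
      finally have eq: "f ?t x = lie_add (\<LL> x) (lie_bracket (\<LL> x) (lie_zero (\<LL> x)) (f (B q) x)) (lie_zero (\<LL> x))"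
        by (simp only: t(2))
      have in_fiber: "\<pi> (f (B q) x) = x" by (rule section_in_fiber[OF fD(1)[OF Q(3)]])
      show ?thesis unfolding eq
        by (rule bundle_chart_eqI[OF U]) (simp_all add: in_fiber bc_add[OF U] bc_bracket[OF U] bc_zero[OF U])
    qed
    moreover have "?t \<in> carrier (sections k)" by (rule sections_closed(2)[OF b t(1)])
    ultimately show ?case by (intro bexI[of _ ?t]) auto
  qed
  from this[OF Q(1) subset_refl] obtain t where t: "t \<in> carrier (sections k)" "f t x = lie_zero (\<LL> x)"
    "\<And>U \<phi> y. (U, \<phi>) \<in> \<Phi> \<Longrightarrow> y \<in> U \<Longrightarrow> \<phi> (t y) = (\<Sum>q\<in>Q. bracket (\<phi> (A q y)) (\<phi> (B q y)))" by auto
  have "t = s"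
  proof
    fix y
    obtain U \<phi> where U: "(U, \<phi>) \<in> \<Phi>" "y \<in> U" using bundle_chart_at by blast
    show "t y = s y"
      by (rule bundle_chart_eqI[OF U section_in_fiber[OF t(1)] section_in_fiber[OF s]])
        (simp add: t(3)[OF U] Q(4)[OF U])
  qed
  then show ?thesis using t(2) by simp
qed

lemma centroid_vanish_centerfree:
  assumes cf: "centerfree_lie_algebra bracket" and f: "f \<in> carrier (centroid (sections k))"
    and s: "s \<in> carrier (sections k)" and sx: "s x = lie_zero (\<LL> x)"
  shows "f s x = lie_zero (\<LL> x)"
proof -
  note fD = centroid_sectionsD[OF f]
  obtain U \<phi> where U: "(U, \<phi>) \<in> \<Phi>" "x \<in> U" using bundle_chart_at by blast
  note ops = bundle_chart_ops[OF U]
  have "bracket (\<phi> (f s x)) w = 0" for w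
  proof -
    have "\<pi> (fiber_inv \<phi> x w) = x" by (rule bundle_chart_fiber_inv(1)[OF U])
    then obtain t where t: "t \<in> carrier (sections k)" "t x = fiber_inv \<phi> x w"
      by (rule section_through)
    \<comment> \<open>f passes to the right entry of a bracket. Swapping the entries first leaves s,
      which vanishes at x, as the entry that f does not touch.\<close>
    have "(\<lambda>y. lie_bracket (\<LL> y) (t y) (s y)) = (\<lambda>y. lie_scale (\<LL> y) (- 1) (lie_bracket (\<LL> y) (s y) (t y)))"
    proof
      fix y
      obtain V \<psi> where V: "(V, \<psi>) \<in> \<Phi>" "y \<in> V" using bundle_chart_at by blast
      have "bracket (\<psi> (t y)) (\<psi> (s y)) = scl (- 1) (bracket (\<psi> (s y)) (\<psi> (t y)))"
        using bracket_antisym[of "\<psi> (t y)" "\<psi> (s y)"] by simp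
      then show "lie_bracket (\<LL> y) (t y) (s y) = lie_scale (\<LL> y) (- 1) (lie_bracket (\<LL> y) (s y) (t y))"
        by (intro bundle_chart_eqI[OF V])
          (simp_all add: section_in_fiber[OF s] section_in_fiber[OF t(1)] bc_scale[OF V] bc_bracket[OF V])
    qed
    then have "f (\<lambda>y. lie_bracket (\<LL> y) (t y) (s y)) = f (\<lambda>y. lie_scale (\<LL> y) (- 1) (lie_bracket (\<LL> y) (s y) (t y)))"
      by simp
    then have "lie_bracket (\<LL> x) (t x) (f s x) = lie_scale (\<LL> x) (- 1) (lie_bracket (\<LL> x) (s x) (f t x))"
      unfolding fD(4)[OF t(1) s] fD(3)[OF sections_closed(4)[OF s t(1)]] fD(4)[OF s t(1)] by (rule fun_cong)
    then have "\<phi> (lie_bracket (\<LL> x) (t x) (f s x)) = \<phi> (lie_scale (\<LL> x) (- 1) (lie_bracket (\<LL> x) (s x) (f t x)))"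
      by simp
    then have "bracket (\<phi> (t x)) (\<phi> (f s x)) = 0"
      by (simp add: section_in_fiber[OF s] section_in_fiber[OF t(1)] section_in_fiber[OF fD(1)[OF s]]
          section_in_fiber[OF fD(1)[OF t(1)]] ops sx)
    then have "bracket w (\<phi> (f s x)) = 0" by (simp add: t(2) bundle_chart_fiber_inv(2)[OF U])
    then show ?thesis using bracket_antisym[of "\<phi> (f s x)" w] by simp
  qed
  then have "\<phi> (f s x) = 0" using cf unfolding centerfree_lie_algebra_def by blast
  then show ?thesis
    by (intro bundle_chart_eqI[OF U section_in_fiber[OF fD(1)[OF s]]]) (simp_all add: ops)
qed

lemma centroid_pointwise:
  assumes pc: "perfect_lie_algebra scl bracket \<or> centerfree_lie_algebra bracket"
    and f: "f \<in> carrier (centroid (sections k))"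
    and s: "s \<in> carrier (sections k)" and t: "t \<in> carrier (sections k)" and eq: "s x = t x"
  shows "f s x = f t x"
proof -
  note fD = centroid_sectionsD[OF f]
  obtain U \<phi> where U: "(U, \<phi>) \<in> \<Phi>" "x \<in> U" using bundle_chart_at by blast
  note ops = bundle_chart_ops[OF U]
  note in_fiber = section_in_fiber[OF s] section_in_fiber[OF t] section_in_fiber[OF fD(1)[OF s]]
    section_in_fiber[OF fD(1)[OF t]]
  let ?u = "\<lambda>y. lie_scale (\<LL> y) (- 1) (t y)"
  let ?d = "\<lambda>y. lie_add (\<LL> y) (s y) (?u y)"
  have u: "?u \<in> carrier (sections k)" by (rule sections_closed(3)[OF t])
  have d: "?d \<in> carrier (sections k)" by (rule sections_closed(2)[OF s u])
  have "?d x = lie_zero (\<LL> x)"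
    by (rule bundle_chart_eqI[OF U]) (simp_all add: in_fiber ops eq)
  then have "f ?d x = lie_zero (\<LL> x)"
    using pc centroid_vanish_perfect[OF _ f d] centroid_vanish_centerfree[OF _ f d] by blast
  then have "lie_add (\<LL> x) (f s x) (lie_scale (\<LL> x) (- 1) (f t x)) = lie_zero (\<LL> x)"
    by (simp only: fD(2)[OF s u] fD(3)[OF t])
  then have "\<phi> (lie_add (\<LL> x) (f s x) (lie_scale (\<LL> x) (- 1) (f t x))) = \<phi> (lie_zero (\<LL> x))" by simp
  then have "\<phi> (f s x) = \<phi> (f t x)" by (simp add: in_fiber ops)
  then show ?thesis by (rule bundle_chart_eqI[OF U in_fiber(3,4)])
qed

section \<open>The isomorphism\<close>

text \<open>For f in the centroid and a perfect or centerfree fiber,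
  \<open>centroid_pointwise\<close> makes the choice of the section through v immaterial.\<close>

definition fiberwise :: "enat \<Rightarrow> (('m \<Rightarrow> 'l) \<Rightarrow> 'm \<Rightarrow> 'l) \<Rightarrow> 'm \<Rightarrow> 'l \<Rightarrow> 'l" where
  "fiberwise k f = (\<lambda>x. \<lambda>v\<in>carrier (\<LL> x). f (SOME s. s \<in> carrier (sections k) \<and> s x = v) x)"

definition sectionwise :: "enat \<Rightarrow> ('m \<Rightarrow> 'l \<Rightarrow> 'l) \<Rightarrow> ('m \<Rightarrow> 'l) \<Rightarrow> 'm \<Rightarrow> 'l" where
  "sectionwise k A = (\<lambda>s\<in>carrier (sections k). \<lambda>x. A x (s x))"

lemma fiberwise_apply:
  assumes "perfect_lie_algebra scl bracket \<or> centerfree_lie_algebra bracket"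
    and "f \<in> carrier (centroid (sections k))" "s \<in> carrier (sections k)"
  shows "fiberwise k f x (s x) = f s x"
proof -
  let ?t = "SOME t. t \<in> carrier (sections k) \<and> t x = s x"
  have "?t \<in> carrier (sections k) \<and> ?t x = s x" by (rule someI[of _ s]) (simp add: assms(3))
  then have "f ?t x = f s x" by (intro centroid_pointwise[OF assms(1,2) _ assms(3)]) simp_all
  then show ?thesis by (simp add: fiberwise_def carrier_fiber section_in_fiber[OF assms(3)])
qed

lemma fiberwise_in_centroid:
  assumes pc: "perfect_lie_algebra scl bracket \<or> centerfree_lie_algebra bracket"
    and f: "f \<in> carrier (centroid (sections k))"
  shows "fiberwise k f x \<in> carrier (centroid (\<LL> x))"
proof -
  note app = fiberwise_apply[OF pc f] and fD = centroid_sectionsD[OF f]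
  have ext: "fiberwise k f x \<in> extensional (\<pi> -` {x})"
    by (simp add: fiberwise_def carrier_fiber)
  have closed: "\<pi> (fiberwise k f x v) = x" if v: "\<pi> v = x" for v
  proof -
    obtain s where s: "s \<in> carrier (sections k)" "s x = v" using section_through[OF v] by blast
    show ?thesis using app[OF s(1), of x] section_in_fiber[OF fD(1)[OF s(1)]] s(2) by simp
  qed
  have add: "fiberwise k f x (lie_add (\<LL> x) v w) = lie_add (\<LL> x) (fiberwise k f x v) (fiberwise k f x w)"
    and br: "fiberwise k f x (lie_bracket (\<LL> x) v w) = lie_bracket (\<LL> x) v (fiberwise k f x w)"
    if v: "\<pi> v = x" and w: "\<pi> w = x" for v w
  proof -
    obtain s where s: "s \<in> carrier (sections k)" "s x = v" using section_through[OF v] by blast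
    obtain t where t: "t \<in> carrier (sections k)" "t x = w" using section_through[OF w] by blast
    show "fiberwise k f x (lie_add (\<LL> x) v w) = lie_add (\<LL> x) (fiberwise k f x v) (fiberwise k f x w)"
      using app[OF sections_closed(2)[OF s(1) t(1)], of x] app[OF s(1), of x] app[OF t(1), of x]
      by (simp add: fD(2)[OF s(1) t(1)] s(2) t(2))
    show "fiberwise k f x (lie_bracket (\<LL> x) v w) = lie_bracket (\<LL> x) v (fiberwise k f x w)"
      using app[OF sections_closed(4)[OF s(1) t(1)], of x] app[OF t(1), of x]
      by (simp add: fD(4)[OF s(1) t(1)] s(2) t(2))
  qed
  have scale: "fiberwise k f x (lie_scale (\<LL> x) c v) = lie_scale (\<LL> x) c (fiberwise k f x v)"
    if v: "\<pi> v = x" for v c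
  proof -
    obtain s where s: "s \<in> carrier (sections k)" "s x = v" using section_through[OF v] by blast
    show ?thesis
      using app[OF sections_closed(3)[OF s(1)], of x] app[OF s(1), of x] by (simp add: fD(3)[OF s(1)] s(2))
  qed
  show ?thesis
    using ext closed add br scale
    by (simp add: centroid_def endomorphisms_def carrier_fiber PiE_iff)
qed

lemma hom_chart_apply:
  assumes "(U, \<phi>) \<in> \<Phi>" "x \<in> U" "g \<in> endomorphisms (\<LL> x)"
  shows "blinfun_apply (hom_chart \<pi> \<phi> x g) w = \<phi> (g (fiber_inv \<phi> x w))"
  unfolding hom_chart_def
  using bounded_linear_chart_conjugate[OF assms(1,2,1,2,3)]
  by (simp add: bounded_linear_Blinfun_apply comp_def)

text \<open>Near x0 the sections s i, equal to \<rho> times e i in the chart, become a constant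
  spanning family after division by \<rho>. Their images under f are again of class
  \<open>Ck\<close>, and they determine the operator by linearity, so no order of differentiability
  is lost.\<close>

lemma fiberwise_in_centroid_sections:
  assumes pc: "perfect_lie_algebra scl bracket \<or> centerfree_lie_algebra bracket"
    and f: "f \<in> carrier (centroid (sections k))"
  shows "fiberwise k f \<in> carrier (centroid_sections k \<A> \<pi> \<LL> \<Phi>)"
proof -
  note app = fiberwise_apply[OF pc f] and fD = centroid_sectionsD[OF f]
  have endo: "fiberwise k f x \<in> endomorphisms (\<LL> x)" for x
    using fiberwise_in_centroid[OF pc f, of x] by (simp add: centroid_def)
  obtain \<xi> :: "'f \<Rightarrow> real ^ 'f coord_index" and Q where
    c: "bounded_linear \<xi>" "bounded_linear Q" "\<And>v. Q (\<xi> v) = v"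
    using finite_dimensional_coordinates[OF fd_fiber] by blast
  \<comment> \<open>These vectors span the fiber but are dependent, there being one too many; only
    the expansion with coefficients \<xi> is used.\<close>
  define e where "e i = Q (axis i 1)" for i
  have expand: "w = (\<Sum>i\<in>UNIV. (\<xi> w $ i) *\<^sub>R e i)" for w
  proof -
    have "\<xi> w = (\<Sum>i\<in>UNIV. (\<xi> w $ i) *\<^sub>R axis i 1)"
      using basis_expansion[of "\<xi> w"] by (simp add: scalar_mult_eq_scaleR)
    then have "Q (\<xi> w) = Q (\<Sum>i\<in>UNIV. (\<xi> w $ i) *\<^sub>R axis i 1)" by simp
    also have "\<dots> = (\<Sum>i\<in>UNIV. (\<xi> w $ i) *\<^sub>R e i)"
      using bounded_linear.linear[OF c(2)] by (simp add: linear_sum linear_cmul e_def)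
    finally show ?thesis by (simp only: c(3))
  qed
  \<comment> \<open>The rank-one operator sending w to the i-th coordinate of w times u. It depends
    on u by a bounded linear map into the operators, so regularity of u passes to regularity in
    operator norm.\<close>
  define L where "L i u = blinfun_scaleR_left u o\<^sub>L Blinfun (\<lambda>w. \<xi> w $ i)" for i and u :: 'f
  have blL: "bounded_linear (L i)" for i
    unfolding L_def
    by (rule bounded_linear_compose[OF
          bounded_bilinear.bounded_linear_left[OF bounded_bilinear_blinfun_compose]
          bounded_linear_blinfun_scaleR_left])
  have L: "blinfun_apply (L i u) w = (\<xi> w $ i) *\<^sub>R u" for i u w
    unfolding L_def
    using bounded_linear_compose[OF bounded_linear_vec_nth c(1), of i]
    by (simp add: bounded_linear_Blinfun_apply)
  have "Ck k V (\<lambda>x. hom_chart \<pi> \<phi> x (fiberwise k f x))" if V: "(V, \<phi>) \<in> \<Phi>" for V \<phi>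
  proof (rule Ck_local)
    fix x0 assume x0: "x0 \<in> V"
    have oV: "open V" by (rule bundle_chart_domain_open[OF V])
    obtain \<rho> :: "'m \<Rightarrow> real" and C where \<rho>: "Ck \<infinity> UNIV \<rho>" "\<And>x. \<rho> x \<ge> 0" "\<rho> x0 > 0" "compact C" "C \<subseteq> V"
      "\<And>x. \<rho> x \<noteq> 0 \<Longrightarrow> x \<in> C"
      using bump_exists[OF oV x0] by metis
    have "\<exists>s. s \<in> carrier (sections k) \<and> (\<forall>x\<in>V. \<phi> (s x) = \<rho> x *\<^sub>R e i)" for i
      apply (rule bump_section[where k = k and u = "\<lambda>_. e i", OF V \<rho>(1) compact_imp_closed[OF \<rho>(4)] \<rho>(5)])
      subgoal by (rule \<rho>(6))
      subgoal by (rule Ck_const)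
      subgoal for s by (intro exI[of _ s]) simp
      done
    then obtain s where "\<And>i. s i \<in> carrier (sections k) \<and> (\<forall>x\<in>V. \<phi> (s i x) = \<rho> x *\<^sub>R e i)" by metis
    then have s: "s i \<in> carrier (sections k)" "x \<in> V \<Longrightarrow> \<phi> (s i x) = \<rho> x *\<^sub>R e i" for i x by auto
    let ?T = "{x. \<rho> x > 0}"
    have oT: "open ?T" by (rule open_Ck_pos[OF \<rho>(1)])
    have TV: "?T \<subseteq> V" using \<rho>(5,6) by force
    have Ckr: "Ck k ?T (\<lambda>x. inverse (\<rho> x))"
      by (rule Ck_inverse[OF oT Ck_subset[OF Ck_infinityD[OF \<rho>(1)]]]) auto
    have "Ck k ?T (\<lambda>x. L i (inverse (\<rho> x) *\<^sub>R \<phi> (f (s i) x)))" for i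
      by (rule Ck_bounded_linear[OF blL oT Ck_scaleR[OF oT Ckr Ck_subset[OF section_Ck[OF fD(1)[OF s(1)] V] TV]]])
    then have sum: "Ck k ?T (\<lambda>x. \<Sum>i\<in>UNIV. L i (inverse (\<rho> x) *\<^sub>R \<phi> (f (s i) x)))"
      by (rule Ck_sum[OF oT])
    have "(\<Sum>i\<in>UNIV. L i (inverse (\<rho> x) *\<^sub>R \<phi> (f (s i) x))) = hom_chart \<pi> \<phi> x (fiberwise k f x)"
      if x: "x \<in> ?T" for x
    proof (rule blinfun_eqI)
      fix w
      have xV: "x \<in> V" using x TV by blast
      let ?g = "\<lambda>w. \<phi> (fiberwise k f x (fiber_inv \<phi> x w))"
      have lin: "linear ?g"
        by (rule bounded_linear.linear[OF bounded_linear_chart_conjugate[OF V xV V xV endo]])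
      have ge: "inverse (\<rho> x) *\<^sub>R \<phi> (f (s i) x) = ?g (e i)" for i
      proof -
        have "fiber_inv \<phi> x (\<rho> x *\<^sub>R e i) = s i x"
          using bundle_chart_fiber_inv(3)[OF V xV section_in_fiber[OF s(1)], of i] s(2)[OF xV, of i] by simp
        then have "?g (\<rho> x *\<^sub>R e i) = \<phi> (f (s i) x)" by (simp add: app[OF s(1)])
        then have "\<phi> (f (s i) x) = \<rho> x *\<^sub>R ?g (e i)" using linear_cmul[OF lin, of "\<rho> x" "e i"] by simp
        then show ?thesis using x by simp
      qed
      have "blinfun_apply (\<Sum>i\<in>UNIV. L i (inverse (\<rho> x) *\<^sub>R \<phi> (f (s i) x))) w =
          (\<Sum>i\<in>UNIV. (\<xi> w $ i) *\<^sub>R ?g (e i))"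
        by (simp only: blinfun.sum_left L ge)
      also have "\<dots> = ?g (\<Sum>i\<in>UNIV. (\<xi> w $ i) *\<^sub>R e i)"
        using linear_sum[OF lin, of "\<lambda>i. (\<xi> w $ i) *\<^sub>R e i" UNIV] linear_cmul[OF lin] by simp
      also have "\<dots> = ?g w" by (simp only: expand[of w, symmetric])
      also have "\<dots> = blinfun_apply (hom_chart \<pi> \<phi> x (fiberwise k f x)) w"
        by (rule hom_chart_apply[OF V xV endo, symmetric])
      finally show "blinfun_apply (\<Sum>i\<in>UNIV. L i (inverse (\<rho> x) *\<^sub>R \<phi> (f (s i) x))) w =
          blinfun_apply (hom_chart \<pi> \<phi> x (fiberwise k f x)) w" .
    qed
    then have "Ck k ?T (\<lambda>x. hom_chart \<pi> \<phi> x (fiberwise k f x))" by (rule Ck_cong[OF sum oT])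
    then show "\<exists>T. open T \<and> x0 \<in> T \<and> Ck k T (\<lambda>x. hom_chart \<pi> \<phi> x (fiberwise k f x))"
      using oT \<rho>(3) by (intro exI[of _ ?T]) simp
  qed
  then show ?thesis
    using endo fiberwise_in_centroid[OF pc f]
    by (simp add: centroid_sections_def hom_sections_def case_prod_beta split_paired_Ball_Sigma)
qed

section \<open>The inverse map and the algebra operations\<close>

lemma centroid_fiberD:
  assumes "g \<in> carrier (centroid (\<LL> x))"
  shows "g \<in> endomorphisms (\<LL> x)" and "\<pi> v = x \<Longrightarrow> \<pi> (g v) = x"
    and "\<pi> v = x \<Longrightarrow> \<pi> w = x \<Longrightarrow> g (lie_add (\<LL> x) v w) = lie_add (\<LL> x) (g v) (g w)"
    and "\<pi> v = x \<Longrightarrow> g (lie_scale (\<LL> x) c v) = lie_scale (\<LL> x) c (g v)"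
    and "\<pi> v = x \<Longrightarrow> \<pi> w = x \<Longrightarrow> g (lie_bracket (\<LL> x) v w) = lie_bracket (\<LL> x) v (g w)"
    and "g \<in> extensional (\<pi> -` {x})"
  using assms by (auto simp: centroid_def endomorphisms_def carrier_fiber PiE_iff)

lemma centroid_sections_carrierD:
  assumes "A \<in> carrier (centroid_sections k \<A> \<pi> \<LL> \<Phi>)"
  shows "A x \<in> carrier (centroid (\<LL> x))"
    and "(U, \<phi>) \<in> \<Phi> \<Longrightarrow> Ck k U (\<lambda>x. hom_chart \<pi> \<phi> x (A x))"
  using assms by (auto simp: centroid_sections_def hom_sections_def)

lemma sectionwise_closed:
  assumes A: "A \<in> carrier (centroid_sections k \<A> \<pi> \<LL> \<Phi>)" and s: "s \<in> carrier (sections k)"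
  shows "(\<lambda>x. A x (s x)) \<in> carrier (sections k)"
  unfolding sections_carrier_iff
proof (intro conjI allI impI)
  note AD = centroid_sections_carrierD[OF A]
  show "\<pi> (A x (s x)) = x" for x by (rule centroid_fiberD(2)[OF AD(1) section_in_fiber[OF s]])
  fix U \<phi> assume U: "(U, \<phi>) \<in> \<Phi>"
  have oU: "open U" by (rule bundle_chart_domain_open[OF U])
  have "Ck k U (\<lambda>x. blinfun_apply (hom_chart \<pi> \<phi> x (A x)) (\<phi> (s x)))"
    by (rule Ck_bilinear[OF bounded_bilinear_blinfun_apply oU AD(2)[OF U] section_Ck[OF s U]])
  then show "Ck k U (\<lambda>x. \<phi> (A x (s x)))"
    by (rule Ck_cong[OF _ oU])
      (simp add: hom_chart_apply[OF U _ centroid_fiberD(1)[OF AD(1)]]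
        bundle_chart_fiber_inv(3)[OF U _ section_in_fiber[OF s]])
qed

lemma sectionwise_in_centroid:
  assumes A: "A \<in> carrier (centroid_sections k \<A> \<pi> \<LL> \<Phi>)"
  shows "sectionwise k A \<in> carrier (centroid (sections k))"
proof -
  note gD = centroid_fiberD[OF centroid_sections_carrierD(1)[OF A]]
  show ?thesis
    by (simp add: centroid_def endomorphisms_def sectionwise_def PiE_iff sectionwise_closed[OF A]
        sections_closed gD(3-5))
qed

lemma fiberwise_sectionwise:
  assumes "perfect_lie_algebra scl bracket \<or> centerfree_lie_algebra bracket"
    and A: "A \<in> carrier (centroid_sections k \<A> \<pi> \<LL> \<Phi>)"
  shows "fiberwise k (sectionwise k A) = A"
proof
  fix x
  show "fiberwise k (sectionwise k A) x = A x"
  proof (rule extensionalityI[of _ "\<pi> -` {x}"])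
    show "fiberwise k (sectionwise k A) x \<in> extensional (\<pi> -` {x})"
      by (simp add: fiberwise_def carrier_fiber)
    show "A x \<in> extensional (\<pi> -` {x})"
      by (rule centroid_fiberD(6)[OF centroid_sections_carrierD(1)[OF A]])
    fix v assume "v \<in> \<pi> -` {x}"
    then obtain s where s: "s \<in> carrier (sections k)" "s x = v" using section_through[of v x] by auto
    show "fiberwise k (sectionwise k A) x v = A x v"
      using fiberwise_apply[OF assms(1) sectionwise_in_centroid[OF A] s(1), of x] s
      by (simp add: sectionwise_def)
  qed
qed

lemma sectionwise_fiberwise:
  assumes "perfect_lie_algebra scl bracket \<or> centerfree_lie_algebra bracket"
    and f: "f \<in> carrier (centroid (sections k))"
  shows "sectionwise k (fiberwise k f) = f"
proof (rule extensionalityI[of _ "carrier (sections k)"])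
  show "sectionwise k (fiberwise k f) \<in> extensional (carrier (sections k))" by (simp add: sectionwise_def)
  show "f \<in> extensional (carrier (sections k))" by (rule centroid_sectionsD(5)[OF f])
  show "sectionwise k (fiberwise k f) s = f s" if "s \<in> carrier (sections k)" for s
    using that fiberwise_apply[OF assms that] by (simp add: sectionwise_def)
qed

text \<open>Reduces each identity of the homomorphism to values of sections. Stated for any f that
  acts on sections through A, it applies to products, sums and multiples without first showing that
  these stay in the centroid.\<close>

lemma fiberwise_eqI:
  assumes pc: "perfect_lie_algebra scl bracket \<or> centerfree_lie_algebra bracket"
    and "\<And>s x. s \<in> carrier (sections k) \<Longrightarrow> f s x = A x (s x)" "\<And>x. A x \<in> extensional (\<pi> -` {x})"
  shows "fiberwise k f = A"
proof
  fix x
  show "fiberwise k f x = A x"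
  proof (rule extensionalityI[OF _ assms(3)])
    show "fiberwise k f x \<in> extensional (\<pi> -` {x})" by (simp add: fiberwise_def carrier_fiber)
    fix v assume v: "v \<in> \<pi> -` {x}"
    let ?t = "SOME t. t \<in> carrier (sections k) \<and> t x = v"
    obtain s where s: "s \<in> carrier (sections k) \<and> s x = v" using section_through[of v x] v by auto
    have "?t \<in> carrier (sections k) \<and> ?t x = v" by (rule someI[of _ s]) (rule s)
    then show "fiberwise k f x v = A x v"
      using assms(2)[of ?t x] v by (simp add: fiberwise_def carrier_fiber)
  qed
qed

theorem centroid_sections_isomorphic:
  assumes pc: "perfect_lie_algebra scl bracket \<or> centerfree_lie_algebra bracket"
  shows "algebra_isomorphic (centroid (sections k)) (centroid_sections k \<A> \<pi> \<LL> \<Phi>)"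
proof -
  let ?A = "centroid (sections k)" and ?B = "centroid_sections k \<A> \<pi> \<LL> \<Phi>"
  note app = fiberwise_apply[OF pc] and fD = centroid_sectionsD
  have "bij_betw (fiberwise k) (carrier ?A) (carrier ?B)"
    by (rule bij_betw_byWitness[where f' = "sectionwise k"])
      (auto simp: sectionwise_fiberwise[OF pc] fiberwise_sectionwise[OF pc]
        fiberwise_in_centroid_sections[OF pc] sectionwise_in_centroid)
  moreover have "fiberwise k (f \<otimes>\<^bsub>?A\<^esub> g) = fiberwise k f \<otimes>\<^bsub>?B\<^esub> fiberwise k g"
    if f: "f \<in> carrier ?A" and g: "g \<in> carrier ?A" for f g
    by (rule fiberwise_eqI[OF pc])
      (simp_all add: centroid_def centroid_sections_def compose_def carrier_fiber
        app[OF f fD(1)[OF g]] app[OF g])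
  moreover have "fiberwise k (f \<oplus>\<^bsub>?A\<^esub> g) = fiberwise k f \<oplus>\<^bsub>?B\<^esub> fiberwise k g"
    if f: "f \<in> carrier ?A" and g: "g \<in> carrier ?A" for f g
    by (rule fiberwise_eqI[OF pc])
      (simp_all add: centroid_def centroid_sections_def carrier_fiber app[OF f] app[OF g])
  moreover have "fiberwise k \<one>\<^bsub>?A\<^esub> = \<one>\<^bsub>?B\<^esub>"
    by (rule fiberwise_eqI[OF pc]) (simp_all add: centroid_def centroid_sections_def carrier_fiber)
  moreover have "fiberwise k (c \<odot>\<^bsub>?A\<^esub> f) = c \<odot>\<^bsub>?B\<^esub> fiberwise k f" if f: "f \<in> carrier ?A" for c f
    by (rule fiberwise_eqI[OF pc])
      (simp_all add: centroid_def centroid_sections_def carrier_fiber app[OF f])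
  ultimately show ?thesis
    unfolding algebra_isomorphic_def ring_iso_def ring_hom_def
    by (intro bexI[of _ "fiberwise k"]) (auto simp: bij_betw_def)
qed

end

theorem theorem2p86:
  fixes \<A> :: "('m::t2_space, 'e::real_normed_vector) atlas"
    and scl :: "'k::real_or_complex \<Rightarrow> 'f::real_normed_vector \<Rightarrow> 'f"
    and bracket :: "'f \<Rightarrow> 'f \<Rightarrow> 'f"
    and \<pi> :: "'l \<Rightarrow> 'm"
    and \<LL> :: "'m \<Rightarrow> ('k, 'l) lie_structure"
    and \<Phi> :: "('l, 'm, 'f) bundle_atlas"
    and k :: enat
  assumes "lie_algebra_bundle \<A> scl bracket \<pi> \<LL> \<Phi>"
    and "perfect_lie_algebra scl bracket \<or> centerfree_lie_algebra bracket"
  shows "algebra_isomorphic (centroid (lie_sections k \<A> \<pi> \<LL> \<Phi>)) (centroid_sections k \<A> \<pi> \<LL> \<Phi>)"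
  using assms by (rule lie_algebra_bundle.centroid_sections_isomorphic)

end
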